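(* Let $0<|q|<1$ and let $n=1,2,3,\dots$. Then $$\Delta(q^2)^{4n^2}=4^{-n(n-1)}q^{-n^2}\prod_{r=1}^{2n-1}(r!)^{-1}\sum_{\substack{y_1,\dots,y_n\ge1\ (\text{all odd})\\ m_1>m_2>\cdots>m_n\ge1\ (\text{all odd})}}m_1m_2\cdots m_n\,q^{m_1y_1+\cdots+m_ny_n}\prod_{1\le r<s\le n}\left(m_r^2-m_s^2\right)^2$$ and $$\Delta(q)^{4n(n+1)}=2^{n}q^{-n(n+1)/2}\prod_{r=1}^{2n}(r!)^{-1}\sum_{\substack{y_1,\dots,y_n\ge1\ (\text{all odd})\\ m_1>m_2>\cdots>m_n\ge1}}(m_1m_2\cdots m_n)^3\,q^{m_1y_1+\cdots+m_ny_n}\prod_{1\le r<s\le n}\left(m_r^2-m_s^2\right)^2,$$ where the $y_i,m_i$ range over integers satisfying the indicated conditions (in the second identity the $m_i$ are not required to be odd).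
   Context: $\Delta(q):=\sum_{j=0}^{\infty}q^{j(j+1)/2}$ (the generating function of triangular numbers). *)

theory Defs
  imports "HOL-Analysis.Analysis"
begin

definition Delta :: "complex \<Rightarrow> complex" where
  "Delta q = (\<Sum>j. q ^ (j * (j + 1) div 2))"

(* Pairs (m, y) of n-tuples, indexed by 1, ..., n.  The extensional function space makes
   each tuple occur exactly once.  M is the set of values allowed for the entries of m;
   the entries of y are odd, hence at least 1. *)
definition tuples :: "nat set \<Rightarrow> nat \<Rightarrow> ((nat \<Rightarrow> nat) \<times> (nat \<Rightarrow> nat)) set" where
  "tuples M n = {(m, y). m \<in> {1..n} \<rightarrow>\<^sub>E M \<and> y \<in> {1..n} \<rightarrow>\<^sub>E {k. odd k} \<and>
                         strict_antimono_on {1..n} m}"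

(* The product over 1 \<le> r < s \<le> n is taken over s = 1, ..., n and, for each s,
   r = 1, ..., s - 1.  The difference of squares is formed in the complex numbers. *)
definition triangular_term :: "nat \<Rightarrow> complex \<Rightarrow> nat \<Rightarrow> (nat \<Rightarrow> nat) \<times> (nat \<Rightarrow> nat) \<Rightarrow> complex" where
  "triangular_term k q n = (\<lambda>(m, y).
     (\<Prod>r=1..n. of_nat (m r)) ^ k * q ^ (\<Sum>r=1..n. m r * y r) *
     (\<Prod>s=1..n. \<Prod>r=1..<s. ((of_nat (m r))\<^sup>2 - (of_nat (m s))\<^sup>2)\<^sup>2))"

end

theory Submission
  imports Defs "HOL-Complex_Analysis.Complex_Analysis" "HOL-Real_Asymp.Real_Asymp"
    "Jordan_Normal_Form.Determinant"
begin

text \<open>Put \<open>\<phi>(t) = \<Sum> a\<^sub>m exp(m t)\<close>, summed over all odd integers \<open>m\<close>, where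
  \<open>a\<^sub>m = 1 / (q\<^sup>-\<^sup>m - q\<^sup>m)\<close>; this is the Jacobi function sn up to scaling. The
  partial fraction expansion of \<open>a\<^sub>m a\<^sub>n\<close> makes the Fourier coefficients of \<open>\<phi>\<^sup>2\<close> and
  \<open>\<phi>\<^sup>3\<close> telescope, whence \<open>\<phi>'' = B \<phi> + 8 \<phi>\<^sup>3\<close> and
  \<open>\<phi>'\<^sup>2 = c\<^sup>2 + B \<phi>\<^sup>2 + 4 \<phi>\<^sup>4\<close>. Hence the second derivative acts on the odd (and on the
  even) powers of \<open>\<phi>\<close> by a tridiagonal matrix, the Taylor coefficients of \<open>\<phi>\<close> and \<open>\<phi>\<^sup>2\<close> are
  moments of Jacobi matrices, and their Hankel determinants are products of off-diagonal entries
  that depend on \<open>q\<close> only through \<open>c = 2 A\<close>, \<open>A = \<Sum> m q\<^sup>m / (1 - q\<^sup>2\<^sup>m)\<close> (\<open>m > 0\<close> odd).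
  By Andreief's identity these determinants are the multiple sums of the theorem (for the second
  sum with \<open>q\<^sup>2\<close> in place of \<open>q\<close>).

  There remains \<open>A = q \<Delta>(q\<^sup>2)\<^sup>4\<close>. The value of \<open>\<phi>\<^sup>2\<close> at a quarter period shows
  \<open>A(q\<^sup>2) = F(q)\<^sup>2\<close> for \<open>F = \<Sum> q\<^sup>m / (1 + q\<^sup>2\<^sup>m)\<close>. Writing \<open>\<phi>\<close> as a quotient of two theta
  series and comparing two of its values relates \<open>F(q)\<close> to \<open>F(q\<^sup>2)\<close>; the function
  \<open>F(q) / (q \<Delta>(q\<^sup>4)\<^sup>2)\<close> turns out to be invariant under \<open>q \<mapsto> q\<^sup>2\<close>, and therefore it equals its
  limit \<open>1\<close> at \<open>0\<close>.\<close>

subsection \<open>Hankel determinants of moments of Jacobi matrices\<close>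

text \<open>Row 0, column \<open>n\<close> of the \<open>k\<close>-th power of the infinite
  tridiagonal matrix with superdiagonal \<open>u\<close>, diagonal \<open>d\<close> and subdiagonal
  \<open>l\<close>. The subdiagonal is counted from 1: \<open>l (Suc n)\<close> leads from index
  \<open>Suc n\<close> to \<open>n\<close>. Column 0 holds the moments.\<close>

fun jacobi_moment :: "(nat \<Rightarrow> 'a::field) \<Rightarrow> (nat \<Rightarrow> 'a) \<Rightarrow> (nat \<Rightarrow> 'a) \<Rightarrow> nat \<Rightarrow> nat \<Rightarrow> 'a" where
  "jacobi_moment u d l 0 n = (if n = 0 then 1 else 0)"
| "jacobi_moment u d l (Suc k) n =
     (case n of 0 \<Rightarrow> 0 | Suc m \<Rightarrow> jacobi_moment u d l k m * u m)
     + jacobi_moment u d l k n * d n + jacobi_moment u d l k (Suc n) * l (Suc n)"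

lemma jacobi_moment_eq_0: "k < n \<Longrightarrow> jacobi_moment u d l k n = 0"
  by (induction k arbitrary: n) (auto split: nat.split)

lemma jacobi_moment_diag: "jacobi_moment u d l k k = (\<Prod>i<k. u i)"
  by (induction k) (auto simp: jacobi_moment_eq_0 mult.commute)

text \<open>The weights \<open>\<Prod>k<n. l (Suc k) / u k\<close> make the tridiagonal matrix
  symmetric, so one factor of it can be moved across the weighted scalar product; induction on
  \<open>j\<close> moves all of them to one side.\<close>

lemma jacobi_moment_add:
  fixes u d l :: "nat \<Rightarrow> 'a::field"
  assumes u: "\<And>i. u i \<noteq> 0" and N: "i + j < N"
  shows "jacobi_moment u d l (i + j) 0 =
    (\<Sum>n<N. jacobi_moment u d l i n * jacobi_moment u d l j n * (\<Prod>k<n. l (Suc k) / u k))"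
  using N
proof (induction j arbitrary: i)
  case 0
  have "(\<Sum>n<N. jacobi_moment u d l i n * jacobi_moment u d l 0 n * (\<Prod>k<n. l (Suc k) / u k))
    = (\<Sum>n\<in>{0}. jacobi_moment u d l i n * jacobi_moment u d l 0 n * (\<Prod>k<n. l (Suc k) / u k))"
    by (rule sum.mono_neutral_right) (use 0 in auto)
  then show ?case by simp
next
  case (Suc j)
  let ?P = "jacobi_moment u d l"
  define w where "w n = (\<Prod>k<n. l (Suc k) / u k)" for n
  have w: "w (Suc n) * u n = w n * l (Suc n)" for n
    by (simp add: w_def u)
  obtain M where N: "N = Suc M" using Suc.prems by (cases N) auto
  \<comment> \<open>Truncation at \<open>N\<close> leaves only products involving the border indices
    \<open>M\<close> and \<open>N\<close>; they vanish because \<open>i + j < M\<close>.\<close>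
  have z: "?P i N = 0" "?P j N = 0" "?P i M = 0 \<or> ?P j M = 0" "?P i M * ?P j N = 0" "?P i N * ?P j M = 0"
    using Suc.prems N by (auto simp: jacobi_moment_eq_0)
  have up: "(\<Sum>n<N. (case n of 0 \<Rightarrow> 0 | Suc m \<Rightarrow> ?P a m * u m) * ?P b n * w n)
     = (\<Sum>n<N. ?P a n * ?P b (Suc n) * l (Suc n) * w n)" 
    if "?P a M * ?P b N = 0" for a b
  proof -
    have "(\<Sum>n<N. (case n of 0 \<Rightarrow> 0 | Suc m \<Rightarrow> ?P a m * u m) * ?P b n * w n)
       = (\<Sum>n<M. ?P a n * u n * ?P b (Suc n) * w (Suc n))"
      unfolding N by (subst sum.lessThan_Suc_shift) simp
    also have "\<dots> = (\<Sum>n<M. ?P a n * ?P b (Suc n) * l (Suc n) * w n)"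
      by (rule sum.cong) (auto simp: w mult_ac, metis w mult.commute mult.left_commute)
    also have "\<dots> = (\<Sum>n<N. ?P a n * ?P b (Suc n) * l (Suc n) * w n)"
      using that unfolding N by auto
    finally show ?thesis .
  qed
  have "(\<Sum>n<N. ?P (Suc i) n * ?P j n * w n) = (\<Sum>n<N. ?P i n * ?P (Suc j) n * w n)"
    using up[of i j] up[of j i] z
    by (simp add: ring_distribs sum.distrib mult_ac)
  then show ?case
    using Suc.IH[of "Suc i"] Suc.prems by (simp add: w_def)
qed

definition hankel_det :: "nat \<Rightarrow> (nat \<Rightarrow> 'a::comm_ring_1) \<Rightarrow> 'a" where
  "hankel_det n \<mu> = Determinant.det (Matrix.mat n n (\<lambda>(i, j). \<mu> (i + j)))"

lemma hankel_det_cmult: "hankel_det n (\<lambda>k. a * \<mu> k) = a ^ n * hankel_det n \<mu>"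
proof -
  have "Matrix.mat n n (\<lambda>(i, j). a * \<mu> (i + j)) = a \<cdot>\<^sub>m Matrix.mat n n (\<lambda>(i, j). \<mu> (i + j))"
    by (intro eq_matI) auto
  then show ?thesis by (simp add: hankel_det_def)
qed

text \<open>By \<open>jacobi_moment_add\<close> the Hankel matrix is a lower times an upper
  triangular matrix. The value does not see the diagonal \<open>d\<close>, which is why the constant
  \<open>B\<close> of the differential equation never has to be determined.\<close>

lemma hankel_det_jacobi_moment:
  fixes u d l :: "nat \<Rightarrow> 'a::field"
  assumes u: "\<And>i. u i \<noteq> 0"
  shows "hankel_det n (\<lambda>k. jacobi_moment u d l k 0) =
    (\<Prod>m<n. \<Prod>i<m. u i * l (Suc i))"
proof -
  let ?P = "jacobi_moment u d l"
  define w where "w n = (\<Prod>k<n. l (Suc k) / u k)" for n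
  define A where "A = Matrix.mat n n (\<lambda>(i, k). ?P i k)"
  define B where "B = Matrix.mat n n (\<lambda>(k, j). ?P j k * w k)"
  have carr: "A \<in> carrier_mat n n" "B \<in> carrier_mat n n" by (auto simp: A_def B_def)
  have eq: "Matrix.mat n n (\<lambda>(i, j). ?P (i + j) 0) = A * B"
  proof (rule eq_matI)
    fix i j assume ij: "i < dim_row (A * B)" "j < dim_col (A * B)"
    then have ij: "i < n" "j < n" by (auto simp: A_def B_def)
    have "?P (i + j) 0 = (\<Sum>k<i+j+1+n. ?P i k * ?P j k * w k)"
      unfolding w_def by (rule jacobi_moment_add) (auto simp: u)
    also have "\<dots> = (\<Sum>k\<in>{0..<n}. ?P i k * ?P j k * w k)"
      by (rule sum.mono_neutral_right) (use ij in \<open>auto simp: jacobi_moment_eq_0\<close>)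
    finally show "Matrix.mat n n (\<lambda>(i, j). ?P (i + j) 0) $$ (i, j) = (A * B) $$ (i, j)"
      using ij by (simp add: A_def B_def scalar_prod_def mult_ac)
  qed (auto simp: A_def B_def)
  have "Determinant.det A = (\<Prod>m<n. ?P m m)"
    by (subst det_lower_triangular[OF _ carr(1)])
       (auto simp: A_def jacobi_moment_eq_0 prod_list_diag_prod atLeast0LessThan)
  moreover have "Determinant.det B = (\<Prod>m<n. ?P m m * w m)"
    by (subst det_upper_triangular[OF _ carr(2)])
       (auto simp: B_def jacobi_moment_eq_0 prod_list_diag_prod atLeast0LessThan)
  moreover have "?P m m * (?P m m * w m) = (\<Prod>i<m. u i * l (Suc i))" for m
    by (simp add: jacobi_moment_diag w_def u flip: prod.distrib)
  ultimately show ?thesis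
    using carr by (simp add: hankel_det_def eq det_mult flip: prod.distrib)
qed

subsection \<open>Exponential series with rapidly decreasing coefficients\<close>

definition moment :: "(int \<Rightarrow> complex) \<Rightarrow> nat \<Rightarrow> complex" where
  "moment b k = (\<Sum>\<^sub>\<infinity>m. b m * of_int m ^ k)"

text \<open>Over the complex numbers this summability is absolute, which is what multiplying and
  rearranging exponential series term by term requires.\<close>

definition rapid :: "(int \<Rightarrow> complex) \<Rightarrow> bool" where
  "rapid b \<longleftrightarrow> (\<forall>k. (\<lambda>m. b m * of_int m ^ k) summable_on UNIV)"

definition conv :: "(int \<Rightarrow> complex) \<Rightarrow> (int \<Rightarrow> complex) \<Rightarrow> int \<Rightarrow> complex" where
  "conv b c N = (\<Sum>\<^sub>\<infinity>m. b m * c (N - m))"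

lemma rapid_summable: "rapid b \<Longrightarrow> (\<lambda>m. b m * of_int m ^ k) summable_on A"
  unfolding rapid_def by (rule summable_on_subset[of _ UNIV]) auto

lemma summable_on_comparison_complex:
  fixes f :: "'a \<Rightarrow> complex" and g :: "'a \<Rightarrow> real"
  assumes "g summable_on A" "\<And>x. x \<in> A \<Longrightarrow> norm (f x) \<le> g x"
  shows "f summable_on A"
  unfolding summable_on_iff_abs_summable_on_complex
  by (rule Infinite_Sum.abs_summable_on_comparison_test'[OF assms])

lemma has_sum_finite_sum:
  fixes f :: "'i \<Rightarrow> 'a \<Rightarrow> 'b::topological_comm_monoid_add"
  assumes "finite I" "\<And>i. i \<in> I \<Longrightarrow> (f i has_sum s i) A"
  shows "((\<lambda>x. \<Sum>i\<in>I. f i x) has_sum (\<Sum>i\<in>I. s i)) A"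
  using assms by (induction I rule: finite_induct) (auto intro: has_sum_add)

lemma has_sum_product_complex:
  fixes f :: "'a \<Rightarrow> complex" and g :: "'b \<Rightarrow> complex"
  assumes f: "(f has_sum a) A" and g: "(g has_sum b) B"
  shows "((\<lambda>(x, y). f x * g y) has_sum a * b) (A \<times> B)"
proof (rule has_sum_SigmaI)
  show "((\<lambda>y. case (x, y) of (x, y) \<Rightarrow> f x * g y) has_sum f x * b) B" for x
    using g by (simp add: has_sum_cmult_right)
  show "((\<lambda>x. f x * b) has_sum a * b) A"
    using f by (rule has_sum_cmult_left)
  have "(\<lambda>x. norm (f x)) summable_on A" "(\<lambda>y. norm (g y)) summable_on B"
    using f g has_sum_imp_summable summable_on_iff_abs_summable_on_complex by blast+
  then show "(\<lambda>(x, y). f x * g y) summable_on A \<times> B"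
    unfolding summable_on_iff_abs_summable_on_complex Infinite_Sum.abs_summable_on_Sigma_iff
    by (auto simp: norm_mult infsum_cmult_right' abs_mult infsum_nonneg
        intro!: summable_on_cmult_right summable_on_cmult_left)
qed

lemma bij_shear: "bij_betw (\<lambda>(N::int, m). (m, N - m)) UNIV UNIV"
  by (rule bij_betwI[where g = "\<lambda>(m, n). (m + n, m)"]) auto

context
  fixes b c :: "int \<Rightarrow> complex"
  assumes b: "rapid b" and c: "rapid c"
begin

text \<open>The shear \<open>N = m + n\<close> reduces this to the product of two series, and the
  binomial theorem expands \<open>(m + n) ^ k\<close>. Summability over pairs then justifies summing
  over \<open>m\<close> first.\<close>

lemma has_sum_conv_pairs:
  "((\<lambda>(N, m). b m * c (N - m) * of_int N ^ k) has_sum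
     (\<Sum>i\<le>k. of_nat (k choose i) * (moment b i * moment c (k - i)))) (UNIV \<times> UNIV)"
proof -
  define f where "f i = (\<lambda>(m, n). (b m * of_int m ^ i) * (c n * of_int n ^ (k - i)))" for i
  have "(f i has_sum moment b i * moment c (k - i)) (UNIV \<times> UNIV)" for i
    unfolding f_def moment_def
    by (rule has_sum_product_complex) (use b c in \<open>auto simp: rapid_def\<close>)
  then have "((\<lambda>p. \<Sum>i\<le>k. of_nat (k choose i) * f i p) has_sum
      (\<Sum>i\<le>k. of_nat (k choose i) * (moment b i * moment c (k - i)))) UNIV"
    by (intro has_sum_finite_sum has_sum_cmult_right) auto
  then have "((\<lambda>p. \<Sum>i\<le>k. of_nat (k choose i) * f i ((\<lambda>(N, m). (m, N - m)) p)) has_sum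
      (\<Sum>i\<le>k. of_nat (k choose i) * (moment b i * moment c (k - i)))) UNIV"
    by (subst has_sum_reindex_bij_betw[OF bij_shear])
  moreover have "(\<Sum>i\<le>k. of_nat (k choose i) * f i ((\<lambda>(N, m). (m, N - m)) p)) =
      (\<lambda>(N, m). b m * c (N - m) * of_int N ^ k) p" for p
  proof -
    obtain N m where p: "p = (N, m)" by (cases p)
    have "of_int N ^ k = (of_int m + of_int (N - m) :: complex) ^ k" by simp
    also have "\<dots> = (\<Sum>i\<le>k. of_nat (k choose i) * of_int m ^ i * of_int (N - m) ^ (k - i))"
      by (rule binomial_ring)
    finally show ?thesis
      by (simp add: p f_def sum_distrib_left mult_ac)
  qed
  ultimately show ?thesis by simp
qed

lemma summable_conv_pairs: "(\<lambda>(N, m). b m * c (N - m) * of_int N ^ k) summable_on UNIV \<times> UNIV"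
  using has_sum_conv_pairs by (rule has_sum_imp_summable)

lemma has_sum_conv: "((\<lambda>m. b m * c (N - m)) has_sum conv b c N) UNIV"
  unfolding conv_def
  using summable_on_SigmaD1[OF summable_conv_pairs[of 0], of N] by simp

lemma has_sum_moment_conv:
  "((\<lambda>N. conv b c N * of_int N ^ k) has_sum
     (\<Sum>i\<le>k. of_nat (k choose i) * (moment b i * moment c (k - i)))) UNIV"
proof -
  have *: "(\<Sum>\<^sub>\<infinity>m. b m * c (N - m) * of_int N ^ k) = conv b c N * of_int N ^ k" for N
    unfolding conv_def by (rule infsum_cmult_left')
  show ?thesis
    using summable_on_Sigma_banach[OF summable_conv_pairs[of k]]
      infsum_Sigma'_banach[OF summable_conv_pairs[of k]] infsumI[OF has_sum_conv_pairs[of k]]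
    by (simp only: * has_sum_iff)
qed

lemma rapid_conv: "rapid (conv b c)"
  unfolding rapid_def using has_sum_moment_conv has_sum_imp_summable by blast

lemma moment_conv:
  "moment (conv b c) k = (\<Sum>i\<le>k. of_nat (k choose i) * (moment b i * moment c (k - i)))"
  unfolding moment_def[of "conv b c"] using has_sum_moment_conv by (rule infsumI)

end

text \<open>The formal Taylor expansion at 0 of the sum of \<open>b m * exp (m * t)\<close>. In this
  form only the moments have to converge; no function of \<open>t\<close> is handled.\<close>

definition exp_series :: "(int \<Rightarrow> complex) \<Rightarrow> complex fps" where
  "exp_series b = Abs_fps (\<lambda>k. moment b k / fact k)"

lemma exp_series_nth: "fps_nth (exp_series b) k = moment b k / fact k"
  by (simp add: exp_series_def)

lemma exp_series_conv:
  assumes "rapid b" "rapid c"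
  shows "exp_series (conv b c) = exp_series b * exp_series c"
proof (rule fps_ext)
  fix k
  have "of_nat (k choose i) * (moment b i * moment c (k - i)) / fact k =
        moment b i / fact i * (moment c (k - i) / fact (k - i))" if "i \<le> k" for i
    using that by (simp add: binomial_fact)
  then show "fps_nth (exp_series (conv b c)) k = fps_nth (exp_series b * exp_series c) k"
    by (simp add: exp_series_nth fps_mult_nth moment_conv[OF assms] sum_divide_distrib atMost_atLeast0)
qed

lemma fps_deriv_exp_series: "fps_deriv (exp_series b) = exp_series (\<lambda>m. of_int m * b m)"
proof (rule fps_ext)
  fix k
  have "moment (\<lambda>m. of_int m * b m) k = moment b (Suc k)"
    by (simp add: moment_def mult_ac)
  then show "fps_nth (fps_deriv (exp_series b)) k = fps_nth (exp_series (\<lambda>m. of_int m * b m)) k"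
    by (simp add: exp_series_nth field_simps del: of_nat_Suc)
qed

lemma rapid_cmult: "rapid b \<Longrightarrow> rapid (\<lambda>m. c * b m)"
  by (simp add: rapid_def summable_on_cmult_right mult.assoc)

lemma exp_series_cmult: "exp_series (\<lambda>m. c * b m) = fps_const c * exp_series b"
  by (rule fps_ext) (simp add: exp_series_nth moment_def infsum_cmult_right' mult.assoc)

lemma exp_series_add:
  assumes "rapid b" "rapid c"
  shows "exp_series (\<lambda>m. b m + c m) = exp_series b + exp_series c"
proof (rule fps_ext)
  fix k
  have "moment (\<lambda>m. b m + c m) k = moment b k + moment c k"
    unfolding moment_def ring_distribs
    by (rule infsum_add) (use assms in \<open>auto simp: rapid_def\<close>)
  then show "fps_nth (exp_series (\<lambda>m. b m + c m)) k = fps_nth (exp_series b + exp_series c) k"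
    by (simp add: exp_series_nth add_divide_distrib)
qed

section \<open>Summability over the integers from geometric bounds\<close>

lemma summable_on_int_split:
  fixes f :: "int \<Rightarrow> real"
  assumes "(\<lambda>n. f (int n)) summable_on UNIV" "(\<lambda>n. f (- int n)) summable_on UNIV"
  shows "f summable_on UNIV"
proof -
  have "f summable_on range int"
    using assms(1) by (subst summable_on_reindex) (auto simp: o_def)
  moreover have "f summable_on range (\<lambda>n. - int n)"
    using assms(2) by (subst summable_on_reindex) (auto simp: o_def inj_on_def)
  moreover have "UNIV = range int \<union> range (\<lambda>n. - int n)"
    by (auto simp: image_iff) (metis int_cases2)
  ultimately show ?thesis by (metis summable_on_union)
qed

lemma summable_power_geometric:
  fixes r :: real assumes "0 \<le> r" "r < 1"
  shows "(\<lambda>n. real n ^ k * r ^ n) summable_on UNIV"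
proof (rule summable_nonneg_imp_summable_on)
  show "summable (\<lambda>n. real n ^ k * r ^ n)"
  proof (cases "r = 0")
    case True
    show ?thesis by (rule summable_finite[of "{0}"]) (auto simp: True)
  next
    case False
    define s where "s = (1 + r) / 2"
    have s: "r < s" "s < 1" using assms by (auto simp: s_def)
    have "(\<lambda>n. real n ^ k * r ^ n) \<in> O(\<lambda>n. s ^ n)"
      using assms s False by real_asymp
    then show ?thesis
      by (rule summable_comparison_test_bigo[rotated]) (use assms s in \<open>auto intro!: summable_geometric\<close>)
  qed
qed (use assms in auto)

lemma rapid_geometric:
  assumes r: "0 \<le> r" "r < 1" and le: "\<And>m. norm (b m) \<le> C * r ^ nat \<bar>m\<bar>"
  shows "rapid b"
  unfolding rapid_def
proof
  fix k
  have "(\<lambda>m::int. C * (real (nat \<bar>m\<bar>) ^ k * r ^ nat \<bar>m\<bar>)) summable_on UNIV"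
    by (rule summable_on_cmult_right, rule summable_on_int_split)
       (simp_all add: summable_power_geometric[OF r])
  then show "(\<lambda>m. b m * of_int m ^ k) summable_on UNIV"
  proof (rule summable_on_comparison_complex)
    fix m :: int
    have "norm (b m * of_int m ^ k) = norm (b m) * real (nat \<bar>m\<bar>) ^ k"
      by (simp add: norm_mult norm_power)
    also have "\<dots> \<le> C * r ^ nat \<bar>m\<bar> * real (nat \<bar>m\<bar>) ^ k"
      by (intro mult_right_mono le) auto
    finally show "norm (b m * of_int m ^ k) \<le> C * (real (nat \<bar>m\<bar>) ^ k * r ^ nat \<bar>m\<bar>)"
      by (simp add: mult_ac)
  qed
qed

subsection \<open>Convolutions of the cosecant sequence\<close>

lemma has_sum_odd_iff:
  "((\<lambda>m::int. if odd m then f m else 0) has_sum S) UNIV \<longleftrightarrow> ((\<lambda>j. f (2 * j - 1)) has_sum S) UNIV"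
proof -
  have "range (\<lambda>j::int. 2 * j - 1) = {m. odd m}"
    by (auto simp: image_iff elim!: oddE) presburger
  then have "((\<lambda>j. f (2 * j - 1)) has_sum S) UNIV \<longleftrightarrow> (f has_sum S) {m. odd m}"
    by (subst has_sum_reindex[symmetric, of "\<lambda>j. 2 * j - 1" UNIV f, unfolded o_def])
       (auto simp: inj_on_def)
  also have "\<dots> \<longleftrightarrow> ((\<lambda>m::int. if odd m then f m else 0) has_sum S) UNIV"
    by (rule has_sum_cong_neutral) auto
  finally show ?thesis ..
qed

lemma has_sum_even_iff:
  "((\<lambda>m::int. if even m then f m else 0) has_sum S) UNIV \<longleftrightarrow> ((\<lambda>j. f (2 * j)) has_sum S) UNIV"
proof -
  have "range (\<lambda>j::int. 2 * j) = {m. even m}"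
    by (auto simp: image_iff elim!: evenE)
  then have "((\<lambda>j. f (2 * j)) has_sum S) UNIV \<longleftrightarrow> (f has_sum S) {m. even m}"
    by (subst has_sum_reindex[symmetric, of "\<lambda>j. 2 * j" UNIV f, unfolded o_def])
       (auto simp: inj_on_def)
  also have "\<dots> \<longleftrightarrow> ((\<lambda>m::int. if even m then f m else 0) has_sum S) UNIV"
    by (rule has_sum_cong_neutral) auto
  finally show ?thesis ..
qed

lemma has_sum_int_shift:
  fixes f :: "int \<Rightarrow> 'a::{comm_monoid_add, topological_space}"
  shows "((\<lambda>m. f (m - k)) has_sum S) UNIV \<longleftrightarrow> (f has_sum S) UNIV"
  by (rule has_sum_reindex_bij_betw) (rule bij_betwI[where g = "\<lambda>m. m + k"], auto)

lemma has_sum_int_uminus: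
  fixes f :: "int \<Rightarrow> 'a::{comm_monoid_add, topological_space}"
  shows "((\<lambda>m. f (- m)) has_sum S) UNIV \<longleftrightarrow> (f has_sum S) UNIV"
  by (rule has_sum_reindex_bij_betw) (rule bij_betwI[where g = uminus], auto)

lemma has_sum_odd_function:
  fixes f :: "int \<Rightarrow> complex"
  assumes "f summable_on UNIV" "\<And>m. f (- m) = - f m"
  shows "(f has_sum 0) UNIV"
proof -
  obtain S where S: "(f has_sum S) UNIV" using assms(1) by (auto simp: summable_on_def)
  then have "((\<lambda>m. f (- m)) has_sum S) UNIV" by (simp add: has_sum_int_uminus)
  then have "((\<lambda>m. - f m) has_sum S) UNIV" by (simp add: assms(2))
  moreover have "((\<lambda>m. - f m) has_sum - S) UNIV" using S by (rule has_sum_uminusI)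
  ultimately have "S = - S" using has_sum_unique by blast
  then show ?thesis using S by simp
qed

text \<open>The bracket is the indicator of \<open>{1..l}\<close> for \<open>l \<ge> 0\<close> and
  minus that of \<open>{l+1..0}\<close> for \<open>l < 0\<close>, so for both signs the sum is the
  antidifference \<open>G\<close>.\<close>

lemma has_sum_step_difference:
  fixes g G :: "int \<Rightarrow> complex"
  assumes "G 0 = 0" "\<And>l. G (l + 1) = G l + g (l + 1)"
  shows "((\<lambda>j. g j * (of_bool (j > 0) - of_bool (j > l))) has_sum G l) UNIV"
proof -
  have pt: "((\<lambda>j. if j = l then g l else 0) has_sum g l) UNIV" for l :: int
    by (rule has_sum_finite_neutralI[of "{l}"]) auto
  show ?thesis
  proof (induction l rule: int_induct[where k = 0])
    case base
    then show ?case by (simp add: assms(1))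
  next
    case (step1 l)
    have "((\<lambda>j. g j * (of_bool (j > 0) - of_bool (j > l)) + (if j = l + 1 then g (l + 1) else 0))
        has_sum G l + g (l + 1)) UNIV"
      by (intro has_sum_add step1 pt)
    also have "(\<lambda>j. g j * (of_bool (j > 0) - of_bool (j > l)) + (if j = l + 1 then g (l + 1) else 0))
        = (\<lambda>j. g j * (of_bool (j > 0) - of_bool (j > l + 1)))"
      by (rule ext) (auto simp: of_bool_def)
    finally show ?case by (simp add: assms(2))
  next
    case (step2 l)
    have "((\<lambda>j. g j * (of_bool (j > 0) - of_bool (j > l)) + - (if j = l then g l else 0))
        has_sum G l + - g l) UNIV"
      by (intro has_sum_add step2 pt has_sum_uminusI)
    also have "(\<lambda>j. g j * (of_bool (j > 0) - of_bool (j > l)) + - (if j = l then g l else 0))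
        = (\<lambda>j. g j * (of_bool (j > 0) - of_bool (j > l - 1)))"
      by (rule ext) (auto simp: of_bool_def)
    finally show ?case using assms(2)[of "l - 1"] by simp
  qed
qed

text \<open>With \<open>q = exp (- h)\<close>, \<open>csch q m\<close> is half the hyperbolic cosecant and
  \<open>2 * kap q m - 1\<close> the hyperbolic cotangent of \<open>m h\<close>; \<open>eps q\<close> is the odd, rapidly decreasing
  difference of \<open>kap q\<close> and the unit step. All three vanish at \<open>0\<close>, for \<open>csch\<close> and \<open>kap\<close>
  because of \<open>inverse 0 = 0\<close>.\<close>

definition csch :: "complex \<Rightarrow> int \<Rightarrow> complex" where
  "csch q m = inverse (q powi (- m) - q powi m)"

definition kap :: "complex \<Rightarrow> int \<Rightarrow> complex" where
  "kap q m = inverse (1 - q powi (2 * m))"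

definition eps :: "complex \<Rightarrow> int \<Rightarrow> complex" where
  "eps q m = (if m = 0 then 0 else kap q m - of_bool (m > 0))"

definition odd_csch :: "complex \<Rightarrow> int \<Rightarrow> complex" where
  "odd_csch q m = (if odd m then csch q m else 0)"

lemma csch_0 [simp]: "csch q 0 = 0"
  by (simp add: csch_def)

lemma csch_uminus: "csch q (- m) = - csch q m"
  by (simp add: csch_def flip: inverse_minus_eq)

lemma odd_csch_uminus: "odd_csch q (- m) = - odd_csch q m"
  by (simp add: odd_csch_def csch_uminus)

locale nome =
  fixes q :: complex
  assumes q_nz: "q \<noteq> 0" and q_lt1: "norm q < 1"
begin

lemma powi_double_neq_1:
  assumes "m \<noteq> 0"
  shows "q powi (2 * m) \<noteq> 1"
proof
  assume eq: "q powi (2 * m) = 1"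
  have "norm q ^ nat \<bar>2 * m\<bar> < 1"
    using assms q_lt1 by (simp add: power_less_one_iff)
  moreover have "q ^ nat \<bar>2 * m\<bar> = 1"
  proof (cases "m \<ge> 0")
    case True
    then show ?thesis using eq by (simp add: power_int_def)
  next
    case False
    then have "inverse (q ^ nat \<bar>2 * m\<bar>) = 1" using eq by (simp add: power_int_def power_inverse)
    then show ?thesis by simp
  qed
  ultimately show False by (metis less_irrefl norm_one norm_power)
qed

lemma powi_add: "q powi (m + n) = q powi m * q powi n"
  using q_nz by (simp add: power_int_add)

lemma powi_double: "q powi (2 * m) = (q powi m)\<^sup>2"
  by (metis mult.commute power_int_mult power_int_numeral)

lemma csch_alt: "csch q m = q powi m / (1 - q powi (2 * m))"
proof (cases "m = 0")
  case False
  define x where "x = q powi m"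
  have "x \<noteq> 0" "x\<^sup>2 \<noteq> 1"
    using q_nz powi_double_neq_1[OF False] by (simp_all add: x_def powi_double)
  then have "inverse (inverse x - x) = x / (1 - x\<^sup>2)"
    by (simp add: field_simps power2_eq_square)
  then show ?thesis
    by (simp add: csch_def power_int_minus powi_double x_def)
qed simp

lemma kap_uminus:
  assumes "m \<noteq> 0"
  shows "kap q (- m) = 1 - kap q m"
proof -
  define X where "X = q powi (2 * m)"
  have X: "X \<noteq> 0" "X \<noteq> 1" "q powi (2 * - m) = inverse X"
    using q_nz powi_double_neq_1[OF assms] by (simp_all add: X_def power_int_minus)
  then show ?thesis
    unfolding kap_def X(3) X_def[symmetric] by (simp add: divide_simps) (simp add: algebra_simps)
qed

lemma eps_uminus: "eps q (- m) = - eps q m"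
  unfolding eps_def by (cases "m = 0") (simp_all add: kap_uminus)

text \<open>This is 1 / (sinh a sinh b) = (coth a + coth b) / sinh (a + b) in exponential form. With
  \<open>n = N - m\<close> the bracket becomes \<open>kap q m - kap q (m - N)\<close>, so that sums
  over \<open>m\<close> telescope.\<close>

lemma csch_mult:
  assumes "m \<noteq> 0" "n \<noteq> 0" "m + n \<noteq> 0"
  shows "csch q m * csch q n = csch q (m + n) * (kap q m - kap q (- n))"
proof -
  define x y where "x = q powi m" and "y = q powi n"
  have nz: "x \<noteq> 0" "y \<noteq> 0" "x\<^sup>2 \<noteq> 1" "y\<^sup>2 \<noteq> 1" "x\<^sup>2 * y\<^sup>2 \<noteq> 1"
    using assms powi_double_neq_1[of m] powi_double_neq_1[of n] powi_double_neq_1[of "m + n"] q_nz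
    by (simp_all add: x_def y_def powi_double powi_add power_mult_distrib)
  have 1: "csch q m * csch q n = x * y / ((1 - x\<^sup>2) * (1 - y\<^sup>2))"
    by (simp add: csch_alt powi_double x_def y_def)
  have 2: "csch q (m + n) = x * y / (1 - x\<^sup>2 * y\<^sup>2)"
    by (simp add: csch_alt powi_double powi_add x_def y_def power_mult_distrib)
  have "kap q m - kap q (- n) = inverse (1 - x\<^sup>2) - (1 - inverse (1 - y\<^sup>2))"
    using assms by (subst kap_uminus) (simp_all add: kap_def powi_double x_def y_def)
  also have "\<dots> = (1 - x\<^sup>2 * y\<^sup>2) / ((1 - x\<^sup>2) * (1 - y\<^sup>2))"
    using nz by (simp add: divide_simps) (simp add: algebra_simps)
  finally have 3: "kap q m - kap q (- n) = (1 - x\<^sup>2 * y\<^sup>2) / ((1 - x\<^sup>2) * (1 - y\<^sup>2))" .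
  have "a / E = a / D * (D / E)" if "D \<noteq> 0" for a D E :: complex
    using that by simp
  moreover have "1 - x\<^sup>2 * y\<^sup>2 \<noteq> 0" using nz(5) by simp
  ultimately show ?thesis unfolding 1 2 3 by blast
qed

lemma norm_one_minus_power_ge: "k > 0 \<Longrightarrow> norm (1 - q ^ k) \<ge> 1 - norm q"
proof -
  assume k: "k > 0"
  have "norm q ^ k \<le> norm q ^ 1"
    using k q_lt1 by (intro power_decreasing) auto
  then show ?thesis
    using norm_triangle_ineq2[of 1 "q ^ k"] by (simp add: norm_power)
qed

lemma norm_csch_le: "norm (csch q m) \<le> inverse (1 - norm q) * norm q ^ nat \<bar>m\<bar>"
proof -
  have pos: "norm (csch q (int n)) \<le> inverse (1 - norm q) * norm q ^ n" for n
  proof (cases "n = 0")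
    case True
    then show ?thesis using q_lt1 by simp
  next
    case False
    have "csch q (int n) = q ^ n / (1 - q ^ (2 * n))"
      by (simp add: csch_alt flip: power_int_of_nat)
    then have "norm (csch q (int n)) = norm q ^ n / norm (1 - q ^ (2 * n))"
      by (simp add: norm_divide norm_power)
    also have "\<dots> \<le> norm q ^ n / (1 - norm q)"
      using norm_one_minus_power_ge[of "2 * n"] False q_lt1
      by (intro divide_left_mono mult_pos_pos) auto
    finally show ?thesis by (simp add: field_simps)
  qed
  show ?thesis
  proof (cases "m \<ge> 0")
    case True
    then show ?thesis using pos[of "nat m"] by simp
  next
    case False
    then show ?thesis using pos[of "nat (- m)"] by (simp add: csch_uminus)
  qed
qed

lemma norm_eps_le: "norm (eps q m) \<le> inverse (1 - norm q) * norm q ^ nat \<bar>m\<bar>"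
proof -
  have pos: "norm (eps q (int n)) \<le> inverse (1 - norm q) * norm q ^ n" for n
  proof (cases "n = 0")
    case True
    then show ?thesis using q_lt1 by (simp add: eps_def)
  next
    case False
    have "1 - q ^ (2 * n) \<noteq> 0"
      using norm_one_minus_power_ge[of "2 * n"] False q_lt1 by auto
    then have "eps q (int n) = q ^ (2 * n) / (1 - q ^ (2 * n))"
      using False powi_double_neq_1[of "int n"]
      by (simp add: eps_def kap_def field_simps flip: power_int_of_nat)
    then have "norm (eps q (int n)) = norm q ^ (2 * n) / norm (1 - q ^ (2 * n))"
      by (simp add: norm_divide norm_power)
    also have "\<dots> \<le> norm q ^ n / (1 - norm q)"
      using norm_one_minus_power_ge[of "2 * n"] False q_lt1
      by (intro frac_le power_decreasing) auto
    finally show ?thesis by (simp add: field_simps)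
  qed
  show ?thesis
  proof (cases "m \<ge> 0")
    case True
    then show ?thesis using pos[of "nat m"] by simp
  next
    case False
    then show ?thesis using pos[of "nat (- m)"] by (simp add: eps_uminus)
  qed
qed

lemma rapid_odd_csch: "rapid (odd_csch q)"
proof (rule rapid_geometric)
  show "norm (odd_csch q m) \<le> inverse (1 - norm q) * norm q ^ nat \<bar>m\<bar>" for m
    using norm_csch_le[of m] q_lt1 by (simp add: odd_csch_def)
qed (use q_lt1 in auto)

lemma rapid_eps: "rapid (eps q)"
  by (rule rapid_geometric[OF _ _ norm_eps_le]) (use q_lt1 in auto)

lemma has_sum_eps_odd: "((\<lambda>m. if odd m then eps q m else 0) has_sum 0) UNIV"
proof (rule has_sum_odd_function)
  have "eps q summable_on {m. odd m}"
    using rapid_summable[OF rapid_eps, of 0] by simp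
  then show "(\<lambda>m. if odd m then eps q m else 0) summable_on UNIV"
    by (rule summable_on_cong_neutral[THEN iffD1, rotated -1]) auto
qed (auto simp: eps_uminus)

lemma kap_diff:
  "m \<noteq> 0 \<Longrightarrow> n \<noteq> 0 \<Longrightarrow>
    kap q m - kap q n = (of_bool (m > 0) - of_bool (n > 0)) + (eps q m - eps q n)"
  by (simp add: eps_def)

lemma conv_odd_csch_odd: "odd N \<Longrightarrow> conv (odd_csch q) (odd_csch q) N = 0"
  unfolding conv_def by (rule infsum_0) (auto simp: odd_csch_def)

text \<open>By \<open>csch_mult\<close> each term is \<open>csch q (2 * M)\<close> times a
  difference of values of \<open>kap\<close>. The step parts count \<open>M\<close> odd integers
  with sign; the two \<open>eps\<close> parts sum to 0 over the odd integers because
  \<open>eps\<close> is odd.\<close>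

lemma conv_odd_csch_even:
  assumes "M \<noteq> 0"
  shows "conv (odd_csch q) (odd_csch q) (2 * M) = of_int M * csch q (2 * M)"
proof -
  have "((\<lambda>j. 1 * (of_bool (j > 0) - of_bool (j > M))) has_sum (of_int M :: complex)) UNIV"
    by (rule has_sum_step_difference[where g = "\<lambda>_. 1" and G = of_int]) auto
  then have "((\<lambda>m. if odd m then of_bool (m > 0) - of_bool (m - 2 * M > 0) else 0) has_sum
      (of_int M :: complex)) UNIV"
    unfolding has_sum_odd_iff by (rule has_sum_cong[THEN iffD1, rotated]) (auto simp: of_bool_def)
  moreover have "((\<lambda>m. if odd m then eps q (m - 2 * M) else 0) has_sum 0) UNIV"
    using has_sum_eps_odd has_sum_int_shift[of "\<lambda>m. if odd m then eps q m else 0" "2 * M" 0]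
    by simp
  ultimately have "((\<lambda>m. csch q (2 * M) * ((if odd m then of_bool (m > 0) - of_bool (m - 2 * M > 0) else 0)
      + ((if odd m then eps q m else 0) + - (if odd m then eps q (m - 2 * M) else 0))))
      has_sum csch q (2 * M) * (of_int M + (0 + - 0))) UNIV"
    by (intro has_sum_cmult_right has_sum_add has_sum_eps_odd has_sum_uminusI)
  also have "(\<lambda>m. csch q (2 * M) * ((if odd m then of_bool (m > 0) - of_bool (m - 2 * M > 0) else 0)
      + ((if odd m then eps q m else 0) + - (if odd m then eps q (m - 2 * M) else 0))))
      = (\<lambda>m. odd_csch q m * odd_csch q (2 * M - m))"
  proof
    fix m
    show "csch q (2 * M) * ((if odd m then of_bool (m > 0) - of_bool (m - 2 * M > 0) else 0)
      + ((if odd m then eps q m else 0) + - (if odd m then eps q (m - 2 * M) else 0)))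
      = odd_csch q m * odd_csch q (2 * M - m)"
    proof (cases "odd m")
      case True
      then have nz: "m \<noteq> 0" "m - 2 * M \<noteq> 0" by presburger+
      show ?thesis
        using csch_mult[of m "2 * M - m"] kap_diff[of m "m - 2 * M"] nz True assms
        by (simp add: odd_csch_def)
    qed (simp add: odd_csch_def)
  qed
  finally show ?thesis
    unfolding conv_def by (intro infsumI) (simp add: mult.commute)
qed

text \<open>Convolving once more weights the differences of \<open>kap\<close> by
  \<open>m / 2\<close>. For \<open>N = 2 * l + 1\<close> the step part sums to
  \<open>l * (l + 1) / 2\<close>, which is quadratic in \<open>N\<close>, and the \<open>eps\<close>
  part is independent of \<open>N\<close>. Since the factor \<open>N ^ 2\<close> means a second
  derivative, this is the differential equation of \<phi> in terms of coefficients.\<close>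

lemma conv3_odd_csch:
  "\<exists>\<beta>. \<forall>N. conv (conv (odd_csch q) (odd_csch q)) (odd_csch q) N = odd_csch q N * (of_int N ^ 2 / 8 + \<beta>)"
proof -
  let ?c = "conv (odd_csch q) (odd_csch q)"
  have eps_sum: "(\<lambda>m. (if P m then 1 else 0) * (of_int m * eps q m)) summable_on UNIV" for P
  proof -
    have "(\<lambda>m. eps q m * of_int m) summable_on {m. P m}"
      using rapid_summable[OF rapid_eps, of 1] by simp
    then show ?thesis
      by (rule summable_on_cong_neutral[THEN iffD1, rotated -1]) (auto simp: mult.commute)
  qed
  obtain S T where S: "((\<lambda>m. (if even m then 1 else 0) * (of_int m * eps q m)) has_sum S) UNIV"
    and T: "((\<lambda>m. (if odd m then 1 else 0) * (of_int m * eps q m)) has_sum T) UNIV"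
    using eps_sum[of even] eps_sum[of odd] unfolding summable_on_def by blast
  have "conv ?c (odd_csch q) N = odd_csch q N * (of_int N ^ 2 / 8 + (?c 0 - 1/8 + S/2 - T/2))" for N
  proof (cases "odd N")
    case False
    then have "?c m = 0 \<or> odd_csch q (N - m) = 0" for m
      using conv_odd_csch_odd by (cases "odd m") (auto simp: odd_csch_def[of q "N - m"])
    then have "?c m * odd_csch q (N - m) = 0" for m
      by simp
    then have "conv ?c (odd_csch q) N = 0"
      unfolding conv_def[of ?c] by (intro infsum_0)
    then show ?thesis using False by (simp add: odd_csch_def)
  next
    case True
    then obtain l where N: "N = 2 * l + 1" by (auto elim: oddE)
    have "((\<lambda>j. of_int j * (of_bool (j > 0) - of_bool (j > l))) has_sum (of_int l * (of_int l + 1) / 2 :: complex)) UNIV"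
      by (rule has_sum_step_difference[where g = of_int and G = "\<lambda>l. of_int l * (of_int l + 1) / 2"])
         (auto simp: field_simps)
    then have 1: "((\<lambda>m. if even m then of_int m / 2 * (of_bool (m > 0) - of_bool (m - N > 0)) else 0)
        has_sum (of_int l * (of_int l + 1) / 2 :: complex)) UNIV"
      unfolding has_sum_even_iff N
      by (rule has_sum_cong[THEN iffD1, rotated]) (auto simp: of_bool_def)
    \<comment> \<open>The shift by the odd \<open>N\<close> turns even \<open>m\<close> into odd
      ones and the weight into \<open>(m + N) / 2\<close>. The part proportional to \<open>N\<close>
      vanishes by oddness of \<open>eps\<close>; the constant \<open>T / 2\<close> remains.\<close>
    have "((\<lambda>m. 1 / 2 * ((if odd m then 1 else 0) * (of_int m * eps q m)) +
          of_int N / 2 * (if odd m then eps q m else 0)) has_sum (1/2 * T + of_int N / 2 * 0)) UNIV"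
      by (intro has_sum_add has_sum_cmult_right T has_sum_eps_odd)
    also have "(\<lambda>m. 1 / 2 * ((if odd m then 1 else 0) * (of_int m * eps q m)) +
          of_int N / 2 * (if odd m then eps q m else 0)) =
         (\<lambda>m. if odd m then (of_int m + of_int N) / 2 * eps q m else 0)"
      by (auto simp: field_simps)
    finally have 2: "((\<lambda>m. if even m then of_int m / 2 * eps q (m - N) else 0) has_sum T / 2) UNIV"
      using has_sum_int_shift[of "\<lambda>m. if odd m then (of_int m + of_int N) / 2 * eps q m else 0" N "T / 2"] True
      by (simp cong: if_cong)
    \<comment> \<open>The entry at \<open>m = 0\<close> is not covered by
      \<open>conv_odd_csch_even\<close>; it is kept as it is and becomes part of
      \<open>\<beta>\<close>.\<close>
    have 3: "((\<lambda>m. if m = 0 then ?c 0 else 0) has_sum ?c 0) UNIV"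
      by (rule has_sum_finite_neutralI[of "{0}"]) auto
    have "((\<lambda>m. csch q N * ((if m = 0 then ?c 0 else 0)
         + (if even m then of_int m / 2 * (of_bool (m > 0) - of_bool (m - N > 0)) else 0)
         + 1 / 2 * ((if even m then 1 else 0) * (of_int m * eps q m))
         + - (if even m then of_int m / 2 * eps q (m - N) else 0))) has_sum
        csch q N * (?c 0 + of_int l * (of_int l + 1) / 2 + 1 / 2 * S + - (T / 2))) UNIV"
      by (intro has_sum_add has_sum_cmult_right has_sum_uminusI 1 2 3 S)
    also have "(\<lambda>m. csch q N * ((if m = 0 then ?c 0 else 0)
         + (if even m then of_int m / 2 * (of_bool (m > 0) - of_bool (m - N > 0)) else 0)
         + 1 / 2 * ((if even m then 1 else 0) * (of_int m * eps q m))
         + - (if even m then of_int m / 2 * eps q (m - N) else 0))) =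
        (\<lambda>m. ?c m * odd_csch q (N - m))"
    proof
      fix m :: int
      consider "odd m" | "m = 0" | "even m" "m \<noteq> 0" by blast
      then show "csch q N * ((if m = 0 then ?c 0 else 0)
         + (if even m then of_int m / 2 * (of_bool (m > 0) - of_bool (m - N > 0)) else 0)
         + 1 / 2 * ((if even m then 1 else 0) * (of_int m * eps q m))
         + - (if even m then of_int m / 2 * eps q (m - N) else 0)) = ?c m * odd_csch q (N - m)"
      proof cases
        case 1
        then show ?thesis by (auto simp: conv_odd_csch_odd)
      next
        case 2
        then show ?thesis using True by (simp add: odd_csch_def)
      next
        case 3
        then obtain M where M: "m = 2 * M" "M \<noteq> 0" by (auto elim: evenE)
        have "m - N \<noteq> 0" "N \<noteq> 0" using 3 True by presburger+
        then have "csch q m * csch q (N - m) =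
            csch q N * ((of_bool (m > 0) - of_bool (m - N > 0)) + (eps q m - eps q (m - N)))"
          using csch_mult[of m "N - m"] kap_diff[of m "m - N"] 3 by simp
        moreover have "?c m * odd_csch q (N - m) = of_int m / 2 * (csch q m * csch q (N - m))"
          using conv_odd_csch_even[OF M(2)] M(1) 3 True by (simp add: odd_csch_def)
        ultimately have "?c m * odd_csch q (N - m) = of_int m / 2 *
            (csch q N * ((of_bool (m > 0) - of_bool (m - N > 0)) + (eps q m - eps q (m - N))))"
          by (simp only:)
        then show ?thesis
          using 3 by (simp only: if_True if_False) (simp add: algebra_simps del: of_bool_eq_iff)
      qed
    qed
    finally have "conv ?c (odd_csch q) N =
        csch q N * (?c 0 + of_int l * (of_int l + 1) / 2 + 1 / 2 * S + - (T / 2))"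
      unfolding conv_def by (rule infsumI)
    also have "of_int l * (of_int l + 1) / 2 = (of_int N ^ 2 / 8 - 1 / 8 :: complex)"
      by (simp add: N power2_eq_square field_simps)
    finally have "conv ?c (odd_csch q) N =
        csch q N * (?c 0 + (of_int N ^ 2 / 8 - 1 / 8) + 1 / 2 * S + - (T / 2))" .
    moreover have "odd_csch q N = csch q N" using True by (simp add: odd_csch_def)
    ultimately show ?thesis by (simp add: algebra_simps)
  qed
  then show ?thesis by blast
qed

end

subsection \<open>The differential equation\<close>

lemma fps_nth_deriv_iter:
  fixes g :: "complex fps"
  shows "fact i * fps_nth ((fps_deriv ^^ k) g) i = fact (i + k) * fps_nth g (i + k)"
proof (induction k arbitrary: i)
  case (Suc k)
  have "fact i * fps_nth ((fps_deriv ^^ Suc k) g) i = fact (Suc i) * fps_nth ((fps_deriv ^^ k) g) (Suc i)"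
    by simp
  then show ?case using Suc[of "Suc i"] by (simp add: mult_ac)
qed simp

lemma fps_deriv_power_Suc:
  fixes f :: "complex fps"
  shows "fps_deriv (f ^ Suc n) = of_nat (Suc n) * (fps_deriv f * f ^ n)"
  by (simp only: fps_deriv_power fps_of_nat diff_Suc_1 mult.assoc)

text \<open>Equation and first integral are both polynomial in \<open>f\<close>, so two derivatives
  of a power involve only powers of the same parity: the neighbours and the power itself.\<close>

lemma fps_deriv2_power:
  fixes f B C :: "complex fps"
  assumes ode: "fps_deriv (fps_deriv f) = B * f + 8 * f ^ 3"
    and int: "fps_deriv f * fps_deriv f = C + B * f ^ 2 + 4 * f ^ 4"
  shows "fps_deriv (fps_deriv (f ^ (n + 2))) = 4 * of_nat ((n + 2) * (n + 3)) * f ^ (n + 4)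
     + of_nat ((n + 2) ^ 2) * B * f ^ (n + 2) + of_nat ((n + 2) * (n + 1)) * C * f ^ n"
proof -
  have 0: "fps_deriv (of_nat k) = (0 :: complex fps)" for k
    by (simp flip: fps_of_nat)
  have 1: "fps_deriv (f ^ (n + 1)) = of_nat (n + 1) * (fps_deriv f * f ^ n)"
    using fps_deriv_power_Suc[of f n] by simp
  have "fps_deriv (f ^ (n + 2)) = of_nat (n + 2) * (fps_deriv f * f ^ (n + 1))"
    using fps_deriv_power_Suc[of f "n + 1"] by simp
  then have "fps_deriv (fps_deriv (f ^ (n + 2))) = of_nat (n + 2) *
      (fps_deriv (fps_deriv f) * f ^ (n + 1) + of_nat (n + 1) * ((fps_deriv f * fps_deriv f) * f ^ n))"
    by (simp only: fps_deriv_mult 0 1) (simp add: algebra_simps)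
  also have "\<dots> = of_nat (n + 2) *
      ((B * f + 8 * f ^ 3) * f ^ (n + 1) + of_nat (n + 1) * ((C + B * f ^ 2 + 4 * f ^ 4) * f ^ n))"
    by (simp only: ode int)
  also have "\<dots> = 4 * of_nat ((n + 2) * (n + 3)) * f ^ (n + 4)
     + of_nat ((n + 2) ^ 2) * B * f ^ (n + 2) + of_nat ((n + 2) * (n + 1)) * C * f ^ n"
    by (simp add: power_add power_numeral_reduce power2_eq_square algebra_simps)
  finally show ?thesis .
qed

text \<open>Conservation of energy: the equation times \<open>2 * fps_deriv f\<close> is a total
  derivative. The constant is read off at 0, where \<open>f\<close> vanishes.\<close>

lemma fps_first_integral:
  fixes f :: "complex fps"
  assumes ode: "fps_deriv (fps_deriv f) = fps_const B * f + 8 * f ^ 3"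
    and f0: "fps_nth f 0 = 0"
  shows "fps_deriv f * fps_deriv f = fps_const (fps_nth f 1 ^ 2) + fps_const B * f ^ 2 + 4 * f ^ 4"
proof -
  define g where "g = fps_deriv f * fps_deriv f - fps_const B * (f * f) - 4 * (f * f) * (f * f)"
  have 4: "fps_deriv 4 = (0 :: complex fps)"
    by (simp add: fps_numeral_fps_const)
  have "fps_deriv g = 0"
    unfolding g_def fps_deriv_sub fps_deriv_mult fps_deriv_const ode 4
    by (simp add: algebra_simps power_numeral_reduce)
  then have "g = fps_const (fps_nth g 0)"
    by (simp add: fps_deriv_eq_0_iff)
  also have "fps_nth g 0 = fps_nth f 1 ^ 2"
    by (simp add: g_def f0 power2_eq_square)
  finally show ?thesis
    by (simp add: g_def algebra_simps power_numeral_reduce)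
qed

text \<open>Differentiating a power of \<open>f\<close> twice gives a three-term recursion, so that the Taylor
  coefficients of \<open>f\<close> and \<open>f\<^sup>2\<close> are the moments of a Jacobi matrix.\<close>

lemma fps_power_taylor:
  fixes f :: "complex fps" and s :: nat
  assumes ode: "fps_deriv (fps_deriv f) = fps_const B * f + 8 * f ^ 3"
    and f0: "fps_nth f 0 = 0" and s: "s = 1 \<or> s = 2"
  defines "c \<equiv> fps_nth f 1"
  defines "u \<equiv> \<lambda>n. 4 * of_nat ((2 * n + s) * (2 * n + s + 1))"
    and "d \<equiv> \<lambda>n. of_nat ((2 * n + s)\<^sup>2) * B"
    and "l \<equiv> \<lambda>n. of_nat ((2 * n + s) * (2 * n + s - 1)) * c\<^sup>2"
  shows "fact (2 * k + s) * fps_nth (f ^ s) (2 * k + s) = fact s * c ^ s * jacobi_moment u d l k 0"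
proof -
  define g where "g n = f ^ (2 * n + s)" for n
  \<comment> \<open>For \<open>s = 2\<close> the second derivative of \<open>f ^ 2\<close> contains
    the constant \<open>l 0\<close>. Passing to derivatives removes it, so the recursion has no term
    below index 0.\<close>
  define \<psi> where "\<psi> n = fps_deriv (g n)" for n
  have cst: "fps_const (of_nat k * x) = of_nat k * fps_const x" "fps_const (4 * of_nat k) = (4 * of_nat k :: complex fps)" for k x
    by (simp_all add: fps_numeral_fps_const flip: fps_of_nat)
  note deriv2 = fps_deriv2_power[OF ode fps_first_integral[OF ode f0], folded c_def]
  have "fps_deriv (fps_deriv (g 0)) = fps_const (u 0) * g 1 + fps_const (d 0) * g 0
       + fps_const (if s = 1 then 0 else l 0)"
  proof (cases "s = 1")
    case True
    then show ?thesis by (simp add: g_def ode u_def d_def fps_numeral_fps_const)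
  next
    case False
    then have "s = 2" using s by simp
    then show ?thesis
      using deriv2[of 0] unfolding u_def d_def l_def cst g_def by (simp add: fps_numeral_fps_const)
  qed
  then have rec0: "fps_deriv (fps_deriv (\<psi> 0)) = fps_const (u 0) * \<psi> 1 + fps_const (d 0) * \<psi> 0"
    by (simp add: \<psi>_def)
  have "fps_deriv (fps_deriv (g (Suc n))) = fps_const (u (Suc n)) * g (Suc (Suc n))
     + fps_const (d (Suc n)) * g (Suc n) + fps_const (l (Suc n)) * g n" for n
  proof -
    have e: "2 * n + s + 2 = 2 * Suc n + s" "2 * n + s + 4 = 2 * Suc (Suc n) + s"
      "2 * n + s + 3 = 2 * Suc n + s + 1" "2 * n + s + 1 = 2 * Suc n + s - 1" by auto
    show ?thesis
      using deriv2[of "2 * n + s"] unfolding u_def d_def l_def cst g_def e .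
  qed
  then have rec: "fps_deriv (fps_deriv (\<psi> (Suc n))) = fps_const (u (Suc n)) * \<psi> (Suc (Suc n))
     + fps_const (d (Suc n)) * \<psi> (Suc n) + fps_const (l (Suc n)) * \<psi> n" for n
    by (simp add: \<psi>_def)
  let ?P = "jacobi_moment u d l"
  have expand: "(fps_deriv ^^ (2 * k)) (\<psi> 0) = (\<Sum>n<N. fps_const (?P k n) * \<psi> n)" if "k < N" for N
    using that
  proof (induction k arbitrary: N)
    case 0
    have "(\<Sum>n<N. fps_const (?P 0 n) * \<psi> n) = (\<Sum>n\<in>{0}. fps_const (?P 0 n) * \<psi> n)"
      by (rule sum.mono_neutral_right) (use 0 in auto)
    then show ?case by simp
  next
    case (Suc k)
    define M where "M = N - 1"
    have M: "N = Suc M" "k < M" using Suc.prems by (auto simp: M_def)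
    have "(fps_deriv ^^ (2 * Suc k)) (\<psi> 0) = fps_deriv (fps_deriv (\<Sum>n<N. fps_const (?P k n) * \<psi> n))"
      using Suc.IH[of N] Suc.prems by simp
    also have "\<dots> = (\<Sum>n<Suc M. fps_const (?P k n) * fps_deriv (fps_deriv (\<psi> n)))"
      by (simp add: fps_deriv_sum M)
    also have "\<dots> = fps_const (?P k 0) * (fps_const (u 0) * \<psi> 1 + fps_const (d 0) * \<psi> 0) +
       (\<Sum>n<M. fps_const (?P k (Suc n)) * (fps_const (u (Suc n)) * \<psi> (Suc (Suc n))
          + fps_const (d (Suc n)) * \<psi> (Suc n) + fps_const (l (Suc n)) * \<psi> n))"
      by (subst sum.lessThan_Suc_shift) (simp add: rec rec0)
    also have "\<dots> = (\<Sum>n<Suc M. fps_const (?P k n * u n) * \<psi> (Suc n))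
        + (\<Sum>n<Suc M. fps_const (?P k n * d n) * \<psi> n)
        + (\<Sum>n<M. fps_const (?P k (Suc n) * l (Suc n)) * \<psi> n)"
      by (subst (1 2) sum.lessThan_Suc_shift)
         (simp add: algebra_simps sum.distrib flip: fps_const_mult)
    also have "(\<Sum>n<Suc M. fps_const (?P k n * u n) * \<psi> (Suc n))
        = (\<Sum>n<M. fps_const (?P k n * u n) * \<psi> (Suc n))"
      using M by (simp add: jacobi_moment_eq_0)
    also have "\<dots> = (\<Sum>n<Suc M. fps_const (case n of 0 \<Rightarrow> 0 | Suc m \<Rightarrow> ?P k m * u m) * \<psi> n)"
      by (subst sum.lessThan_Suc_shift) simp
    also have "(\<Sum>n<M. fps_const (?P k (Suc n) * l (Suc n)) * \<psi> n)
        = (\<Sum>n<Suc M. fps_const (?P k (Suc n) * l (Suc n)) * \<psi> n)"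
      using M by (simp add: jacobi_moment_eq_0)
    finally show ?case
      by (simp add: M(1) sum.distrib algebra_simps flip: fps_const_add)
  qed
  \<comment> \<open>A power \<open>f ^ p\<close> starts at degree \<open>p\<close>. Hence at degree
    \<open>s - 1\<close> only \<open>\<psi> 0\<close> is nonzero, and reading off that coefficient
    selects column 0 of the matrix power.\<close>
  have order: "fps_nth (f ^ p) s = 0" if "s < p" for p
    using that f0 by (intro startsby_zero_power_prefix[rule_format]) auto
  have coeff: "fps_nth (\<psi> n) (s - 1) = (if n = 0 then of_nat s * c ^ s else 0)" for n
  proof -
    have "fps_nth (f ^ s) s = c ^ s"
      using s f0 by (auto simp: c_def power2_eq_square fps_mult_nth numeral_2_eq_2)
    moreover have "fps_nth (\<psi> n) (s - 1) = of_nat (Suc (s - 1)) * fps_nth (f ^ (2 * n + s)) (Suc (s - 1))"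
      by (simp add: \<psi>_def g_def)
    moreover have "Suc (s - 1) = s" using s by auto
    ultimately show ?thesis
      using order[of "2 * n + s"] by (cases "n = 0") auto
  qed
  have "fps_nth ((fps_deriv ^^ (2 * k)) (\<psi> 0)) (s - 1) = ?P k 0 * (of_nat s * c ^ s)"
    unfolding expand[OF lessI] sum.lessThan_Suc_shift by (simp add: fps_sum_nth coeff del: One_nat_def)
  then have "fact (s - 1 + 2 * k) * fps_nth (\<psi> 0) (s - 1 + 2 * k) = fact (s - 1) * (?P k 0 * (of_nat s * c ^ s))"
    using fps_nth_deriv_iter[of "s - 1" "2 * k" "\<psi> 0"] by simp
  moreover have "fact (s - 1 + 2 * k) * fps_nth (\<psi> 0) (s - 1 + 2 * k) = fact (2 * k + s) * fps_nth (f ^ s) (2 * k + s)"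
  proof -
    have e: "2 * k + s = Suc (s - 1 + 2 * k)" using s by auto
    have "fact t * fps_nth (fps_deriv F) t = fact (Suc t) * fps_nth F (Suc t)" for t and F :: "complex fps"
      by (simp add: mult_ac)
    then show ?thesis unfolding e by (simp only: \<psi>_def g_def mult_0_right add_0)
  qed
  moreover have "fact (s - 1) * of_nat s = (fact s :: complex)"
    using s by auto
  ultimately show ?thesis
    by (metis mult.assoc mult.commute)
qed

subsection \<open>Hankel determinants of Lambert series\<close>

lemma jacobi_moment_scale:
  fixes u d l :: "nat \<Rightarrow> 'a::field"
  shows "jacobi_moment (\<lambda>n. r * u n) (\<lambda>n. r * d n) (\<lambda>n. r * l n) k n = r ^ k * jacobi_moment u d l k n"
  by (induction k arbitrary: n) (auto simp: algebra_simps split: nat.split)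

lemma infsum_int_even_function:
  fixes h :: "int \<Rightarrow> complex"
  assumes "h summable_on UNIV" "\<And>m. h (- m) = h m" "h 0 = 0"
  shows "infsum h UNIV = 2 * (\<Sum>\<^sub>\<infinity>m\<in>{1..}. h (int m))"
proof -
  have pos: "infsum h {0<..} = (\<Sum>\<^sub>\<infinity>m\<in>{1..}. h (int m))"
    by (rule infsum_reindex_bij_witness[of _ int nat]) auto
  have "infsum h {..<0} = infsum h {0<..}"
    by (rule infsum_reindex_bij_witness[of _ uminus uminus]) (auto simp: assms(2))
  moreover have "infsum h UNIV = infsum h ({0<..} \<union> {..<0})"
    by (rule infsum_cong_neutral) (auto simp: assms(3) not_less order.order_iff_strict)
  moreover have "infsum h ({0<..} \<union> {..<0}) = infsum h {0<..} + infsum h {..<0}"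
    by (rule infsum_Un_disjoint) (auto intro: summable_on_subset[OF assms(1)])
  ultimately show ?thesis using pos by simp
qed

context nome
begin

definition odd_lambert :: "nat \<Rightarrow> complex" where
  "odd_lambert k = (\<Sum>\<^sub>\<infinity>m\<in>{m::nat. odd m}. of_nat m ^ k * csch q (int m))"

text \<open>A Lambert series in the square of \<open>q\<close>: the factor 2 reflects that the
  convolution square lives on even indices. For the second identity \<open>q\<close> is therefore
  replaced by a square root.\<close>

definition even_lambert :: "nat \<Rightarrow> complex" where
  "even_lambert k = (\<Sum>\<^sub>\<infinity>m\<in>{m::nat. m \<ge> 1}. of_nat m ^ k * csch q (2 * int m))"

lemma moment_odd_csch: "moment (odd_csch q) (2 * k + 1) = 2 * odd_lambert (2 * k + 1)"
proof -
  have "moment (odd_csch q) (2 * k + 1) =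
      2 * (\<Sum>\<^sub>\<infinity>m\<in>{1..}. odd_csch q (int m) * of_int (int m) ^ (2 * k + 1))"
    unfolding moment_def
    by (rule infsum_int_even_function)
       (simp_all add: odd_csch_uminus rapid_summable[OF rapid_odd_csch] del: power_Suc)
  also have "(\<Sum>\<^sub>\<infinity>m\<in>{1..}. odd_csch q (int m) * of_int (int m) ^ (2 * k + 1)) = odd_lambert (2 * k + 1)"
    unfolding odd_lambert_def
    by (rule infsum_cong_neutral) (auto simp: odd_csch_def mult.commute Suc_le_eq intro: Nat.gr0I)
  finally show ?thesis .
qed

lemma moment_0_odd_csch: "moment (odd_csch q) 0 = 0"
  unfolding moment_def
  using has_sum_odd_function[of "odd_csch q"] rapid_summable[OF rapid_odd_csch, of 0 UNIV]
  by (simp add: odd_csch_uminus infsumI)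

lemma moment_conv_odd_csch:
  "moment (conv (odd_csch q) (odd_csch q)) (2 * k + 2) = 2 * 4 ^ (k + 1) * even_lambert (2 * k + 3)"
proof -
  let ?c = "conv (odd_csch q) (odd_csch q)"
  have even: "?c (2 * M) * of_int (2 * M) ^ (2 * k + 2) = 4 ^ (k + 1) * (of_int M ^ (2 * k + 3) * csch q (2 * M))" for M
  proof (cases "M = 0")
    case False
    have "(of_int (2 * M) :: complex) ^ (2 * k + 2) = (2 ^ 2) ^ (k + 1) * of_int M ^ (2 * k + 2)"
      unfolding power_mult[symmetric] by (simp add: power_mult_distrib)
    moreover have "(of_int M :: complex) ^ (2 * k + 3) = of_int M * of_int M ^ (2 * k + 2)"
      by (simp add: numeral_3_eq_3)
    ultimately show ?thesis
      by (simp only: conv_odd_csch_even[OF False]) (simp add: mult_ac)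
  qed simp
  have "((\<lambda>N. ?c N * of_int N ^ (2 * k + 2)) has_sum moment ?c (2 * k + 2)) UNIV"
    unfolding moment_def by (rule has_sum_infsum, rule rapid_summable)
       (intro rapid_conv rapid_odd_csch)
  also have "(\<lambda>N. ?c N * of_int N ^ (2 * k + 2)) = (\<lambda>N. if even N then ?c N * of_int N ^ (2 * k + 2) else 0)"
    by (auto simp: conv_odd_csch_odd)
  finally have s: "((\<lambda>M. 4 ^ (k + 1) * (of_int M ^ (2 * k + 3) * csch q (2 * M))) has_sum moment ?c (2 * k + 2)) UNIV"
    unfolding has_sum_even_iff even .
  have "moment ?c (2 * k + 2) = 2 * (\<Sum>\<^sub>\<infinity>m\<in>{1..}. 4 ^ (k + 1) * (of_int (int m) ^ (2 * k + 3) * csch q (2 * int m)))"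
    unfolding infsumI[OF s, symmetric]
    by (rule infsum_int_even_function)
       (use s in \<open>auto simp: has_sum_iff power_minus_odd csch_uminus simp del: power_Suc\<close>)
  also have "\<dots> = 2 * 4 ^ (k + 1) * even_lambert (2 * k + 3)"
    unfolding even_lambert_def by (simp add: infsum_cmult_right' atLeast_def mult.assoc)
  finally show ?thesis .
qed

text \<open>Multiplying the coefficients twice by their index is differentiating twice, and
  convolution is multiplication, so \<open>conv3_odd_csch\<close> translates into a differential
  equation.\<close>

lemma exp_series_odd_csch_ode:
  obtains B where "fps_deriv (fps_deriv (exp_series (odd_csch q))) =
    fps_const B * exp_series (odd_csch q) + 8 * exp_series (odd_csch q) ^ 3"
proof -
  let ?a = "odd_csch q"
  obtain \<beta> where \<beta>: "\<And>N. conv (conv ?a ?a) ?a N = ?a N * (of_int N ^ 2 / 8 + \<beta>)"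
    using conv3_odd_csch by blast
  have "fps_deriv (fps_deriv (exp_series ?a)) = exp_series (\<lambda>m. of_int m * (of_int m * ?a m))"
    by (simp add: fps_deriv_exp_series)
  define B where "B = - 8 * \<beta>"
  note \<open>fps_deriv (fps_deriv (exp_series ?a)) = exp_series (\<lambda>m. of_int m * (of_int m * ?a m))\<close>
  also have "(\<lambda>m. of_int m * (of_int m * ?a m)) = (\<lambda>m. B * ?a m + 8 * conv (conv ?a ?a) ?a m)"
    by (simp add: \<beta> B_def algebra_simps power2_eq_square)
  also have "exp_series \<dots> = fps_const B * exp_series ?a + fps_const 8 * exp_series (conv (conv ?a ?a) ?a)"
    by (subst exp_series_add) (auto intro!: rapid_cmult rapid_conv rapid_odd_csch simp: exp_series_cmult)
  also have "exp_series (conv (conv ?a ?a) ?a) = exp_series ?a ^ 3"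
    by (simp add: exp_series_conv rapid_conv rapid_odd_csch power3_eq_cube)
  finally have "fps_deriv (fps_deriv (exp_series ?a)) =
      fps_const B * exp_series ?a + 8 * exp_series ?a ^ 3"
    by (simp only: fps_numeral_fps_const)
  then show ?thesis by (rule that)
qed

lemma exp_series_odd_csch_nth:
  "fps_nth (exp_series (odd_csch q)) 0 = 0"
  "fps_nth (exp_series (odd_csch q)) 1 = 2 * odd_lambert 1"
  using moment_0_odd_csch moment_odd_csch[of 0] by (simp_all add: exp_series_nth)

text \<open>The Taylor coefficients of \<phi> are moments with first derivative
  \<open>2 * odd_lambert 1\<close> at 0. The products \<open>u i * l (Suc i)\<close> extend
  \<open>fact (2 * i) * fact (2 * i + 1)\<close> to the next index, whence the factorials.\<close>

lemma hankel_det_odd_lambert: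
  "hankel_det n (\<lambda>k. odd_lambert (2 * k + 1)) =
    (\<Prod>m<n. odd_lambert 1 * (16 * odd_lambert 1 ^ 2) ^ m * fact (2 * m) * fact (2 * m + 1))"
proof -
  let ?f = "exp_series (odd_csch q)" and ?A = "odd_lambert 1"
  obtain B where ode: "fps_deriv (fps_deriv ?f) = fps_const B * ?f + 8 * ?f ^ 3"
    by (rule exp_series_odd_csch_ode)
  define u d l :: "nat \<Rightarrow> complex"
    where "u = (\<lambda>n. 4 * of_nat ((2 * n + 1) * (2 * n + 1 + 1)))"
      and "d = (\<lambda>n. of_nat ((2 * n + 1)\<^sup>2) * B)"
      and "l = (\<lambda>n. of_nat ((2 * n + 1) * (2 * n + 1 - 1)) * (2 * ?A)\<^sup>2)"
  have "odd_lambert (2 * k + 1) = ?A * jacobi_moment u d l k 0" for k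
    using fps_power_taylor[OF ode exp_series_odd_csch_nth(1), of 1 k]
    unfolding exp_series_odd_csch_nth(2) u_def[symmetric] d_def[symmetric] l_def[symmetric]
    using moment_odd_csch[of k] by (simp add: exp_series_nth del: fact_Suc)
  then have "hankel_det n (\<lambda>k. odd_lambert (2 * k + 1)) =
      ?A ^ n * hankel_det n (\<lambda>k. jacobi_moment u d l k 0)"
    by (simp add: hankel_det_cmult)
  also have "hankel_det n (\<lambda>k. jacobi_moment u d l k 0) = (\<Prod>m<n. \<Prod>i<m. u i * l (Suc i))"
    by (rule hankel_det_jacobi_moment) (simp only: u_def mult_eq_0_iff of_nat_eq_0_iff, simp)
  also have "?A ^ n * \<dots> = (\<Prod>m<n. ?A * (\<Prod>i<m. u i * l (Suc i)))"
    by (simp add: prod.distrib)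
  also have "\<dots> = (\<Prod>m<n. ?A * (16 * ?A ^ 2) ^ m * fact (2 * m) * fact (2 * m + 1))"
  proof -
    have "(\<Prod>i<m. u i * l (Suc i)) = (16 * ?A ^ 2) ^ m * fact (2 * m) * fact (2 * m + 1)" for m
    proof (induction m)
      case (Suc m)
      have *: "u m * l (Suc m) = 16 * ?A ^ 2 * (of_nat (2 * m + 2) * of_nat (2 * m + 1)) * (of_nat (2 * m + 3) * of_nat (2 * m + 2))"
        by (simp add: u_def l_def algebra_simps power2_eq_square)
      have f: "fact (2 * Suc m) = of_nat (2 * m + 2) * of_nat (2 * m + 1) * (fact (2 * m) :: complex)"
        "fact (2 * Suc m + 1) = of_nat (2 * m + 3) * of_nat (2 * m + 2) * (fact (2 * m + 1) :: complex)"
        by (simp_all add: algebra_simps)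
      show ?case unfolding prod.lessThan_Suc Suc * f power_Suc by (simp only: mult_ac)
    qed simp
    then show ?thesis by (simp only: mult.assoc)
  qed
  finally show ?thesis .
qed

text \<open>The same argument for the square of \<phi>, whose coefficients are those of
  \<open>conv_odd_csch_even\<close>.\<close>

lemma hankel_det_even_lambert:
  "hankel_det n (\<lambda>k. even_lambert (2 * k + 3)) =
    (\<Prod>m<n. odd_lambert 1 ^ (2 * m + 2) * fact (2 * m + 1) * fact (2 * m + 2) / 2)"
proof -
  let ?f = "exp_series (odd_csch q)" and ?A = "odd_lambert 1"
  obtain B where ode: "fps_deriv (fps_deriv ?f) = fps_const B * ?f + 8 * ?f ^ 3"
    by (rule exp_series_odd_csch_ode)
  define u d l :: "nat \<Rightarrow> complex"
    where "u = (\<lambda>n. 4 * of_nat ((2 * n + 2) * (2 * n + 2 + 1)))"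
      and "d = (\<lambda>n. of_nat ((2 * n + 2)\<^sup>2) * B)"
      and "l = (\<lambda>n. of_nat ((2 * n + 2) * (2 * n + 2 - 1)) * (2 * ?A)\<^sup>2)"
  \<comment> \<open>Dividing the matrix by 4 absorbs the factor \<open>4 ^ k\<close> of
    \<open>moment_conv_odd_csch\<close>.\<close>
  define u' d' l' where "u' = (\<lambda>n. 1/4 * u n)" and "d' = (\<lambda>n. 1/4 * d n)" and "l' = (\<lambda>n. 1/4 * l n)"
  have "even_lambert (2 * k + 3) = ?A ^ 2 * jacobi_moment u' d' l' k 0" for k
  proof -
    have "?f ^ 2 = exp_series (conv (odd_csch q) (odd_csch q))"
      by (simp add: exp_series_conv rapid_odd_csch power2_eq_square)
    then have "moment (conv (odd_csch q) (odd_csch q)) (2 * k + 2) = 2 * (2 * ?A) ^ 2 * jacobi_moment u d l k 0"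
      using fps_power_taylor[OF ode exp_series_odd_csch_nth(1), of 2 k]
      unfolding exp_series_odd_csch_nth(2) u_def[symmetric] d_def[symmetric] l_def[symmetric]
      by (simp add: exp_series_nth del: fact_Suc)
    then show ?thesis
      unfolding moment_conv_odd_csch u'_def d'_def l'_def jacobi_moment_scale
      by (simp add: field_simps)
  qed
  then have "hankel_det n (\<lambda>k. even_lambert (2 * k + 3)) =
      (?A ^ 2) ^ n * hankel_det n (\<lambda>k. jacobi_moment u' d' l' k 0)"
    by (simp add: hankel_det_cmult)
  also have "hankel_det n (\<lambda>k. jacobi_moment u' d' l' k 0) = (\<Prod>m<n. \<Prod>i<m. u' i * l' (Suc i))"
    by (rule hankel_det_jacobi_moment) (simp only: u_def u'_def mult_eq_0_iff of_nat_eq_0_iff, simp)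
  also have "(?A ^ 2) ^ n * \<dots> = (\<Prod>m<n. ?A ^ 2 * (\<Prod>i<m. u' i * l' (Suc i)))"
    by (simp add: prod.distrib)
  also have "\<dots> = (\<Prod>m<n. ?A ^ (2 * m + 2) * fact (2 * m + 1) * fact (2 * m + 2) / 2)"
  proof -
    have "(\<Prod>i<m. u' i * l' (Suc i)) = ?A ^ (2 * m) * fact (2 * m + 1) * fact (2 * m + 2) * inverse 2" for m
    proof (induction m)
      case (Suc m)
      have *: "u' m * l' (Suc m) = ?A ^ 2 * (of_nat (2 * m + 3) * of_nat (2 * m + 2)) * (of_nat (2 * m + 4) * of_nat (2 * m + 3))"
        by (simp add: u_def l_def u'_def l'_def algebra_simps power2_eq_square)
      have f: "fact (2 * Suc m + 1) = of_nat (2 * m + 3) * of_nat (2 * m + 2) * (fact (2 * m + 1) :: complex)"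
        "fact (2 * Suc m + 2) = of_nat (2 * m + 4) * of_nat (2 * m + 3) * (fact (2 * m + 2) :: complex)"
        "?A ^ (2 * Suc m) = ?A ^ 2 * ?A ^ (2 * m)"
        by (simp_all add: algebra_simps power2_eq_square)
      show ?case unfolding prod.lessThan_Suc Suc * f by (simp only: mult_ac)
    qed (simp add: numeral_2_eq_2)
    moreover have "?A ^ (2 * m + 2) = ?A ^ 2 * ?A ^ (2 * m)" for m by (simp add: power2_eq_square)
    ultimately show ?thesis by (simp only: mult.assoc divide_inverse)
  qed
  finally show ?thesis .
qed

end

subsection \<open>Theta series and triangular numbers\<close>

definition sg :: "int \<Rightarrow> complex" where
  "sg n = (if even n then 1 else - 1)"

text \<open>The nontrivial Dirichlet character modulo 4: \<open>div\<close> rounds down, so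
  \<open>m div 2\<close> is \<open>(m - 1) / 2\<close> for odd \<open>m\<close> of either
  sign.\<close>

definition chi :: "int \<Rightarrow> complex" where
  "chi m = (if odd m then sg (m div 2) else 0)"

lemma sg_add: "sg (m + n) = sg m * sg n"
  by (auto simp: sg_def)

lemma sg_square [simp]: "sg n * sg n = 1"
  by (simp add: sg_def)

lemma norm_sg [simp]: "norm (sg n) = 1"
  by (simp add: sg_def)

lemma sg_uminus [simp]: "sg (- n) = sg n"
  by (simp add: sg_def)

lemma chi_odd: "chi (2 * j + 1) = sg j"
  by (simp add: chi_def)

lemma chi_uminus: "chi (- m) = - chi m"
proof (cases "odd m")
  case True
  then obtain j where "m = 2 * j + 1" by (auto elim: oddE)
  moreover from this have "- m = 2 * (- j - 1) + 1" by simp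
  ultimately have "chi m = sg j" "chi (- m) = sg (- j - 1)" by (simp_all only: chi_odd)
  then show ?thesis by (simp add: sg_def)
qed (simp add: chi_def)

lemma norm_chi_le: "norm (chi m) \<le> 1"
  by (simp add: chi_def)

lemma rapid_bounded_mult:
  assumes "rapid b" "\<And>m. norm (w m) \<le> 1"
  shows "rapid (\<lambda>m. w m * b m)"
  unfolding rapid_def
proof
  fix k
  have "(\<lambda>m. norm (b m * of_int m ^ k)) summable_on UNIV"
    using assms(1) unfolding rapid_def summable_on_iff_abs_summable_on_complex by blast
  then show "(\<lambda>m. w m * b m * of_int m ^ k) summable_on UNIV"
  proof (rule summable_on_comparison_complex)
    show "norm (w m * b m * of_int m ^ k) \<le> norm (b m * of_int m ^ k)" for m
      using mult_right_mono[OF assms(2)[of m], of "norm (b m * of_int m ^ k)"]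
      by (simp add: norm_mult mult.assoc)
  qed
qed

lemma has_sum_moment0:
  assumes "rapid b"
  shows "(b has_sum moment b 0) UNIV"
  using rapid_summable[OF assms, of 0 UNIV] by (simp add: moment_def)

lemma moment0_conv: "rapid b \<Longrightarrow> rapid c \<Longrightarrow> moment (conv b c) 0 = moment b 0 * moment c 0"
  by (simp add: moment_conv)

lemma has_sum_odd_nat:
  "((\<lambda>j. f (2 * j + 1)) has_sum S) UNIV \<Longrightarrow> (f has_sum S) {y::nat. odd y}"
  by (subst has_sum_reindex_bij_witness[of _ "\<lambda>j. 2 * j + 1" "\<lambda>y. y div 2" UNIV "\<lambda>j. f (2 * j + 1)"]) auto

lemma has_sum_geometric_odd:
  fixes x :: "'a::{real_normed_field, banach}"
  assumes "norm x < 1"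
  shows "((\<lambda>y. x ^ y) has_sum x / (1 - x\<^sup>2)) {y::nat. odd y}"
proof (rule has_sum_odd_nat)
  have "norm (x\<^sup>2) < 1" using assms by (simp add: norm_power power_less_one_iff)
  then have "((\<lambda>j. (x\<^sup>2) ^ j) has_sum 1 / (1 - x\<^sup>2)) UNIV"
    by (intro norm_summable_imp_has_sum geometric_sums) (auto simp: norm_power intro!: summable_geometric)
  then have "((\<lambda>j. x * (x\<^sup>2) ^ j) has_sum x * (1 / (1 - x\<^sup>2))) UNIV"
    by (rule has_sum_cmult_right)
  then show "((\<lambda>j. x ^ (2 * j + 1)) has_sum x / (1 - x\<^sup>2)) UNIV"
    by (simp add: power_mult)
qed

lemma has_sum_geometric_chi:
  fixes x :: complex
  assumes "norm x < 1"
  shows "((\<lambda>y. chi (int y) * x ^ y) has_sum x / (1 + x\<^sup>2)) {y::nat. odd y}"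
proof (rule has_sum_odd_nat)
  have "norm (- (x\<^sup>2)) < 1" using assms by (simp add: norm_power power_less_one_iff)
  then have "((\<lambda>j. (- (x\<^sup>2)) ^ j) has_sum 1 / (1 - (- (x\<^sup>2)))) UNIV"
    by (intro norm_summable_imp_has_sum geometric_sums) (auto simp: norm_power intro!: summable_geometric)
  then have "((\<lambda>j. x * (- (x\<^sup>2)) ^ j) has_sum x * (1 / (1 - (- (x\<^sup>2))))) UNIV"
    by (rule has_sum_cmult_right)
  moreover have "x * (- (x\<^sup>2)) ^ j = chi (int (2 * j + 1)) * x ^ (2 * j + 1)" for j
  proof -
    have "(- (x\<^sup>2)) ^ j = (- 1) ^ j * x ^ (2 * j)"
      by (metis mult_minus1 power_mult power_mult_distrib)
    moreover have "int (2 * j + 1) = 2 * int j + 1" by simp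
    ultimately show ?thesis
      unfolding \<open>int (2 * j + 1) = 2 * int j + 1\<close> chi_odd by (simp add: sg_def uminus_power_if)
  qed
  ultimately show "((\<lambda>j. chi (int (2 * j + 1)) * x ^ (2 * j + 1)) has_sum x / (1 + x\<^sup>2)) UNIV"
    by simp
qed

lemma rapid_csch: "nome q \<Longrightarrow> rapid (csch q)"
  by (rule rapid_geometric[OF _ _ nome.norm_csch_le]) (auto simp: nome_def)

lemma (in nome) csch_nat: "csch q (int m) = q ^ m / (1 - (q ^ m)\<^sup>2)"
  by (simp add: csch_alt powi_double)

text \<open>The geometric series over odd \<open>y\<close> turns row \<open>m\<close> into a value
  of \<open>csch\<close>. The row sums of the norms are at most
  \<open>m ^ k * norm q ^ m / (1 - norm q)\<close>, so the double series converges
  absolutely.\<close>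

lemma (in nome) has_sum_lambert_pairs:
  assumes M: "M \<subseteq> {1..}"
  shows "((\<lambda>(m, y). of_nat m ^ k * q ^ (m * y)) has_sum (\<Sum>\<^sub>\<infinity>m\<in>M. of_nat m ^ k * csch q (int m)))
     (M \<times> {y. odd y})"
proof (rule has_sum_SigmaI)
  have lt: "norm q ^ m < 1" if "m \<in> M" for m
    using that M q_lt1 by (auto simp: power_less_one_iff)
  show "((\<lambda>y. case (m, y) of (m, y) \<Rightarrow> of_nat m ^ k * q ^ (m * y)) has_sum of_nat m ^ k * csch q (int m)) {y. odd y}"
    if "m \<in> M" for m
    using has_sum_cmult_right[OF has_sum_geometric_odd[of "q ^ m"], of "of_nat m ^ k"] lt[OF that]
    by (simp add: power_mult csch_nat norm_power)
  let ?r = "norm q"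
  have "(\<lambda>m. inverse (1 - ?r) * (real m ^ k * ?r ^ m)) summable_on M"
    by (rule summable_on_subset[of _ UNIV], rule summable_on_cmult_right)
       (use q_lt1 in \<open>auto intro!: summable_power_geometric\<close>)
  then have bound: "(\<lambda>m. real m ^ k * (?r ^ m / (1 - (?r ^ m)\<^sup>2))) summable_on M"
  proof (rule summable_on_comparison_test)
    fix m assume m: "m \<in> M"
    then have "m \<ge> 1" using M by auto
    then have "?r ^ (m * 2) \<le> ?r ^ 1" using q_lt1 by (intro power_decreasing) auto
    then have *: "1 - (?r ^ m)\<^sup>2 \<ge> 1 - ?r" by (simp add: power_mult)
    then have "?r ^ m / (1 - (?r ^ m)\<^sup>2) \<le> ?r ^ m / (1 - ?r)"
      using q_lt1 by (intro divide_left_mono) auto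
    then have "real m ^ k * (?r ^ m / (1 - (?r ^ m)\<^sup>2)) \<le> real m ^ k * (?r ^ m / (1 - ?r))"
      by (rule mult_left_mono) auto
    also have "\<dots> = inverse (1 - ?r) * (real m ^ k * ?r ^ m)"
      by (simp add: divide_inverse)
    finally show "real m ^ k * (?r ^ m / (1 - (?r ^ m)\<^sup>2)) \<le> inverse (1 - ?r) * (real m ^ k * ?r ^ m)" .
    show "0 \<le> real m ^ k * (?r ^ m / (1 - (?r ^ m)\<^sup>2))"
      using * q_lt1 by auto
  qed
  have "(\<lambda>p. norm ((\<lambda>(m, y). of_nat m ^ k * q ^ (m * y) :: complex) p)) summable_on M \<times> {y. odd y}"
  proof (rule summable_on_SigmaI[OF _ bound])
    show "((\<lambda>y. norm ((\<lambda>(m, y). of_nat m ^ k * q ^ (m * y) :: complex) (m, y))) has_sum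
        real m ^ k * (?r ^ m / (1 - (?r ^ m)\<^sup>2))) {y. odd y}" if "m \<in> M" for m
      using has_sum_cmult_right[OF has_sum_geometric_odd[of "?r ^ m"], of "real m ^ k"] lt[OF that]
      by (simp add: power_mult norm_mult norm_power)
  qed auto
  then show *: "(\<lambda>(m, y). of_nat m ^ k * q ^ (m * y) :: complex) summable_on M \<times> {y. odd y}"
    unfolding summable_on_iff_abs_summable_on_complex .
  have "(\<lambda>m. of_nat m ^ k * csch q (int m)) summable_on M"
  proof -
    have "(\<lambda>m. csch q m * of_int m ^ k) summable_on (int ` M)"
      by (rule rapid_summable, rule rapid_csch) unfold_locales
    then show ?thesis
      by (subst (asm) summable_on_reindex) (auto simp: o_def mult.commute)
  qed
  then show "((\<lambda>m. of_nat m ^ k * csch q (int m)) has_sum (\<Sum>\<^sub>\<infinity>m\<in>M. of_nat m ^ k * csch q (int m))) M"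
    by (rule has_sum_infsum)
qed

section \<open>Triangular numbers and the theta constant \<open>theta3\<close>\<close>

lemma has_sum_int_nonneg:
  fixes h :: "int \<Rightarrow> 'a::topological_comm_monoid_add"
  assumes 1: "((\<lambda>j. h (int j)) has_sum S) UNIV" and 2: "((\<lambda>j. h (- 1 - int j)) has_sum T) UNIV"
  shows "(h has_sum S + T) UNIV"
proof -
  have "(h has_sum S) {0..}"
    using 1 by (subst has_sum_reindex_bij_witness[of _ int nat UNIV "\<lambda>j. h (int j)"]) auto
  moreover have "(h has_sum T) {..<0}"
    using 2 by (subst has_sum_reindex_bij_witness[of _ "\<lambda>j. - 1 - int j" "\<lambda>j. nat (- 1 - j)" UNIV "\<lambda>j. h (- 1 - int j)"]) auto
  ultimately have "(h has_sum S + T) ({0..} \<union> {..<0})"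
    by (rule has_sum_Un_disjoint) auto
  moreover have "{0..} \<union> {..<0} = (UNIV :: int set)" by auto
  ultimately show ?thesis by simp
qed

text \<open>Triangular numbers extended to all integers. The reflection
  \<open>j \<mapsto> - 1 - j\<close> preserves them, so summing over the integers gives twice
  \<open>Delta\<close>.\<close>

definition tri :: "int \<Rightarrow> nat" where
  "tri j = nat (j * (j + 1) div 2)"

lemma int_tri: "2 * int (tri j) = j * (j + 1)"
proof -
  have "j * (j + 1) \<ge> 0" by (cases "j \<ge> 0") (auto simp: mult_nonpos_nonpos)
  moreover have "even (j * (j + 1))" by simp
  ultimately show ?thesis unfolding tri_def by simp
qed

lemma tri_int: "tri (int j) = j * (j + 1) div 2"
  unfolding tri_def by (metis nat_int of_nat_1 of_nat_add of_nat_mult of_nat_numeral zdiv_int)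

lemma tri_reflect: "tri (- 1 - j) = tri j"
  unfolding tri_def by (rule arg_cong[of _ _ "\<lambda>x. nat (x div 2)"]) (simp add: algebra_simps)

lemma summable_triangular:
  fixes x :: complex
  assumes "norm x < 1"
  shows "summable (\<lambda>j. norm (x ^ (j * (j + 1) div 2)))"
proof (rule summable_comparison_test')
  show "summable (\<lambda>j. norm x ^ j)" using assms by (intro summable_geometric) auto
  show "norm (norm (x ^ (j * (j + 1) div 2))) \<le> norm x ^ j" if "j \<ge> 0" for j
  proof -
    have "j * 2 \<le> j * (j + 1)" by (cases j) auto
    then have "j * 2 div 2 \<le> j * (j + 1) div 2" by (rule div_le_mono)
    then have "j \<le> j * (j + 1) div 2" by (simp only: nonzero_mult_div_cancel_right)
    then show ?thesis using assms by (simp add: norm_power power_decreasing)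
  qed
qed

lemma has_sum_Delta:
  assumes "norm x < 1"
  shows "((\<lambda>j. x ^ tri j) has_sum 2 * Delta x) UNIV"
proof -
  have "((\<lambda>j. x ^ tri (int j)) has_sum Delta x) UNIV"
    unfolding Delta_def tri_int
    using summable_triangular[OF assms] by (intro norm_summable_imp_has_sum summable_sums) (auto intro: summable_norm_cancel)
  moreover from this have "((\<lambda>j. x ^ tri (- 1 - int j)) has_sum Delta x) UNIV"
    by (simp add: tri_reflect)
  ultimately have "((\<lambda>j. x ^ tri j) has_sum Delta x + Delta x) UNIV"
    by (rule has_sum_int_nonneg)
  then show ?thesis by simp
qed

lemma summable_on_int_power:
  fixes x :: complex and e :: "int \<Rightarrow> nat"
  assumes "norm x < 1" "\<And>n. nat \<bar>n\<bar> \<le> e n"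
  shows "(\<lambda>n. x ^ e n) summable_on UNIV"
proof (rule summable_on_comparison_complex)
  show "(\<lambda>n::int. norm x ^ nat \<bar>n\<bar>) summable_on UNIV"
    using summable_power_geometric[of "norm x" 0] assms(1) by (intro summable_on_int_split) auto
qed (use assms in \<open>auto simp: norm_power intro: power_decreasing\<close>)

definition theta3 :: "complex \<Rightarrow> complex" where
  "theta3 x = (\<Sum>\<^sub>\<infinity>n::int. x ^ nat (n\<^sup>2))"

lemma nat_abs_le_square: "nat \<bar>n\<bar> \<le> nat ((n::int)\<^sup>2)"
proof -
  have "\<bar>n\<bar> * 1 \<le> \<bar>n\<bar> * \<bar>n\<bar>"
  proof (cases "n = 0")
    case False
    then show ?thesis by (intro mult_left_mono) auto
  qed simp
  then show ?thesis by (simp add: power2_eq_square nat_mono)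
qed

lemma has_sum_theta3:
  assumes "norm x < 1"
  shows "((\<lambda>n::int. x ^ nat (n\<^sup>2)) has_sum theta3 x) UNIV"
  unfolding theta3_def
  by (rule has_sum_infsum, rule summable_on_int_power) (use assms nat_abs_le_square in auto)

text \<open>Pairs of equal parity have the form \<open>(u + v, u - v)\<close>, and there
  \<open>tri (u + v) + tri (u - v) = 2 * tri u + v\<^sup>2\<close>. The reflection
  \<open>b \<mapsto> - 1 - b\<close> carries them to the pairs of opposite parity without changing
  the exponent.\<close>

lemma Delta_square:
  assumes x: "norm x < 1"
  shows "Delta x ^ 2 = Delta (x\<^sup>2) * theta3 x"
proof -
  define G where "G = (\<lambda>(a, b). x ^ tri a * x ^ tri b)"
  define T where "T = {(a, b). even (a - b :: int)}"
  have x2: "norm (x\<^sup>2) < 1" using x by (simp add: norm_power power_less_one_iff)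
  have all: "(G has_sum (2 * Delta x) * (2 * Delta x)) (UNIV \<times> UNIV)"
    unfolding G_def by (intro has_sum_product_complex has_sum_Delta x)
  have 1: "((\<lambda>(u, v). (x\<^sup>2) ^ tri u * x ^ nat (v\<^sup>2)) has_sum (2 * Delta (x\<^sup>2)) * theta3 x) (UNIV \<times> UNIV)"
    by (intro has_sum_product_complex has_sum_Delta has_sum_theta3 x x2)
  have 2: "G ((\<lambda>(u, v). (u + v, u - v)) p) = (\<lambda>(u, v). (x\<^sup>2) ^ tri u * x ^ nat (v\<^sup>2)) p" for p
  proof -
    obtain u v where p: "p = (u, v)" by (cases p)
    have "2 * (int (tri (u + v)) + int (tri (u - v))) = 2 * (2 * int (tri u) + int (nat (v\<^sup>2)))"
      unfolding distrib_left int_tri by (simp add: int_tri power2_eq_square algebra_simps)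
    then have "int (tri (u + v) + tri (u - v)) = int (2 * tri u + nat (v\<^sup>2))" by simp
    then have "tri (u + v) + tri (u - v) = 2 * tri u + nat (v\<^sup>2)" by (simp only: of_nat_eq_iff)
    then show ?thesis
      by (simp add: p G_def flip: power_add power_mult)
  qed
  have 3: "bij_betw (\<lambda>(u, v). (u + v, u - v)) (UNIV \<times> UNIV) T"
  proof (rule bij_betwI[where g = "\<lambda>(a, b). ((a + b) div 2, (a - b) div 2)"])
    show "(\<lambda>(u, v). (u + v, u - v)) ((\<lambda>(a, b). ((a + b) div 2, (a - b) div 2)) p) = p" if p: "p \<in> T" for p
    proof -
      obtain a b where ab: "p = (a, b)" by (cases p)
      then obtain k where "a - b = 2 * k" using p unfolding T_def by blast
      then have "a = b + 2 * k" by simp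
      then show ?thesis using ab by simp
    qed
  qed (auto simp: T_def)
  have even: "(G has_sum (2 * Delta (x\<^sup>2)) * theta3 x) T"
    using has_sum_reindex_bij_betw[OF 3, of G] 1 by (simp only: 2)
  note even
  also have "?this \<longleftrightarrow> (G has_sum (2 * Delta (x\<^sup>2)) * theta3 x) (- T)"
    by (rule has_sum_reindex_bij_witness[of _ "\<lambda>(a, b). (a, - 1 - b)" "\<lambda>(a, b). (a, - 1 - b)"])
       (auto simp: T_def G_def tri_reflect)
  finally have "(G has_sum (2 * Delta (x\<^sup>2)) * theta3 x + (2 * Delta (x\<^sup>2)) * theta3 x) (T \<union> - T)"
    by (intro has_sum_Un_disjoint even) auto
  moreover have "T \<union> - T = UNIV \<times> UNIV" by auto
  ultimately have "(2 * Delta x) * (2 * Delta x) = (2 * Delta (x\<^sup>2)) * theta3 x + (2 * Delta (x\<^sup>2)) * theta3 x"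
    using all has_sum_unique by metis
  then show ?thesis by (simp add: power2_eq_square)
qed

subsection \<open>The theta quotient\<close>

text \<open>The series \<phi> takes the value 2 i \<open>chi_lambert q\<close> where exp t = i. This
  is the function F of the overview; its other expansion is
  \<open>has_sum_odd_csch_sum\<close>.\<close>

definition chi_lambert :: "complex \<Rightarrow> complex" where
  "chi_lambert q = (\<Sum>\<^sub>\<infinity>m\<in>{m::nat. odd m}. chi (int m) * csch q (int m))"

lemma sum_split_even:
  fixes f :: "int \<Rightarrow> complex"
  assumes "(f has_sum S) UNIV" "\<And>m. odd m \<Longrightarrow> f m = 0"
  shows "((\<lambda>j. f (2 * j)) has_sum S) UNIV"
proof -
  have "f = (\<lambda>m. if even m then f m else 0)" using assms(2) by auto
  then show ?thesis using assms(1) has_sum_even_iff[of f S] by simp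
qed

lemma sum_split_odd:
  fixes f :: "int \<Rightarrow> complex"
  assumes "(f has_sum S) UNIV" "\<And>m. even m \<Longrightarrow> f m = 0"
  shows "((\<lambda>j. f (2 * j + 1)) has_sum S) UNIV"
proof -
  have "f = (\<lambda>m. if odd m then f m else 0)" using assms(2) by auto
  then have "((\<lambda>j. f (2 * j - 1)) has_sum S) UNIV"
    using assms(1) has_sum_odd_iff[of f S] by simp
  then show ?thesis
    using has_sum_int_shift[of "\<lambda>j. f (2 * j + 1)" 1 S] by simp
qed

lemma infsum_odd_even_function:
  fixes h :: "int \<Rightarrow> complex"
  assumes "(h has_sum S) UNIV" "\<And>m. h (- m) = h m" "\<And>m. even m \<Longrightarrow> h m = 0"
  shows "S = 2 * (\<Sum>\<^sub>\<infinity>m\<in>{m::nat. odd m}. h (int m))"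
proof -
  have "S = infsum h UNIV" using assms(1) by (simp add: infsumI)
  also have "\<dots> = 2 * (\<Sum>\<^sub>\<infinity>m\<in>{1..}. h (int m))"
    using assms by (intro infsum_int_even_function) (auto simp: summable_on_def)
  also have "(\<Sum>\<^sub>\<infinity>m\<in>{1..}. h (int m)) = (\<Sum>\<^sub>\<infinity>m\<in>{m::nat. odd m}. h (int m))"
    by (rule infsum_cong_neutral) (auto simp: assms(3) Suc_le_eq odd_pos)
  finally show ?thesis .
qed

context nome
begin

lemma rapid_chi: "rapid (\<lambda>m. chi m * odd_csch q m)"
  by (rule rapid_bounded_mult[OF rapid_odd_csch norm_chi_le])

lemma moment_chi: "moment (\<lambda>m. chi m * odd_csch q m) 0 = 2 * chi_lambert q"
proof -
  have "moment (\<lambda>m. chi m * odd_csch q m) 0 = 2 * (\<Sum>\<^sub>\<infinity>m\<in>{m::nat. odd m}. chi (int m) * odd_csch q (int m))"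
    by (rule infsum_odd_even_function[OF has_sum_moment0[OF rapid_chi]])
       (simp_all add: chi_uminus odd_csch_uminus, simp add: odd_csch_def)
  also have "(\<Sum>\<^sub>\<infinity>m\<in>{m::nat. odd m}. chi (int m) * odd_csch q (int m)) = chi_lambert q"
    unfolding chi_lambert_def by (rule infsum_cong) (auto simp: odd_csch_def)
  finally show ?thesis .
qed

lemma csch_square: "csch (q\<^sup>2) m = csch q (2 * m)"
  by (simp add: csch_def power_int_mult flip: power_int_numeral)
     (simp add: power_int_minus power_int_mult)

text \<open>Evaluation of the square of the series at a quarter period.\<close>

lemma chi_lambert_square: "nome.odd_lambert (q\<^sup>2) 1 = chi_lambert q ^ 2"
proof -
  let ?a = "odd_csch q"
  let ?b = "\<lambda>m. chi m * odd_csch q m"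
  let ?c = "conv ?a ?a"
  \<comment> \<open>For odd \<open>m\<close> the characters of \<open>m\<close> and
    \<open>2 * M - m\<close> multiply to a sign that depends on \<open>M\<close> alone.\<close>
  have b: "conv ?b ?b (2 * M) = - sg M * ?c (2 * M)" for M
  proof -
    have "?b m * ?b (2 * M - m) = - sg M * (?a m * ?a (2 * M - m))" for m
    proof (cases "odd m")
      case True
      then obtain j where m: "m = 2 * j + 1" by (auto elim: oddE)
      have "2 * M - m = 2 * (M - j - 1) + 1" using m by simp
      then have "chi (2 * M - m) = sg (M - j - 1)" by (simp only: chi_odd)
      then have "chi m * chi (2 * M - m) = - sg M"
        using m by (simp only: chi_odd) (simp add: sg_def)
      moreover have "?b m * ?b (2 * M - m) = (chi m * chi (2 * M - m)) * (?a m * ?a (2 * M - m))"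
        by (simp only: mult_ac)
      ultimately show ?thesis by (simp only:)
    qed (simp add: odd_csch_def)
    then show ?thesis
      unfolding conv_def by (simp only: infsum_cmult_right')
  qed
  have b0: "conv ?b ?b N = 0" if "odd N" for N
    unfolding conv_def by (rule infsum_0) (use that in \<open>auto simp: odd_csch_def\<close>)
  have "((\<lambda>M. - sg M * ?c (2 * M)) has_sum (2 * chi_lambert q) * (2 * chi_lambert q)) UNIV"
    using sum_split_even[OF has_sum_moment0[OF rapid_conv[OF rapid_chi rapid_chi]] b0]
    unfolding b moment0_conv[OF rapid_chi rapid_chi] moment_chi by simp
  \<comment> \<open>The coefficients of the square of \<phi> sum to 0 because \<phi> vanishes at 0.
    Adding this relation cancels all even \<open>M\<close>, in particular the unknown coefficient at
    0, and doubles the odd ones.\<close>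
  moreover have "((\<lambda>M. ?c (2 * M)) has_sum 0) UNIV"
    using sum_split_even[OF has_sum_moment0[OF rapid_conv[OF rapid_odd_csch rapid_odd_csch]] conv_odd_csch_odd]
    unfolding moment0_conv[OF rapid_odd_csch rapid_odd_csch] moment_0_odd_csch by simp
  ultimately have "((\<lambda>M. - sg M * ?c (2 * M) + ?c (2 * M)) has_sum
      (2 * chi_lambert q) * (2 * chi_lambert q) + 0) UNIV"
    by (rule has_sum_add)
  also have "(\<lambda>M. - sg M * ?c (2 * M) + ?c (2 * M)) = (\<lambda>M. if odd M then 2 * (of_int M * csch q (2 * M)) else 0)"
  proof
    fix M :: int
    show "- sg M * ?c (2 * M) + ?c (2 * M) = (if odd M then 2 * (of_int M * csch q (2 * M)) else 0)"
      using conv_odd_csch_even[of M] by (cases "M = 0") (auto simp: sg_def)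
  qed
  finally have "(2 * chi_lambert q) * (2 * chi_lambert q) + 0 =
      2 * (\<Sum>\<^sub>\<infinity>m\<in>{m::nat. odd m}. if odd (int m) then 2 * (of_int (int m) * csch q (2 * int m)) else 0)"
    by (rule infsum_odd_even_function) (auto simp: csch_uminus)
  also have "(\<Sum>\<^sub>\<infinity>m\<in>{m::nat. odd m}. if odd (int m) then 2 * (of_int (int m) * csch q (2 * int m)) else 0)
     = (\<Sum>\<^sub>\<infinity>m\<in>{m::nat. odd m}. 2 * (of_nat m ^ 1 * csch (q\<^sup>2) (int m)))"
  proof (rule infsum_cong)
    show "(if odd (int m) then 2 * (of_int (int m) * csch q (2 * int m)) else 0)
        = 2 * (of_nat m ^ 1 * csch (q\<^sup>2) (int m))" if "m \<in> {m. odd m}" for m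
      using that by (simp add: csch_square)
  qed
  also have "nome (q\<^sup>2)" by unfold_locales (use q_nz q_lt1 in \<open>auto simp: norm_power power_less_one_iff\<close>)
  then have "(\<Sum>\<^sub>\<infinity>m\<in>{m::nat. odd m}. 2 * (of_nat m ^ 1 * csch (q\<^sup>2) (int m))) = 2 * nome.odd_lambert (q\<^sup>2) 1"
    by (simp only: infsum_cmult_right' nome.odd_lambert_def)
  finally show ?thesis by (simp add: power2_eq_square)
qed

text \<open>Both forms are the double series of \<open>chi m * q ^ (m * y)\<close> over odd
  \<open>m\<close> and \<open>y\<close>: summing over \<open>y\<close> first gives
  \<open>chi_lambert\<close>, summing over \<open>m\<close> first gives the terms here.\<close>

lemma has_sum_odd_csch_sum:
  "((\<lambda>m. q ^ m / (1 + (q ^ m)\<^sup>2)) has_sum chi_lambert q) {m::nat. odd m}"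
proof -
  let ?O = "{m::nat. odd m}"
  have O: "?O \<subseteq> {1..}" by (auto simp: Suc_le_eq odd_pos)
  have lt: "norm (q ^ m) < 1" if "m \<in> ?O" for m
    using that q_lt1 O by (auto simp: norm_power power_less_one_iff odd_pos)
  have "(\<lambda>(m, y). q ^ (m * y)) summable_on ?O \<times> ?O"
    using has_sum_lambert_pairs[OF O, of 0] by (auto simp: summable_on_def)
  then have s: "(\<lambda>(m, y). chi (int m) * q ^ (m * y)) summable_on ?O \<times> ?O"
    unfolding summable_on_iff_abs_summable_on_complex
    by (rule Infinite_Sum.abs_summable_on_comparison_test) 
       (auto simp: norm_mult intro!: mult_left_le_one_le norm_chi_le)
  have 1: "(\<Sum>\<^sub>\<infinity>y\<in>?O. chi (int m) * q ^ (m * y)) = chi (int m) * csch q (int m)" if "m \<in> ?O" for m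
    using has_sum_geometric_odd[of "q ^ m"] lt[OF that]
    by (simp add: infsum_cmult_right' infsumI power_mult csch_nat)
  have 2: "(\<Sum>\<^sub>\<infinity>m\<in>?O. chi (int m) * q ^ (m * y)) = q ^ y / (1 + (q ^ y)\<^sup>2)" if "y \<in> ?O" for y
    using infsumI[OF has_sum_geometric_chi[OF lt[OF that]]]
    by (simp add: mult.commute flip: power_mult)
  have s': "(\<lambda>(y, m). chi (int m) * q ^ (m * y)) summable_on ?O \<times> ?O"
    using s summable_on_swap[of "\<lambda>(m, y). chi (int m) * q ^ (m * y)" ?O ?O] by (simp add: case_prod_unfold)
  have "(\<lambda>y. \<Sum>\<^sub>\<infinity>m\<in>?O. chi (int m) * q ^ (m * y)) summable_on ?O"
    using summable_on_Sigma_banach[OF s'] by simp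
  moreover have "chi_lambert q = (\<Sum>\<^sub>\<infinity>m\<in>?O. \<Sum>\<^sub>\<infinity>y\<in>?O. chi (int m) * q ^ (m * y))"
    unfolding chi_lambert_def by (rule infsum_cong) (rule 1[symmetric])
  then have "chi_lambert q = (\<Sum>\<^sub>\<infinity>y\<in>?O. \<Sum>\<^sub>\<infinity>m\<in>?O. chi (int m) * q ^ (m * y))"
    using infsum_swap_banach[OF s] by simp
  ultimately have "((\<lambda>y. \<Sum>\<^sub>\<infinity>m\<in>?O. chi (int m) * q ^ (m * y)) has_sum chi_lambert q) ?O"
    by (simp add: has_sum_iff)
  then show ?thesis
    by (rule has_sum_cong[THEN iffD1, rotated]) (rule 2)
qed

text \<open>Coefficients of the theta series in t with terms
  \<open>sg j * q powi (4 * j\<^sup>2) * exp (2 * j * t)\<close>, the denominator of the theta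
  quotient.\<close>

definition alt_gauss :: "int \<Rightarrow> complex" where
  "alt_gauss k = (if even k then sg (k div 2) * q powi (k\<^sup>2) else 0)"

text \<open>The coefficients of the product of \<open>\<phi>\<close> (for the parameter \<open>q\<^sup>2\<close>) with the series of
  \<open>alt_gauss\<close>; the two-term recursion \<open>theta_coeff_shift\<close> identifies this product with a
  theta series.\<close>

definition theta_coeff :: "int \<Rightarrow> complex" where
  "theta_coeff N = conv (odd_csch (q\<^sup>2)) alt_gauss N"

lemma norm_powi_le:
  assumes "e \<ge> int n"
  shows "norm (q powi e) \<le> norm q ^ n"
proof -
  have "norm (q powi e) = norm q ^ nat e"
    using assms by (simp add: power_int_def norm_power)
  also have "\<dots> \<le> norm q ^ n"
    using assms q_lt1 by (intro power_decreasing) auto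
  finally show ?thesis .
qed

lemma abs_le_square_int: "\<bar>n::int\<bar> \<le> n\<^sup>2"
proof (cases "n = 0")
  case False
  then have "\<bar>n\<bar> * 1 \<le> \<bar>n\<bar> * \<bar>n\<bar>" by (intro mult_left_mono) auto
  then show ?thesis by (simp add: power2_eq_square)
qed simp

lemma rapid_gauss:
  assumes "\<And>k. norm (w k) \<le> 1" "\<And>k. even k \<Longrightarrow> e k \<ge> \<bar>k\<bar> - int c"
  shows "rapid (\<lambda>k. if even k then w k * q powi e k else 0)"
proof (rule rapid_geometric[of "norm q" _ "norm (q powi (- int c))"])
  fix k
  have "norm (w k * q powi e k) \<le> norm (q powi (- int c)) * norm q ^ nat \<bar>k\<bar>" if k: "even k"
  proof -
    have "norm (w k * q powi e k) \<le> 1 * norm (q powi ((- int c) + (e k + int c)))"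
      unfolding norm_mult by (intro mult_mono assms) auto
    also have "\<dots> = norm (q powi (- int c)) * norm (q powi (e k + int c))"
      by (simp only: powi_add norm_mult mult_1)
    also have "\<dots> \<le> norm (q powi (- int c)) * norm q ^ nat \<bar>k\<bar>"
      by (intro mult_left_mono norm_powi_le) (use assms(2)[OF k] in auto)
    finally show ?thesis .
  qed
  then show "norm (if even k then w k * q powi e k else 0) \<le> norm (q powi (- int c)) * norm q ^ nat \<bar>k\<bar>"
    by simp
qed (use q_lt1 in auto)

lemma nome_square: "nome (q\<^sup>2)"
  by unfold_locales (use q_nz q_lt1 in \<open>auto simp: norm_power power_less_one_iff\<close>)

lemma rapid_alt_gauss: "rapid alt_gauss"
  unfolding alt_gauss_def[abs_def] by (rule rapid_gauss[where c = 0]) (auto simp: abs_le_square_int)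

lemma alt_gauss_shift: "alt_gauss (k + 2) = - (q powi (4 * k + 4)) * alt_gauss k"
proof (cases "even k")
  case True
  have "(k + 2)\<^sup>2 = (4 * k + 4) + k\<^sup>2" by (simp add: power2_eq_square algebra_simps)
  then have "q powi ((k + 2)\<^sup>2) = q powi (4 * k + 4) * q powi (k\<^sup>2)" by (simp only: powi_add)
  moreover have "sg ((k + 2) div 2) = - sg (k div 2)" using True by (simp add: sg_def)
  ultimately show ?thesis using True by (simp add: alt_gauss_def)
qed (simp add: alt_gauss_def)

lemma rapid_sq: "rapid (odd_csch (q\<^sup>2))"
  by (rule nome.rapid_odd_csch[OF nome_square])

text \<open>Shifting \<open>alt_gauss\<close> by 2 costs a factor that, after scaling, is
  \<open>inverse (x\<^sup>2)\<close> for \<open>x = q powi (2 * m)\<close>. Then \<open>(inverse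
  (x\<^sup>2) - 1) * (x / (1 - x\<^sup>2)) = inverse x\<close> clears the denominator, and what
  remains is the theta series at one of its zeros.\<close>

lemma theta_coeff_shift:
  assumes N: "odd N"
  shows "theta_coeff (N + 2) = - (q powi (4 * N + 4)) * theta_coeff N"
proof -
  let ?a = "odd_csch (q\<^sup>2)"
  have 1: "((\<lambda>m. ?a m * alt_gauss (N - m)) has_sum theta_coeff N) UNIV"
    unfolding theta_coeff_def by (rule has_sum_conv[OF rapid_sq rapid_alt_gauss])
  have 2: "((\<lambda>m. ?a m * alt_gauss (N + 2 - m)) has_sum theta_coeff (N + 2)) UNIV"
    unfolding theta_coeff_def by (rule has_sum_conv[OF rapid_sq rapid_alt_gauss])
  have diff: "- (q powi (- (4 * N + 4))) * (?a m * alt_gauss (N + 2 - m)) - ?a m * alt_gauss (N - m)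
      = q powi (- 2 * N) * (alt_gauss (N - m) * q powi (2 * (N - m)))" for m
  proof (cases "odd m")
    case False
    then show ?thesis using N by (simp add: odd_csch_def alt_gauss_def)
  next
    case True
    then have m: "m \<noteq> 0" by auto
    have g: "alt_gauss (N + 2 - m) = - (q powi (4 * (N - m) + 4)) * alt_gauss (N - m)"
      using alt_gauss_shift[of "N - m"] by (simp add: algebra_simps)
    have e1: "q powi (- (4 * N + 4)) * q powi (4 * (N - m) + 4) = q powi (2 * (2 * (- m)))"
      by (simp flip: powi_add)
    have e2: "q powi (- 2 * N) * q powi (2 * (N - m)) = q powi (2 * (- m))"
      by (simp flip: powi_add)
    define x where "x = q powi (2 * m)"
    have x: "x \<noteq> 0" "x\<^sup>2 \<noteq> 1"
      using q_nz powi_double_neq_1[of "2 * m"] m unfolding x_def powi_double[of "2 * m", symmetric] by auto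
    have a: "?a m = x / (1 - x\<^sup>2)"
      using True unfolding odd_csch_def csch_square csch_alt powi_double[of "2 * m"] x_def by simp
    have xi: "q powi (2 * (- m)) = inverse x" "q powi (2 * (2 * (- m))) = inverse (x\<^sup>2)"
      using powi_double[of "2 * (- m)"] by (simp_all add: x_def power_int_minus power_inverse)
    have "inverse (x\<^sup>2) * (x / (1 - x\<^sup>2)) - x / (1 - x\<^sup>2) = inverse x"
      using x by (simp add: divide_simps power2_eq_square)
    then have key: "(q powi (2 * (2 * (- m))) * ?a m - ?a m) * alt_gauss (N - m) = q powi (2 * (- m)) * alt_gauss (N - m)"
      unfolding a xi by simp
    have "- (q powi (- (4 * N + 4))) * (?a m * alt_gauss (N + 2 - m)) - ?a m * alt_gauss (N - m)
       = (q powi (- (4 * N + 4)) * q powi (4 * (N - m) + 4) * ?a m - ?a m) * alt_gauss (N - m)"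
      unfolding g by (simp add: algebra_simps)
    also have "\<dots> = q powi (2 * (- m)) * alt_gauss (N - m)"
      unfolding e1 by (rule key)
    finally show ?thesis
      unfolding e2[symmetric] by (simp add: mult_ac)
  qed
  \<comment> \<open>The exponent \<open>k\<^sup>2 + 2 * k\<close> is invariant under
    \<open>k \<mapsto> - 2 - k\<close>, while the sign of \<open>alt_gauss\<close> flips; the sum
    equals its own negative.\<close>
  have zero: "((\<lambda>k. alt_gauss k * q powi (2 * k)) has_sum 0) UNIV"
  proof -
    have "(\<lambda>k. alt_gauss k * q powi (2 * k)) = (\<lambda>k. if even k then sg (k div 2) * q powi (k\<^sup>2 + 2 * k) else 0)"
      by (auto simp: alt_gauss_def powi_add)
    moreover have "rapid (\<lambda>k. if even k then sg (k div 2) * q powi (k\<^sup>2 + 2 * k) else 0)"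
    proof (rule rapid_gauss[where c = 2])
      show "\<bar>k\<bar> - int 2 \<le> k\<^sup>2 + 2 * k" if k: "even k" for k :: int
      proof -
        obtain j where j: "k = 2 * j" using k by (auto elim: evenE)
        have "2 * \<bar>j\<bar> - 2 \<le> 4 * (j * j) + 4 * j"
        proof (cases "j \<le> - 2")
          case True
          then have "(- j) * 2 \<le> (- j) * (- j)" by (intro mult_left_mono) auto
          then show ?thesis using True by simp
        next
          case False
          then have "j \<ge> 0 \<or> j = -1" by auto
          moreover have "\<bar>j\<bar> \<le> j * j" using abs_le_square_int[of j] by (simp add: power2_eq_square)
          ultimately show ?thesis by auto
        qed
        moreover have "\<bar>k\<bar> = 2 * \<bar>j\<bar>" "k\<^sup>2 + 2 * k = 4 * (j * j) + 4 * j"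
          by (simp_all add: j power2_eq_square abs_mult)
        ultimately show ?thesis by simp
      qed
    qed auto
    ultimately obtain S where S: "((\<lambda>k. alt_gauss k * q powi (2 * k)) has_sum S) UNIV"
      using has_sum_moment0 by metis
    have "((\<lambda>k. alt_gauss (- (k - (- 2))) * q powi (2 * (- (k - (- 2))))) has_sum S) UNIV"
      using has_sum_int_shift[of "\<lambda>k. alt_gauss (- k) * q powi (2 * (- k))" "- 2" S] S
        has_sum_int_uminus[of "\<lambda>k. alt_gauss k * q powi (2 * k)" S] by simp
    also have "(\<lambda>k. alt_gauss (- (k - (- 2))) * q powi (2 * (- (k - (- 2))))) = (\<lambda>k. - (alt_gauss k * q powi (2 * k)))"
    proof
      fix k :: int
      show "alt_gauss (- (k - (- 2))) * q powi (2 * (- (k - (- 2)))) = - (alt_gauss k * q powi (2 * k))"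
      proof (cases "even k")
        case True
        then obtain j where j: "k = 2 * j" by (auto elim: evenE)
        have k2: "- (k - (- 2)) = 2 * (- j - 1)" by (simp add: j)
        moreover have "alt_gauss (2 * t) = sg t * q powi ((2 * t)\<^sup>2)" for t
          by (simp add: alt_gauss_def)
        ultimately have "alt_gauss (- (k - (- 2))) = sg (- j - 1) * q powi ((2 * (- j - 1))\<^sup>2)"
          by (simp only:)
        moreover have "(2 * (- j - 1))\<^sup>2 + 2 * (2 * (- j - 1)) = k\<^sup>2 + 2 * k"
          by (simp add: j power2_eq_square algebra_simps)
        then have "q powi ((2 * (- j - 1))\<^sup>2) * q powi (2 * (2 * (- j - 1))) = q powi (k\<^sup>2) * q powi (2 * k)"
          by (simp only: powi_add[symmetric])
        moreover have "sg (- j - 1) = - sg j" by (simp add: sg_def)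
        moreover have "alt_gauss k = sg j * q powi (k\<^sup>2)" by (simp add: alt_gauss_def j)
        ultimately show ?thesis
          unfolding k2 by (simp add: mult.assoc)
      qed (simp add: alt_gauss_def)
    qed
    finally have "((\<lambda>k. - (alt_gauss k * q powi (2 * k))) has_sum S) UNIV" .
    then have "S = - S" using has_sum_uminusI[OF S] has_sum_unique by blast
    then show ?thesis using S by simp
  qed
  have "((\<lambda>m. alt_gauss (N - m) * q powi (2 * (N - m))) has_sum 0) UNIV"
    by (rule has_sum_reindex_bij_betw[THEN iffD2, OF _ zero])
       (rule bij_betwI[where g = "\<lambda>m. N - m"], auto)
  then have "((\<lambda>m. q powi (- 2 * N) * (alt_gauss (N - m) * q powi (2 * (N - m)))) has_sum q powi (- 2 * N) * 0) UNIV"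
    by (rule has_sum_cmult_right)
  then have "((\<lambda>m. - (q powi (- (4 * N + 4))) * (?a m * alt_gauss (N + 2 - m)) - ?a m * alt_gauss (N - m)) has_sum 0) UNIV"
    unfolding diff by simp
  moreover have "((\<lambda>m. - (q powi (- (4 * N + 4))) * (?a m * alt_gauss (N + 2 - m)) + - (?a m * alt_gauss (N - m)))
      has_sum - (q powi (- (4 * N + 4))) * theta_coeff (N + 2) + - theta_coeff N) UNIV"
    by (intro has_sum_add has_sum_cmult_right has_sum_uminusI 1 2)
  ultimately have "- (q powi (- (4 * N + 4))) * theta_coeff (N + 2) + - theta_coeff N = 0"
    using has_sum_unique by fastforce
  moreover have "q powi (4 * N + 4) * q powi (- (4 * N + 4)) = 1"
    by (simp flip: powi_add)
  moreover have "t' = - w * t" if "- v * t' + - t = 0" "w * v = 1" for t t' v w :: complex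
  proof -
    have "t = - v * t'" using that(1) by (metis add_eq_0_iff minus_minus)
    then show ?thesis by (simp add: that(2) mult.assoc[symmetric])
  qed
  ultimately show ?thesis by blast
qed

end

section \<open>Holomorphy of the series on the unit disc\<close>

lemma holomorphic_on_suminf_geometric:
  fixes f :: "nat \<Rightarrow> complex \<Rightarrow> complex"
  assumes hol: "\<And>n. f n holomorphic_on ball 0 1"
    and bound: "\<And>r n y. 0 < r \<Longrightarrow> r < 1 \<Longrightarrow> norm y \<le> r \<Longrightarrow> norm (f n y) \<le> C r * r ^ n"
  shows "(\<lambda>x. \<Sum>n. f n x) holomorphic_on ball 0 1"
proof -
  have ex: "\<exists>d h. 0 < d \<and> summable h \<and> range h \<subseteq> \<real>\<^sub>\<ge>\<^sub>0 \<and>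
      (\<forall>\<^sub>F n in sequentially. \<forall>y\<in>ball x d \<inter> ball 0 1. cmod (f n y) \<le> cmod (h n))"
    if x: "x \<in> ball 0 1" for x
  proof (intro exI conjI)
    \<comment> \<open>With \<open>r\<close> halfway between \<open>norm x\<close> and 1, a single
      geometric majorant serves the ball of radius \<open>(1 - norm x) / 2\<close> about
      \<open>x\<close>.\<close>
    define r where "r = (1 + norm x) / 2"
    have r: "0 < r" "r < 1" "norm x < r" using x by (auto simp: r_def intro: add_pos_nonneg)
    show "0 < (1 - norm x) / 2" using x by auto
    show "summable (\<lambda>n. complex_of_real (\<bar>C r\<bar> * r ^ n))"
      using r by (intro summable_of_real summable_mult summable_geometric) auto
    show "range (\<lambda>n. complex_of_real (\<bar>C r\<bar> * r ^ n)) \<subseteq> \<real>\<^sub>\<ge>\<^sub>0"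
      using r by (auto simp: complex_nonneg_Reals_iff)
    have "norm (f n y) \<le> norm (complex_of_real (\<bar>C r\<bar> * r ^ n))" if y: "y \<in> ball x ((1 - norm x) / 2)" for n y
    proof -
      have "norm y \<le> r"
        using y norm_triangle_ineq3[of x y] by (simp add: dist_norm r_def field_simps)
      then have "norm (f n y) \<le> C r * r ^ n" using r by (intro bound) auto
      also have "\<dots> \<le> \<bar>C r\<bar> * r ^ n" using r by (intro mult_right_mono) auto
      finally show ?thesis using r by (simp add: norm_mult norm_power)
    qed
    then show "\<forall>\<^sub>F n in sequentially. \<forall>y\<in>ball x ((1 - norm x) / 2) \<inter> ball 0 1.
        cmod (f n y) \<le> cmod (complex_of_real (\<bar>C r\<bar> * r ^ n))"
      by simp
  qed
  have diff: "f n field_differentiable (at x)" if "x \<in> ball 0 1" for n x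
    using hol that by (simp add: holomorphic_on_open field_differentiable_def)
  obtain g where g: "\<forall>x \<in> ball 0 1. ((\<lambda>n. f n x) sums g x) \<and> g field_differentiable (at x)"
  proof (rule series_differentiable_comparison_complex[of "ball 0 1" f])
    show "f n field_differentiable (at x)" if "x \<in> ball 0 1" for n x
      using that by (rule diff)
  qed (use ex in auto)
  then have "g holomorphic_on ball 0 1"
    by (auto simp: holomorphic_on_def intro: field_differentiable_at_within)
  then show ?thesis
    by (rule holomorphic_transform) (use g in \<open>auto dest: sums_unique\<close>)
qed

lemma Delta_holomorphic: "Delta holomorphic_on ball 0 1"
proof -
  have "norm (x ^ (n * (n + 1) div 2)) \<le> 1 * r ^ n" if "0 < r" "r < 1" "norm x \<le> r" for r :: real and n and x :: complex
  proof -
    have "n * 2 \<le> n * (n + 1)" by (cases n) auto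
    then have "n * 2 div 2 \<le> n * (n + 1) div 2" by (rule div_le_mono)
    then have "n \<le> n * (n + 1) div 2" by (simp only: nonzero_mult_div_cancel_right)
    then have "norm x ^ (n * (n + 1) div 2) \<le> norm x ^ n" using that by (intro power_decreasing) auto
    also have "\<dots> \<le> r ^ n" using that by (intro power_mono) auto
    finally show ?thesis by (simp add: norm_power)
  qed
  then have "(\<lambda>x. \<Sum>n. x ^ (n * (n + 1) div 2)) holomorphic_on ball (0::complex) 1"
    by (intro holomorphic_on_suminf_geometric[where C = "\<lambda>_. 1"] holomorphic_intros) auto
  then show ?thesis by (simp only: Delta_def[abs_def])
qed

lemma Delta_0 [simp]: "Delta 0 = 1"
proof -
  have "(\<lambda>j. (0::complex) ^ (j * (j + 1) div 2)) = (\<lambda>j. if j = 0 then 1 else 0)"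
  proof
    fix j :: nat
    show "(0::complex) ^ (j * (j + 1) div 2) = (if j = 0 then 1 else 0)"
    proof (cases j)
      case (Suc i)
      then have "2 \<le> j * (j + 1)" by simp
      then have "j * (j + 1) div 2 \<noteq> 0" by simp
      then show ?thesis using Suc by simp
    qed simp
  qed
  then show ?thesis
    using sums_unique[OF sums_single[of 0 "\<lambda>_. 1::complex"]] by (simp add: Delta_def)
qed

text \<open>This is \<open>chi_lambert\<close> with a factor \<open>q\<close> divided out
  (\<open>chi_lambert_eq\<close>). The form is holomorphic at 0 with value 1, as the limit argument
  requires.\<close>

definition sech_lambert :: "complex \<Rightarrow> complex" where
  "sech_lambert q = (\<Sum>j. q ^ (2 * j) / (1 + q ^ (4 * j + 2)))"

lemma norm_one_plus_power_ge:
  fixes x :: complex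
  assumes "norm x \<le> r" "r < 1" "k > 0"
  shows "norm (1 + x ^ k) \<ge> 1 - r"
proof -
  have "norm x ^ k \<le> norm x ^ 1" using assms by (intro power_decreasing) auto
  then show ?thesis
    using norm_diff_ineq[of 1 "x ^ k"] assms by (simp add: norm_power)
qed

lemma norm_sech_term_le:
  fixes x :: complex
  assumes "norm x \<le> r" "r < 1"
  shows "norm (x ^ (2 * j) / (1 + x ^ (4 * j + 2))) \<le> inverse (1 - r) * r ^ j"
proof -
  have "0 \<le> r" using assms(1) norm_ge_zero order_trans by blast
  have "norm x ^ (2 * j) \<le> norm x ^ j" using assms by (intro power_decreasing) auto
  also have "\<dots> \<le> r ^ j" using assms by (intro power_mono) auto
  finally have "norm x ^ (2 * j) / norm (1 + x ^ (4 * j + 2)) \<le> r ^ j / (1 - r)"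
    using norm_one_plus_power_ge[OF assms, of "4 * j + 2"] assms \<open>0 \<le> r\<close> by (intro frac_le) auto
  then show ?thesis
    unfolding norm_divide norm_power by (simp only: divide_inverse mult.commute)
qed

lemma sech_lambert_holomorphic: "sech_lambert holomorphic_on ball 0 1"
proof -
  have "1 + x ^ (4 * n + 2) \<noteq> 0" if "norm x < 1" for n and x :: complex
    using norm_one_plus_power_ge[of x "norm x" "4 * n + 2"] that by auto
  then have "(\<lambda>x. \<Sum>j. x ^ (2 * j) / (1 + x ^ (4 * j + 2))) holomorphic_on ball (0::complex) 1"
    by (intro holomorphic_on_suminf_geometric[where C = "\<lambda>r. inverse (1 - r)"] holomorphic_intros norm_sech_term_le) auto
  then show ?thesis by (simp only: sech_lambert_def[abs_def])
qed

lemma sech_lambert_0 [simp]: "sech_lambert 0 = 1"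
proof -
  have "(\<lambda>j. (0::complex) ^ (2 * j) / (1 + 0 ^ (4 * j + 2))) = (\<lambda>j. if j = 0 then 1 else 0)"
    by (auto simp: power_0_left)
  then show ?thesis
    using sums_unique[OF sums_single[of 0 "\<lambda>_. 1::complex"]] by (simp add: sech_lambert_def)
qed

section \<open>Values of the theta quotient and the duplication formula\<close>

context nome
begin

text \<open>The shift is iterated in both directions; its exponents \<open>8 * j + 8\<close> add up
  to \<open>4 * (j * (j + 1))\<close>. So \<phi> times the \<open>alt_gauss\<close> series is
  \<open>theta_coeff 1\<close> times another theta series.\<close>

lemma theta_coeff_odd: "theta_coeff (2 * j + 1) = sg j * q powi (4 * (j * (j + 1))) * theta_coeff 1"
proof (induction j rule: int_induct[where k = 0])
  case base
  then show ?case by (simp add: sg_def)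
next
  case (step1 j)
  have "theta_coeff (2 * (j + 1) + 1) = - (q powi (8 * j + 8)) * theta_coeff (2 * j + 1)"
    using theta_coeff_shift[of "2 * j + 1"] by (simp add: algebra_simps)
  moreover have "4 * ((j + 1) * (j + 1 + 1)) = (8 * j + 8) + 4 * (j * (j + 1))" by (simp add: algebra_simps)
  ultimately show ?case
    unfolding step1(2) by (simp only: powi_add) (simp add: sg_def)
next
  case (step2 j)
  have "theta_coeff (2 * j + 1) = - (q powi (8 * j)) * theta_coeff (2 * (j - 1) + 1)"
    using theta_coeff_shift[of "2 * (j - 1) + 1"] by (simp add: algebra_simps)
  then have "theta_coeff (2 * (j - 1) + 1) = - (q powi (- (8 * j))) * theta_coeff (2 * j + 1)"
    using q_nz by (simp add: power_int_minus)
  moreover have "4 * ((j - 1) * (j - 1 + 1)) = (- (8 * j)) + 4 * (j * (j + 1))" by (simp add: algebra_simps)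
  ultimately show ?case
    unfolding step2(2) by (simp only: powi_add) (simp add: sg_def)
qed

lemma theta_coeff_even: "even N \<Longrightarrow> theta_coeff N = 0"
  unfolding theta_coeff_def conv_def by (rule infsum_0) (auto simp: odd_csch_def alt_gauss_def)

text \<open>Used to evaluate the theta quotient at a point: there both coefficient sequences acquire
  weights, and if these combine to a factor \<open>w\<close> depending on \<open>N\<close> only, the
  product still has the coefficients \<open>theta_coeff\<close>.\<close>

lemma conv_twisted:
  assumes "\<And>m. odd m \<Longrightarrow> even (N - m) \<Longrightarrow> b m * s (N - m) = w * (odd_csch (q\<^sup>2) m * alt_gauss (N - m))"
    and "\<And>m. even m \<Longrightarrow> b m = 0" "\<And>k. odd k \<Longrightarrow> s k = 0"
  shows "conv b s N = w * theta_coeff N"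
proof -
  have "b m * s (N - m) = w * (odd_csch (q\<^sup>2) m * alt_gauss (N - m))" for m
  proof (cases "odd m \<and> even (N - m)")
    case False
    then have "even m \<or> odd (N - m)" by blast
    then have "b m * s (N - m) = 0" using assms(2)[of m] assms(3)[of "N - m"] by (metis mult_eq_0_iff)
    moreover have "odd_csch (q\<^sup>2) m * alt_gauss (N - m) = 0"
      using False by (auto simp: odd_csch_def alt_gauss_def)
    ultimately show ?thesis by (simp only: mult_zero_right)
  qed (use assms in blast)
  then show ?thesis
    unfolding theta_coeff_def conv_def by (simp only: infsum_cmult_right')
qed

lemma powi_square_eq: "q powi ((2 * j)\<^sup>2) = (q ^ 4) ^ nat (j\<^sup>2)"
proof -
  have "int (4 * nat (j\<^sup>2)) = (2 * j)\<^sup>2" by (simp add: power_mult_distrib)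
  then have "q powi ((2 * j)\<^sup>2) = q ^ (4 * nat (j\<^sup>2))" by (metis power_int_of_nat)
  then show ?thesis by (simp add: power_mult)
qed

lemma powi_tri_eq: "q powi (4 * (j * (j + 1))) = (q ^ 8) ^ tri j"
proof -
  have "int (8 * tri j) = 4 * (j * (j + 1))" using int_tri[of j] by simp
  then have "q powi (4 * (j * (j + 1))) = q ^ (8 * tri j)" by (metis power_int_of_nat)
  then show ?thesis by (simp add: power_mult)
qed

lemma norm_power_lt1: "k > 0 \<Longrightarrow> norm (q ^ k) < 1"
  using q_lt1 by (simp add: norm_power power_less_one_iff)

text \<open>Evaluation at exp t = i, with the common factor i left out. The signs of
  \<open>alt_gauss\<close> disappear, giving \<open>theta3 (q ^ 4)\<close>, and \<open>chi\<close>
  cancels the signs in \<open>theta_coeff_odd\<close>, leaving triangular powers of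
  \<open>q ^ 8\<close>.\<close>

lemma theta_quotient_at_half_period:
  "chi_lambert (q\<^sup>2) * theta3 (q ^ 4) = theta_coeff 1 * Delta (q ^ 8)"
proof -
  interpret sq: nome "q\<^sup>2" by (rule nome_square)
  let ?b = "\<lambda>m. chi m * odd_csch (q\<^sup>2) m"
  let ?s = "\<lambda>k. if even k then 1 * q powi (k\<^sup>2) else 0"
  have s: "rapid ?s" by (rule rapid_gauss[where c = 0]) (auto simp: abs_le_square_int)
  have conv: "conv ?b ?s N = chi N * theta_coeff N" for N
  proof (rule conv_twisted)
    fix m assume m: "odd m" "even (N - m)"
    obtain j where j: "m = 2 * j + 1" using m(1) by (auto elim: oddE)
    obtain n where n: "N - m = 2 * n" using m(2) by (blast elim: evenE)
    have N: "N = 2 * (j + n) + 1" using j n by simp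
    have "chi m = chi N * sg n" unfolding j N chi_odd by (simp add: sg_add mult.assoc)
    then show "?b m * ?s (N - m) = chi N * (odd_csch (q\<^sup>2) m * alt_gauss (N - m))"
      by (simp add: n alt_gauss_def)
  qed (auto simp: odd_csch_def)
  have 1: "moment ?s 0 = theta3 (q ^ 4)"
  proof (rule has_sum_unique)
    show "((\<lambda>j. (q ^ 4) ^ nat (j\<^sup>2)) has_sum theta3 (q ^ 4)) UNIV"
      by (rule has_sum_theta3) (simp add: norm_power_lt1)
    show "((\<lambda>j. (q ^ 4) ^ nat (j\<^sup>2)) has_sum moment ?s 0) UNIV"
      using sum_split_even[OF has_sum_moment0[OF s]] unfolding powi_square_eq[symmetric] by simp
  qed
  have "((\<lambda>j. chi (2 * j + 1) * theta_coeff (2 * j + 1)) has_sum (2 * chi_lambert (q\<^sup>2)) * theta3 (q ^ 4)) UNIV"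
    using sum_split_odd[OF has_sum_moment0[OF rapid_conv[OF sq.rapid_chi s]]]
    unfolding moment0_conv[OF sq.rapid_chi s] sq.moment_chi 1 conv by (simp add: theta_coeff_even)
  moreover have "chi (2 * j + 1) * theta_coeff (2 * j + 1) = theta_coeff 1 * (q ^ 8) ^ tri j" for j
    unfolding chi_odd theta_coeff_odd powi_tri_eq by (simp add: mult.assoc[symmetric])
  ultimately have "((\<lambda>j. theta_coeff 1 * (q ^ 8) ^ tri j) has_sum (2 * chi_lambert (q\<^sup>2)) * theta3 (q ^ 4)) UNIV"
    by simp
  moreover have "((\<lambda>j. theta_coeff 1 * (q ^ 8) ^ tri j) has_sum theta_coeff 1 * (2 * Delta (q ^ 8))) UNIV"
    by (intro has_sum_cmult_right has_sum_Delta norm_power_lt1) auto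
  ultimately have "(2 * chi_lambert (q\<^sup>2)) * theta3 (q ^ 4) = theta_coeff 1 * (2 * Delta (q ^ 8))"
    by (rule has_sum_unique)
  then show ?thesis by simp
qed

lemma rapid_twisted_csch: "rapid (\<lambda>m. q powi (- m) * odd_csch (q\<^sup>2) m)"
proof (rule rapid_geometric)
  fix m :: int
  let ?C = "inverse (1 - norm q)"
  have "norm (q powi (- m) * odd_csch (q\<^sup>2) m) \<le> norm (q powi (- m)) * norm (csch q (2 * m))"
    by (simp add: norm_mult odd_csch_def csch_square)
  also have "\<dots> \<le> norm (q powi (- m)) * (?C * norm q ^ nat \<bar>2 * m\<bar>)"
    by (intro mult_left_mono norm_csch_le) auto
  also have "\<dots> = ?C * norm (q powi (- m + int (nat \<bar>2 * m\<bar>)))"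
    by (simp only: powi_add power_int_of_nat norm_mult norm_power mult_ac)
  also have "\<dots> \<le> ?C * norm q ^ nat \<bar>m\<bar>"
    using q_lt1 by (intro mult_left_mono norm_powi_le) auto
  finally show "norm (q powi (- m) * odd_csch (q\<^sup>2) m) \<le> ?C * norm q ^ nat \<bar>m\<bar>" .
qed (use q_lt1 in auto)

text \<open>The value at exp t = \<open>inverse q\<close> of \<phi> for the parameter
  \<open>q\<^sup>2\<close>. Folding \<open>m\<close> with \<open>- m\<close> gives \<open>(inverse x
  - x) * (x\<^sup>2 / (1 - x ^ 4)) = x / (1 + x\<^sup>2)\<close> for
  \<open>x = q ^ m\<close>.\<close>

lemma moment_twisted_csch: "moment (\<lambda>m. q powi (- m) * odd_csch (q\<^sup>2) m) 0 = chi_lambert q"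
proof -
  define b where "b = (\<lambda>m. q powi (- m) * odd_csch (q\<^sup>2) m)"
  have b: "(b has_sum moment b 0) UNIV"
    unfolding b_def by (rule has_sum_moment0[OF rapid_twisted_csch])
  then have "((\<lambda>m. b (- m)) has_sum moment b 0) UNIV" by (simp only: has_sum_int_uminus)
  with b have "((\<lambda>m. 1/2 * (b m + b (- m))) has_sum 1/2 * (moment b 0 + moment b 0)) UNIV"
    by (intro has_sum_cmult_right has_sum_add)
  then have "1/2 * (moment b 0 + moment b 0) = 2 * (\<Sum>\<^sub>\<infinity>m\<in>{m::nat. odd m}. 1/2 * (b (int m) + b (- int m)))"
    by (rule infsum_odd_even_function) (auto simp: b_def odd_csch_def add.commute)
  also have "(\<Sum>\<^sub>\<infinity>m\<in>{m::nat. odd m}. 1/2 * (b (int m) + b (- int m))) = 1/2 * (\<Sum>\<^sub>\<infinity>m\<in>{m::nat. odd m}. b (int m) + b (- int m))"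
    by (rule infsum_cmult_right')
  also have "(\<Sum>\<^sub>\<infinity>m\<in>{m::nat. odd m}. b (int m) + b (- int m)) = (\<Sum>\<^sub>\<infinity>m\<in>{m::nat. odd m}. q ^ m / (1 + (q ^ m)\<^sup>2))"
  proof (rule infsum_cong)
    fix m :: nat assume m: "m \<in> {m. odd m}"
    define x where "x = q ^ m"
    have "m > 0" using m by (auto simp: odd_pos)
    then have "norm (q ^ (4 * m)) < 1" by (intro norm_power_lt1) auto
    then have n4: "x ^ 4 \<noteq> 1" by (auto simp: x_def mult.commute simp flip: power_mult)
    have x4: "x ^ 4 = x\<^sup>2 * x\<^sup>2" by (simp add: power2_eq_square power4_eq_xxxx)
    have "x\<^sup>2 \<noteq> 1" using n4 x4 by (metis mult_1)
    moreover have "x\<^sup>2 \<noteq> - 1" using n4 x4 by (metis mult_minus1 minus_minus)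
    then have "1 + x\<^sup>2 \<noteq> 0" by (metis add_eq_0_iff)
    ultimately have x: "x\<^sup>2 \<noteq> 1" "1 + x\<^sup>2 \<noteq> 0" by blast+
    have x0: "x \<noteq> 0" using q_nz by (simp add: x_def)
    have "csch q (2 * int m) = x\<^sup>2 / (1 - x ^ 4)"
      using csch_nat[of "2 * m"] by (simp add: x_def mult.commute flip: power_mult)
    then have b: "b (int m) = inverse x * (x\<^sup>2 / (1 - x ^ 4))" "b (- int m) = - x * (x\<^sup>2 / (1 - x ^ 4))"
      using m unfolding b_def odd_csch_def csch_square by (simp_all add: power_int_minus x_def csch_uminus)
    have "(inverse x - x) * (x\<^sup>2 / (1 - x ^ 4)) = x / (1 + x\<^sup>2)"
    proof -
      have 1: "1 - x ^ 4 = (1 - x\<^sup>2) * (1 + x\<^sup>2)" unfolding x4 by (simp add: algebra_simps)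
      have 2: "(inverse x - x) * x\<^sup>2 = (1 - x\<^sup>2) * x" using x0 by (simp add: power2_eq_square field_simps)
      have "(inverse x - x) * (x\<^sup>2 / (1 - x ^ 4)) = ((inverse x - x) * x\<^sup>2) / (1 - x ^ 4)" by simp
      also have "\<dots> = x / (1 + x\<^sup>2)" unfolding 1 2 using x by simp
      finally show ?thesis .
    qed
    moreover have "inverse x * Q + - x * Q = (inverse x - x) * Q" for Q
      by (simp add: algebra_simps)
    ultimately show "b (int m) + b (- int m) = q ^ m / (1 + (q ^ m)\<^sup>2)"
      unfolding b x_def[symmetric] by (simp only:)
  qed
  also have "\<dots> = chi_lambert q" by (rule infsumI[OF has_sum_odd_csch_sum])
  finally show ?thesis by (simp add: b_def)
qed

text \<open>Evaluation at exp t = \<open>inverse q\<close>. After \<open>j \<mapsto> - j\<close> the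
  same theta value \<open>\<Theta>\<close> stands on both sides; the bound on \<open>q\<close> lets
  its term at \<open>j = 0\<close> dominate, so that it can be cancelled.\<close>

lemma theta_quotient_at_quarter:
  assumes "norm q < 1 / 2"
  shows "q * chi_lambert q = theta_coeff 1"
proof -
  let ?b = "\<lambda>m. q powi (- m) * odd_csch (q\<^sup>2) m"
  let ?s = "\<lambda>k. if even k then sg (k div 2) * q powi (k\<^sup>2 - k) else 0"
  have exp_ge: "\<bar>2 * j\<bar> \<le> (2 * j)\<^sup>2 - 2 * j" for j :: int
    using abs_le_square_int[of j] by (simp add: power_mult_distrib)
  have s: "rapid ?s"
    by (rule rapid_gauss[where c = 0]) (use exp_ge in \<open>auto elim!: evenE\<close>)
  have conv: "conv ?b ?s N = q powi (- N) * theta_coeff N" for N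
  proof (rule conv_twisted)
    fix m assume m: "odd m" "even (N - m)"
    have "q powi (- m) * q powi ((N - m)\<^sup>2 - (N - m)) = q powi (- N) * q powi ((N - m)\<^sup>2)"
      by (simp flip: powi_add)
    then show "?b m * ?s (N - m) = q powi (- N) * (odd_csch (q\<^sup>2) m * alt_gauss (N - m))"
      using m by (simp add: alt_gauss_def)
  qed (auto simp: odd_csch_def)
  define f where "f j = sg j * q powi ((2 * j)\<^sup>2 - 2 * j)" for j
  define \<Theta> where "\<Theta> = moment ?s 0"
  have f: "(f has_sum \<Theta>) UNIV"
    using sum_split_even[OF has_sum_moment0[OF s]] by (simp add: \<Theta>_def f_def[abs_def])
  have "((\<lambda>j. q powi (- (2 * j + 1)) * theta_coeff (2 * j + 1)) has_sum chi_lambert q * \<Theta>) UNIV"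
    using sum_split_odd[OF has_sum_moment0[OF rapid_conv[OF rapid_twisted_csch s]]]
    unfolding moment0_conv[OF rapid_twisted_csch s] moment_twisted_csch conv \<Theta>_def[symmetric]
    by (simp add: theta_coeff_even)
  moreover have "q powi (- (2 * j + 1)) * theta_coeff (2 * j + 1) = inverse q * theta_coeff 1 * f (- j)" for j
  proof -
    have "(- (2 * j + 1)) + 4 * (j * (j + 1)) = - 1 + ((2 * (- j))\<^sup>2 - 2 * (- j))"
      by (simp add: power2_eq_square algebra_simps)
    then have e: "q powi (- (2 * j + 1)) * q powi (4 * (j * (j + 1))) = inverse q * q powi ((2 * (- j))\<^sup>2 - 2 * (- j))"
      by (metis power_int_minus1_right powi_add)
    have "q powi (- (2 * j + 1)) * theta_coeff (2 * j + 1) =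
        sg j * theta_coeff 1 * (q powi (- (2 * j + 1)) * q powi (4 * (j * (j + 1))))"
      unfolding theta_coeff_odd by (simp only: mult_ac)
    also have "\<dots> = inverse q * theta_coeff 1 * f (- j)"
      unfolding e f_def sg_uminus by (simp only: mult_ac)
    finally show ?thesis .
  qed
  ultimately have "((\<lambda>j. inverse q * theta_coeff 1 * f (- j)) has_sum chi_lambert q * \<Theta>) UNIV"
    by simp
  moreover have "((\<lambda>j. inverse q * theta_coeff 1 * f (- j)) has_sum inverse q * theta_coeff 1 * \<Theta>) UNIV"
    by (intro has_sum_cmult_right) (use f in \<open>simp add: has_sum_int_uminus\<close>)
  ultimately have eq: "chi_lambert q * \<Theta> = inverse q * theta_coeff 1 * \<Theta>"
    by (rule has_sum_unique)
  have "\<Theta> \<noteq> 0"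
  proof
    assume 0: "\<Theta> = 0"
    have "((\<lambda>j::int. if j = 0 then - 1 else 0) has_sum (- 1 :: complex)) UNIV"
      by (rule has_sum_finite_neutralI[of "{0}"]) auto
    from has_sum_add[OF f this]
    have "((\<lambda>j. f j + (if j = 0 then - 1 else 0)) has_sum - 1) UNIV" by (simp add: 0)
    \<comment> \<open>The majorant sums to 4/3 over \<open>j \<ge> 0\<close> and to 1/3 over
      \<open>j < 0\<close>; taking away the term at 0 leaves 2/3, which is less than the 1 that
      \<open>\<Theta> = 0\<close> would demand.\<close>
    moreover have "((\<lambda>j::int. (1/4) ^ nat \<bar>j\<bar> + (if j = 0 then - 1 else 0)) has_sum (4/3 + 1/3 + - 1 :: real)) UNIV"
    proof -
      have geo: "((\<lambda>j. (1/4) ^ j) has_sum (4/3 :: real)) UNIV"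
        using geometric_sums[of "1/4::real"] by (intro sums_nonneg_imp_has_sum) auto
      have "((\<lambda>j. 1/4 * (1/4) ^ j) has_sum (1/4 * (4/3) :: real)) UNIV"
        by (intro has_sum_cmult_right geo)
      then have "((\<lambda>j. (1/4) ^ nat \<bar>- 1 - int j\<bar>) has_sum (1/3 :: real)) UNIV"
        by (simp add: nat_add_distrib abs_if algebra_simps)
      then have "((\<lambda>j::int. (1/4) ^ nat \<bar>j\<bar>) has_sum (4/3 + 1/3 :: real)) UNIV"
        by (intro has_sum_int_nonneg) (use geo in auto)
      moreover have "((\<lambda>j::int. if j = 0 then - 1 else 0) has_sum (- 1 :: real)) UNIV"
        by (rule has_sum_finite_neutralI[of "{0}"]) auto
      ultimately show ?thesis
        by (rule has_sum_add)
    qed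
    moreover have "norm (f j + (if j = 0 then - 1 else 0)) \<le> (1/4) ^ nat \<bar>j\<bar> + (if j = 0 then - 1 else 0)" for j
    proof (cases "j = 0")
      case False
      have "norm (f j) \<le> norm q ^ nat \<bar>2 * j\<bar>"
        unfolding f_def norm_mult norm_sg mult_1 by (rule norm_powi_le) (use exp_ge[of j] in auto)
      also have "\<dots> = (norm q ^ 2) ^ nat \<bar>j\<bar>"
        by (simp add: abs_mult nat_mult_distrib flip: power_mult)
      also have "\<dots> \<le> (1/4) ^ nat \<bar>j\<bar>"
        using power_mono[of "norm q" "1/2" 2] assms by (intro power_mono) (auto simp: power2_eq_square)
      finally show ?thesis using False by simp
    qed (simp add: f_def sg_def)
    ultimately have "norm (- 1 :: complex) \<le> 4/3 + 1/3 + - 1"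
      by (rule norm_infsum_le)
    then show False by simp
  qed
  with eq show ?thesis using q_nz by (simp add: field_simps)
qed

lemma chi_lambert_eq: "chi_lambert q = q * sech_lambert q"
proof -
  have "((\<lambda>j. q ^ (2 * j + 1) / (1 + (q ^ (2 * j + 1))\<^sup>2)) has_sum chi_lambert q) UNIV"
    using has_sum_odd_csch_sum
    by (subst has_sum_reindex_bij_witness[of UNIV "\<lambda>y. y div 2" "\<lambda>j. 2 * j + 1" "{m. odd m}" "\<lambda>m. q ^ m / (1 + (q ^ m)\<^sup>2)"]) auto
  moreover have "q ^ (2 * j + 1) / (1 + (q ^ (2 * j + 1))\<^sup>2) = q * (q ^ (2 * j) / (1 + q ^ (4 * j + 2)))" for j
  proof -
    have "(2 * j + 1) * 2 = 4 * j + 2" by simp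
    then have "(q ^ (2 * j + 1))\<^sup>2 = q ^ (4 * j + 2)" by (metis power_mult)
    then show ?thesis by simp
  qed
  ultimately have "((\<lambda>j. q * (q ^ (2 * j) / (1 + q ^ (4 * j + 2)))) has_sum chi_lambert q) UNIV"
    by (simp only:)
  then have "(\<lambda>j. q * (q ^ (2 * j) / (1 + q ^ (4 * j + 2)))) sums chi_lambert q"
    by (rule has_sum_imp_sums)
  then have "(\<lambda>j. inverse q * (q * (q ^ (2 * j) / (1 + q ^ (4 * j + 2))))) sums (inverse q * chi_lambert q)"
    by (rule sums_mult)
  then have "sech_lambert q = inverse q * chi_lambert q"
    using q_nz unfolding sech_lambert_def by (simp add: sums_iff mult.assoc[symmetric])
  then show ?thesis using q_nz by simp
qed

text \<open>The two evaluations are combined by eliminating \<open>theta_coeff 1\<close>;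
  \<open>Delta_square\<close> at \<open>q ^ 4\<close> then eliminates \<open>theta3\<close>.\<close>

lemma sech_lambert_duplication:
  assumes "norm q < 1 / 2"
  shows "sech_lambert q * Delta (q ^ 8) ^ 2 = sech_lambert (q\<^sup>2) * Delta (q ^ 4) ^ 2"
proof -
  interpret sq: nome "q\<^sup>2" by (rule nome_square)
  have "q\<^sup>2 * sech_lambert (q\<^sup>2) * theta3 (q ^ 4) = q\<^sup>2 * sech_lambert q * Delta (q ^ 8)"
    using theta_quotient_at_half_period theta_quotient_at_quarter[OF assms] chi_lambert_eq sq.chi_lambert_eq
    by (simp add: power2_eq_square mult_ac)
  then have "sech_lambert (q\<^sup>2) * theta3 (q ^ 4) = sech_lambert q * Delta (q ^ 8)"
    using q_nz by simp
  moreover have "Delta (q ^ 4) ^ 2 = Delta (q ^ 8) * theta3 (q ^ 4)"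
    using Delta_square[OF norm_power_lt1[of 4]] by (simp flip: power_mult)
  ultimately show ?thesis by (simp add: power2_eq_square mult_ac)
qed

end

text \<open>Near 0, where \<open>Delta\<close> has no zero, the quotient \<open>h\<close> is
  invariant under squaring its argument. Repeated squaring tends to 0, so \<open>h\<close> equals
  \<open>h 0 = 1\<close> there, and analytic continuation covers the disc.\<close>

lemma sech_lambert_eq_Delta:
  assumes "norm q < 1"
  shows "sech_lambert q = Delta (q ^ 4) ^ 2"
proof -
  have "continuous_on (ball 0 1) Delta" "continuous_on (ball 0 1) sech_lambert"
    by (auto intro: holomorphic_on_imp_continuous_on Delta_holomorphic sech_lambert_holomorphic)
  then have cont: "isCont Delta 0" "isCont sech_lambert 0"
    by (auto simp: continuous_on_eq_continuous_at)
  then have "eventually (\<lambda>x. Delta x \<noteq> 0) (at 0)"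
    using tendsto_imp_eventually_ne[of Delta "Delta 0" "at 0" 0] by (simp add: isCont_def)
  then obtain d where d: "d > 0" "\<And>x. x \<noteq> 0 \<Longrightarrow> norm x < d \<Longrightarrow> Delta x \<noteq> 0"
    by (auto simp: eventually_at)
  define e where "e = min d (1/2)"
  have e: "e > 0" "e \<le> 1/2" "\<And>x. norm x < e \<Longrightarrow> Delta x \<noteq> 0"
    using d by (auto simp: e_def) (metis Delta_0 zero_neq_one)
  define h where "h q = sech_lambert q / Delta (q ^ 4) ^ 2" for q
  have small: "norm (x ^ k) < e" if "norm x < e" "k > 0" for k and x :: complex
  proof -
    have "norm x ^ k \<le> norm x ^ 1" using that e by (intro power_decreasing) auto
    then show ?thesis using that by (simp add: norm_power)
  qed
  have step: "h x = h (x\<^sup>2)" if x: "norm x < e" for x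
  proof (cases "x = 0")
    case False
    interpret nome x by unfold_locales (use False x e in auto)
    have "Delta (x ^ 4) \<noteq> 0" "Delta (x ^ 8) \<noteq> 0" using small[OF x] e(3) by auto
    moreover have "sech_lambert x * Delta (x ^ 8) ^ 2 = sech_lambert (x\<^sup>2) * Delta (x ^ 4) ^ 2"
      using x e by (intro sech_lambert_duplication) auto
    ultimately show ?thesis
      unfolding h_def by (simp add: field_simps flip: power_mult)
  qed (simp add: h_def)
  have eq: "sech_lambert x = Delta (x ^ 4) ^ 2" if x: "x \<in> ball 0 e" for x
  proof -
    have "h x = h (x ^ (2 ^ k))" for k
    proof (induction k)
      case (Suc k)
      have "h (x ^ (2 ^ k)) = h ((x ^ (2 ^ k))\<^sup>2)" by (rule step, rule small) (use x in auto)
      then show ?case using Suc by (simp add: mult.commute flip: power_mult)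
    qed simp
    moreover have "(\<lambda>k. h (x ^ (2 ^ k))) \<longlonglongrightarrow> h 0"
    proof (rule isCont_tendsto_compose[of 0 h])
      have "isCont (\<lambda>y. Delta (y ^ 4)) 0"
        by (rule isCont_o2[where g = Delta]) (use cont in auto)
      then show "isCont h 0"
        unfolding h_def[abs_def] by (intro continuous_intros cont) auto
      have "(\<lambda>n. x ^ n) \<longlonglongrightarrow> 0" using x e by (intro LIMSEQ_power_zero) auto
      moreover have "filterlim (\<lambda>k. 2 ^ k :: nat) at_top sequentially"
        by (rule filterlim_subseq) (auto simp: strict_mono_def)
      ultimately show "(\<lambda>k. x ^ (2 ^ k)) \<longlonglongrightarrow> 0"
        by (rule filterlim_compose)
    qed
    ultimately have "(\<lambda>k::nat. h x) \<longlonglongrightarrow> h 0" by simp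
    then have "h x = h 0" using LIMSEQ_unique tendsto_const by blast
    then have "sech_lambert x / Delta (x ^ 4) ^ 2 = 1" by (simp add: h_def)
    then show ?thesis by (simp add: divide_eq_1_iff)
  qed
  have hol: "(\<lambda>x. Delta (x ^ 4) ^ 2) holomorphic_on ball 0 1"
  proof -
    have "(Delta \<circ> (\<lambda>x. x ^ 4)) holomorphic_on ball 0 1"
      by (intro holomorphic_on_compose_gen[OF _ Delta_holomorphic] holomorphic_intros)
         (auto simp: norm_power power_less_one_iff)
    then show ?thesis by (intro holomorphic_intros) (simp add: o_def)
  qed
  show ?thesis
    by (rule analytic_continuation_open[of "ball 0 e" "ball 0 1" sech_lambert])
       (use e assms eq hol sech_lambert_holomorphic in auto)
qed

text \<open>A square root \<open>p\<close> of \<open>q\<close> is needed because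
  \<open>chi_lambert_square\<close> expresses the series at a squared nome.\<close>

lemma (in nome) odd_lambert_1: "odd_lambert 1 = q * Delta (q\<^sup>2) ^ 4"
proof -
  define p where "p = csqrt q"
  have p: "p\<^sup>2 = q" by (simp add: p_def)
  have "norm p < 1"
    using q_lt1 unfolding p[symmetric] by (simp add: norm_power power_less_one_iff)
  then interpret p: nome p by unfold_locales (use q_nz p in auto)
  have "odd_lambert 1 = (p * sech_lambert p) ^ 2"
    using p.chi_lambert_square p.chi_lambert_eq by (simp add: p)
  also have "\<dots> = q * Delta (p ^ 4) ^ 4"
    using sech_lambert_eq_Delta[OF \<open>norm p < 1\<close>] by (simp add: power_mult_distrib p flip: power_mult)
  also have "p ^ 4 = q\<^sup>2" by (simp flip: p power_mult)
  finally show ?thesis .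
qed

subsection \<open>Andreief's identity and decreasing tuples\<close>

text \<open>Column operations as a matrix product: the coefficient matrix \<open>U\<close> of the
  monic Newton polynomials \<open>P j\<close> is unitriangular, and their values at the nodes form a
  lower triangular matrix.\<close>

lemma det_vandermonde:
  fixes x :: "nat \<Rightarrow> 'a::idom"
  shows "Determinant.det (Matrix.mat n n (\<lambda>(i, j). x i ^ j)) = (\<Prod>s<n. \<Prod>r<s. x s - x r)"
proof -
  define P where "P k = (\<Prod>r<k. [:- x r, 1:])" for k
  have deg: "degree (P k) = k" for k
    unfolding P_def by (subst degree_prod_eq_sum_degree) auto
  have lead: "coeff (P k) k = 1" for k
  proof -
    have "lead_coeff (P k) = 1" unfolding P_def by (simp add: lead_coeff_prod)
    then show ?thesis by (simp add: deg)
  qed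
  define X where "X = Matrix.mat n n (\<lambda>(i, j). x i ^ j)"
  define U where "U = Matrix.mat n n (\<lambda>(i, j). coeff (P j) i)"
  define N where "N = Matrix.mat n n (\<lambda>(i, j). poly (P j) (x i))"
  have carr: "X \<in> carrier_mat n n" "U \<in> carrier_mat n n" "N \<in> carrier_mat n n"
    by (auto simp: X_def U_def N_def)
  have "X * U = N"
  proof (rule eq_matI)
    fix i j assume "i < dim_row N" "j < dim_col N"
    then have ij: "i < n" "j < n" by (auto simp: N_def)
    have "poly (P j) (x i) = (\<Sum>k\<le>j. coeff (P j) k * x i ^ k)"
      by (simp add: poly_altdef deg)
    also have "\<dots> = (\<Sum>k=0..<n. coeff (P j) k * x i ^ k)"
      by (rule sum.mono_neutral_left) (use ij in \<open>auto simp: coeff_eq_0 deg\<close>)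
    finally show "(X * U) $$ (i, j) = N $$ (i, j)"
      using ij by (simp add: X_def U_def N_def scalar_prod_def mult.commute)
  qed (auto simp: X_def U_def N_def)
  moreover have "Determinant.det U = 1"
    by (subst det_upper_triangular[OF _ carr(2)])
       (auto simp: U_def prod_list_diag_prod lead coeff_eq_0 deg)
  moreover have "Determinant.det N = (\<Prod>s<n. \<Prod>r<s. x s - x r)"
    by (subst det_lower_triangular[OF _ carr(3)])
       (auto simp: N_def P_def prod_list_diag_prod poly_prod atLeast0LessThan)
  ultimately show ?thesis
    using det_mult[OF carr(1,2)] by (simp add: X_def)
qed

lemma has_sum_prod_PiE:
  fixes f :: "'i \<Rightarrow> 'a \<Rightarrow> complex"
  assumes "finite A" "\<And>i. i \<in> A \<Longrightarrow> (f i has_sum s i) (B i)"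
  shows "((\<lambda>z. \<Prod>i\<in>A. f i (z i)) has_sum (\<Prod>i\<in>A. s i)) (PiE A B)"
  using assms
proof (induction A rule: finite_induct)
  case (insert a A)
  have "((\<lambda>(y, z). f a y * (\<Prod>i\<in>A. f i (z i))) has_sum s a * (\<Prod>i\<in>A. s i)) (B a \<times> PiE A B)"
    by (intro has_sum_product_complex insert.IH insert.prems) auto
  moreover have "f a y * (\<Prod>i\<in>A. f i (z i)) = (\<Prod>i\<in>insert a A. f i ((z(a := y)) i))" for y z
  proof -
    have "(\<Prod>i\<in>A. f i ((z(a := y)) i)) = (\<Prod>i\<in>A. f i (z i))"
      by (rule prod.cong) (use insert.hyps in auto)
    then show ?thesis using insert.hyps by simp
  qed
  ultimately have "(((\<lambda>z. \<Prod>i\<in>insert a A. f i (z i)) \<circ> (\<lambda>(y, z). z(a := y))) has_sum s a * (\<Prod>i\<in>A. s i))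
      (B a \<times> PiE A B)"
    by (simp add: o_def case_prod_unfold)
  then have "((\<lambda>z. \<Prod>i\<in>insert a A. f i (z i)) has_sum s a * (\<Prod>i\<in>A. s i)) ((\<lambda>(y, z). z(a := y)) ` (B a \<times> PiE A B))"
    by (subst has_sum_reindex) (auto intro!: inj_combinator insert.hyps)
  then show ?case using insert.hyps by (simp add: PiE_insert_eq)
next
  case empty
  show ?case using has_sum_finite[of "{\<lambda>x. undefined}" "\<lambda>_. 1 :: complex"] by simp
qed

text \<open>The squared product is the square of a Vandermonde determinant. Expanding both factors
  over permutations makes every summand a product of one-variable series, which sum to entries of
  the Hankel matrix.\<close>

lemma has_sum_andreief:
  fixes g x :: "'a \<Rightarrow> complex"
  assumes \<mu>: "\<And>k. ((\<lambda>z. g z * x z ^ k) has_sum \<mu> k) Z"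
  shows "((\<lambda>z. (\<Prod>i<n. g (z i)) * (\<Prod>s<n. \<Prod>r<s. (x (z s) - x (z r))\<^sup>2)) has_sum
    (fact n * hankel_det n \<mu>)) ({..<n} \<rightarrow>\<^sub>E Z)"
proof -
  let ?S = "{p. p permutes {0..<n}}"
  define V where "V z = Determinant.det (Matrix.mat n n (\<lambda>(i, j). x (z i) ^ j))" for z :: "nat \<Rightarrow> 'a"
  have V: "V z = (\<Sum>p\<in>?S. signof p * (\<Prod>i<n. x (z i) ^ p i))" for z
  proof -
    have "V z = (\<Sum>p\<in>?S. signof p * (\<Prod>i=0..<n. Matrix.mat n n (\<lambda>(i, j). x (z i) ^ j) $$ (i, p i)))"
      unfolding V_def by (rule det_def') simp
    also have "\<dots> = (\<Sum>p\<in>?S. signof p * (\<Prod>i<n. x (z i) ^ p i))"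
    proof (rule sum.cong[OF refl])
      fix p assume "p \<in> ?S"
      then have "p i < n" if "i < n" for i using that by (auto dest: permutes_in_image)
      then show "signof p * (\<Prod>i=0..<n. Matrix.mat n n (\<lambda>(i, j). x (z i) ^ j) $$ (i, p i)) = signof p * (\<Prod>i<n. x (z i) ^ p i)"
        by (simp add: atLeast0LessThan)
    qed
    finally show ?thesis .
  qed
  have sq: "(\<Prod>s<n. \<Prod>r<s. (x (z s) - x (z r))\<^sup>2) = V z * V z" for z
    unfolding V_def det_vandermonde by (simp add: prod_power_distrib power2_eq_square flip: prod.distrib)
  \<comment> \<open>For fixed \<open>s\<close> the sum over \<open>p\<close> is the Hankel
    determinant with rows permuted by \<open>s\<close>. The second sign of \<open>s\<close> cancels
    this one, so all \<open>fact n\<close> outer terms agree.\<close>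
  have inner: "(\<Sum>p\<in>?S. signof p * (\<Prod>i<n. \<mu> (s i + p i))) = signof s * hankel_det n \<mu>" if s: "s \<in> ?S" for s
  proof -
    let ?H = "Matrix.mat n n (\<lambda>(i, j). \<mu> (i + j))"
    have s_lt: "s i < n" if "i < n" for i using s that by (auto dest: permutes_in_image)
    have "signof s * hankel_det n \<mu> = Determinant.det (Matrix.mat n n (\<lambda>(i, j). ?H $$ (s i, j)))"
      unfolding hankel_det_def using s by (intro det_permute_rows[symmetric]) auto
    also have "Matrix.mat n n (\<lambda>(i, j). ?H $$ (s i, j)) = Matrix.mat n n (\<lambda>(i, j). \<mu> (s i + j))"
      using s_lt by (intro eq_matI) auto
    also have "Determinant.det \<dots> = (\<Sum>p\<in>?S. signof p * (\<Prod>i=0..<n. Matrix.mat n n (\<lambda>(i, j). \<mu> (s i + j)) $$ (i, p i)))"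
      by (rule det_def') simp
    also have "\<dots> = (\<Sum>p\<in>?S. signof p * (\<Prod>i<n. \<mu> (s i + p i)))"
    proof (rule sum.cong[OF refl])
      fix p assume "p \<in> ?S"
      then have "p i < n" if "i < n" for i using that by (auto dest: permutes_in_image)
      then show "signof p * (\<Prod>i=0..<n. Matrix.mat n n (\<lambda>(i, j). \<mu> (s i + j)) $$ (i, p i)) = signof p * (\<Prod>i<n. \<mu> (s i + p i))"
        by (simp add: atLeast0LessThan)
    qed
    finally show ?thesis by simp
  qed
  have "((\<lambda>z. \<Sum>s\<in>?S. \<Sum>p\<in>?S. signof s * signof p * (\<Prod>i<n. g (z i) * x (z i) ^ (s i + p i)))
      has_sum (\<Sum>s\<in>?S. \<Sum>p\<in>?S. signof s * signof p * (\<Prod>i<n. \<mu> (s i + p i)))) ({..<n} \<rightarrow>\<^sub>E Z)"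
    by (intro has_sum_finite_sum has_sum_cmult_right has_sum_prod_PiE finite_permutations \<mu>) auto
  also have "(\<lambda>z. \<Sum>s\<in>?S. \<Sum>p\<in>?S. signof s * signof p * (\<Prod>i<n. g (z i) * x (z i) ^ (s i + p i)))
      = (\<lambda>z. (\<Prod>i<n. g (z i)) * (V z * V z))"
    unfolding V sum_product by (simp add: sum_distrib_left power_add prod.distrib mult_ac)
  also have "(\<Sum>s\<in>?S. \<Sum>p\<in>?S. signof s * signof p * (\<Prod>i<n. \<mu> (s i + p i))) =
      (\<Sum>s\<in>?S. signof s * (signof s * hankel_det n \<mu>))"
    by (intro sum.cong refl) (simp add: inner mult.assoc flip: sum_distrib_left)
  also have "\<dots> = (\<Sum>s\<in>?S. hankel_det n \<mu>)"
    by (intro sum.cong refl) (simp add: sign_def)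
  also have "\<dots> = fact n * hankel_det n \<mu>"
    by (simp add: card_permutations[of "{0..<n}" n])
  finally show ?thesis by (simp only: sq)
qed

text \<open>The permutation that sorts distinct entries decreasingly: the position of an entry is
  the number of larger ones. Outside the index range it is the identity, as \<open>permutes\<close>
  demands.\<close>

definition rank_of :: "nat \<Rightarrow> (nat \<Rightarrow> nat) \<Rightarrow> nat \<Rightarrow> nat" where
  "rank_of n k i = (if i < n then card {j. j < n \<and> k j > k i} else i)"

lemma rank_of_less: "i < n \<Longrightarrow> j < n \<Longrightarrow> k j < k i \<Longrightarrow> rank_of n k i < rank_of n k j"
  unfolding rank_of_def by (auto intro!: psubset_card_mono)

lemma rank_of_permutes:
  assumes "inj_on k {..<n}"
  shows "rank_of n k permutes {..<n}"
proof (rule bij_imp_permutes)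
  have "inj_on (rank_of n k) {..<n}"
  proof (rule inj_onI)
    fix i j assume ij: "i \<in> {..<n}" "j \<in> {..<n}" "rank_of n k i = rank_of n k j"
    then have "\<not> k i < k j" "\<not> k j < k i" using rank_of_less[of _ n _ k] by fastforce+
    then show "i = j" using assms ij by (auto dest: inj_onD)
  qed
  moreover have "rank_of n k ` {..<n} \<subseteq> {..<n}"
  proof
    fix r assume "r \<in> rank_of n k ` {..<n}"
    then obtain i where i: "i < n" "r = card {j. j < n \<and> k j > k i}" by (auto simp: rank_of_def)
    have "{j. j < n \<and> k j > k i} \<subset> {..<n}" using i by auto
    then have "card {j. j < n \<and> k j > k i} < card {..<n}" by (intro psubset_card_mono) auto
    then show "r \<in> {..<n}" using i by simp
  qed
  ultimately show "bij_betw (rank_of n k) {..<n} {..<n}"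
    by (simp add: bij_betw_def endo_inj_surj)
qed (simp add: rank_of_def)

text \<open>A rearranged decreasing tuple remembers its permutation: the entries larger than the one
  at \<open>i\<close> sit at those \<open>j\<close> with \<open>p j < p i\<close>, and there are
  \<open>p i\<close> of them. This makes different rearrangements disjoint.\<close>

lemma rank_of_decreasing_comp:
  assumes "strict_antimono_on {..<n} k" "p permutes {..<n}"
  shows "rank_of n (k \<circ> p) = p"
proof
  fix i
  show "rank_of n (k \<circ> p) i = p i"
  proof (cases "i < n")
    case True
    have p: "p j < n \<longleftrightarrow> j < n" for j using assms(2) permutes_in_image[of p "{..<n}" j] by auto
    have "k (p j) > k (p i) \<longleftrightarrow> p j < p i" if "j < n" for j
      using assms(1) that True p[of i] p[of j] unfolding monotone_on_def
      by (metis lessThan_iff linorder_neqE_nat order_less_asym order_less_irrefl)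
    then have "{j. j < n \<and> (k \<circ> p) j > (k \<circ> p) i} = {j. j < n \<and> p j < p i}" by auto
    moreover have "bij_betw p {j. j < n \<and> p j < p i} {..<p i}"
    proof (rule bij_betwI')
      fix y assume "y \<in> {..<p i}"
      then have "y \<in> p ` {..<n}" using permutes_image[OF assms(2)] p[of i] True by auto
      then show "\<exists>x\<in>{j. j < n \<and> p j < p i}. y = p x" using \<open>y \<in> {..<p i}\<close> by auto
    qed (use permutes_inj[OF assms(2)] in \<open>auto dest: injD\<close>)
    ultimately show ?thesis
      using True by (simp add: rank_of_def bij_betw_same_card)
  next
    case False
    then show ?thesis using permutes_not_in[OF assms(2), of i] by (simp add: rank_of_def)
  qed
qed

text \<open>Tuples with distinct keys split into \<open>fact n\<close> disjoint rearrangements of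
  the decreasing ones. By symmetry each class has the same sum, and tuples with a repeated key
  contribute 0.\<close>

lemma has_sum_decreasing_tuples:
  fixes h :: "(nat \<Rightarrow> 'a) \<Rightarrow> complex" and key :: "'a \<Rightarrow> nat"
  assumes h: "(h has_sum (fact n * S)) ({..<n} \<rightarrow>\<^sub>E Z)"
    and sym: "\<And>z p. p permutes {..<n} \<Longrightarrow> h (z \<circ> p) = h z"
    and zero: "\<And>z. \<not> inj_on (key \<circ> z) {..<n} \<Longrightarrow> h z = 0"
  shows "(h has_sum S) {z \<in> {..<n} \<rightarrow>\<^sub>E Z. strict_antimono_on {..<n} (key \<circ> z)}" (is "(h has_sum S) ?D")
proof -
  let ?S = "{p. p permutes {..<n}}"
  have compE: "z \<circ> p \<in> {..<n} \<rightarrow>\<^sub>E Z" if z: "z \<in> {..<n} \<rightarrow>\<^sub>E Z" and p: "p permutes {..<n}" for z p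
  proof (rule PiE_I)
    show "(z \<circ> p) i \<in> Z" if "i \<in> {..<n}" for i
      using that PiE_mem[OF z, of "p i"] permutes_in_image[OF p, of i] by simp
    show "(z \<circ> p) i = undefined" if "i \<notin> {..<n}" for i
      using that PiE_arb[OF z, of i] permutes_not_in[OF p, of i] by simp
  qed
  have "h summable_on ?D"
    by (rule summable_on_subset[OF has_sum_imp_summable[OF h]]) auto
  then obtain T where T: "(h has_sum T) ?D" by (auto simp: summable_on_def)
  have inj: "inj_on (\<lambda>z. z \<circ> p) X" if "p permutes {..<n}" for p and X :: "(nat \<Rightarrow> 'a) set"
    by (rule inj_onI) (metis comp_assoc comp_id permutes_inv_o(1) that)
  have Tp: "(h has_sum T) ((\<lambda>z. z \<circ> p) ` ?D)" if "p \<in> ?S" for p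
    using that T sym by (subst has_sum_reindex) (auto simp: o_def[of h] intro: inj)
  have union: "(\<Union>p\<in>?S. (\<lambda>z. z \<circ> p) ` ?D) = {z \<in> {..<n} \<rightarrow>\<^sub>E Z. inj_on (key \<circ> z) {..<n}}"
  proof (intro equalityI subsetI)
    fix z assume "z \<in> (\<Union>p\<in>?S. (\<lambda>z. z \<circ> p) ` ?D)"
    then obtain p w where p: "p permutes {..<n}" and w: "w \<in> ?D" and z: "z = w \<circ> p" by auto
    have "inj_on (key \<circ> w) {..<n}"
    proof (rule linorder_inj_onI')
      fix i j assume ij: "i \<in> {..<n}" "j \<in> {..<n}" "i < j"
      then have "(key \<circ> w) j < (key \<circ> w) i" using w by (auto simp: monotone_on_def)
      then show "(key \<circ> w) i \<noteq> (key \<circ> w) j" by simp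
    qed
    then have "inj_on (key \<circ> w) (p ` {..<n})" using permutes_image[OF p] by simp
    then have "inj_on ((key \<circ> w) \<circ> p) {..<n}" by (rule comp_inj_on[OF permutes_inj_on[OF p]])
    then show "z \<in> {z \<in> {..<n} \<rightarrow>\<^sub>E Z. inj_on (key \<circ> z) {..<n}}"
      using w p compE by (simp add: z comp_assoc)
  next
    fix z assume z: "z \<in> {z \<in> {..<n} \<rightarrow>\<^sub>E Z. inj_on (key \<circ> z) {..<n}}"
    define p where "p = rank_of n (key \<circ> z)"
    have p: "p permutes {..<n}" using z by (auto simp: p_def intro: rank_of_permutes)
    define w where "w = z \<circ> inv_into UNIV p"
    have ip: "inv_into UNIV p permutes {..<n}" using p by (rule permutes_inv)
    have "(key \<circ> w) s < (key \<circ> w) r" if rs: "r < n" "s < n" "r < s" for r s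
    proof -
      have lt: "inv_into UNIV p r < n" "inv_into UNIV p s < n" using rs permutes_in_image[OF ip, of r] permutes_in_image[OF ip, of s] by simp_all
      have eq: "p (inv_into UNIV p r) = r" "p (inv_into UNIV p s) = s" using permutes_inverses(1)[OF p] by simp_all
      have "\<not> (key \<circ> z) (inv_into UNIV p r) < (key \<circ> z) (inv_into UNIV p s)"
        using rank_of_less[OF lt(2,1), of "key \<circ> z"] rs(3) eq unfolding p_def[symmetric] by auto
      moreover have "(key \<circ> z) (inv_into UNIV p r) \<noteq> (key \<circ> z) (inv_into UNIV p s)"
      proof
        assume e: "(key \<circ> z) (inv_into UNIV p r) = (key \<circ> z) (inv_into UNIV p s)"
        have "inv_into UNIV p r = inv_into UNIV p s"
          by (rule inj_onD[where f = "key \<circ> z" and A = "{..<n}"]) (use z lt e in simp_all)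
        then show False using eq rs(3) by (metis less_irrefl)
      qed
      ultimately show ?thesis by (simp add: w_def)
    qed
    then have "w \<in> ?D"
      using z compE[OF _ ip] by (auto simp: w_def monotone_on_def)
    moreover have "z = w \<circ> p"
      using p by (simp add: w_def comp_assoc permutes_inv_o)
    ultimately show "z \<in> (\<Union>p\<in>?S. (\<lambda>z. z \<circ> p) ` ?D)" using p by blast
  qed
  have disj: "(\<lambda>z. z \<circ> p) ` ?D \<inter> (\<lambda>z. z \<circ> p') ` ?D = {}" if "p \<in> ?S" "p' \<in> ?S" "p \<noteq> p'" for p p'
  proof (rule ccontr)
    assume "\<not> ?thesis"
    then obtain w w' where w: "w \<in> ?D" "w' \<in> ?D" "w \<circ> p = w' \<circ> p'" by blast
    then have "rank_of n ((key \<circ> w) \<circ> p) = rank_of n ((key \<circ> w') \<circ> p')" by (simp add: comp_assoc)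
    then show False using w that by (simp add: rank_of_decreasing_comp)
  qed
  have "(h has_sum (\<Sum>p\<in>?S. T)) (\<Union>p\<in>?S. (\<lambda>z. z \<circ> p) ` ?D)"
    by (rule sum_has_sum) (use Tp disj in \<open>auto intro: finite_permutations\<close>)
  then have "(h has_sum (fact n * T)) {z \<in> {..<n} \<rightarrow>\<^sub>E Z. inj_on (key \<circ> z) {..<n}}"
    unfolding union by (simp add: card_permutations[of "{..<n}" n])
  also have "?this \<longleftrightarrow> (h has_sum (fact n * T)) ({..<n} \<rightarrow>\<^sub>E Z)"
    by (rule has_sum_cong_neutral) (auto simp: zero)
  finally have "fact n * T = fact n * S" using h has_sum_unique by blast
  then show ?thesis using T by simp
qed

subsection \<open>The multiple sums\<close>

text \<open>Permuting the nodes permutes the rows of the Vandermonde matrix, which changes its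
  determinant by a sign at most.\<close>

lemma vandermonde_square_permute:
  fixes y :: "nat \<Rightarrow> 'a::idom"
  assumes "p permutes {..<n}"
  shows "(\<Prod>s<n. \<Prod>r<s. (y (p s) - y (p r))\<^sup>2) = (\<Prod>s<n. \<Prod>r<s. (y s - y r)\<^sup>2)"
proof -
  let ?V = "\<lambda>y. Determinant.det (Matrix.mat n n (\<lambda>(i, j). y i ^ j))"
  have p: "p permutes {0..<n}" using assms by (simp add: atLeast0LessThan)
  have "Matrix.mat n n (\<lambda>(i, j). Matrix.mat n n (\<lambda>(i, j). y i ^ j) $$ (p i, j)) = Matrix.mat n n (\<lambda>(i, j). y (p i) ^ j)"
    using permutes_in_image[OF assms] by (intro eq_matI) auto
  then have "?V (\<lambda>i. y (p i)) = signof p * ?V y"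
    using det_permute_rows[of "Matrix.mat n n (\<lambda>(i, j). y i ^ j)" n p] p by simp
  then have "(?V (\<lambda>i. y (p i)))\<^sup>2 = (?V y)\<^sup>2"
    by (simp add: power_mult_distrib sign_def)
  then show ?thesis
    unfolding det_vandermonde by (simp add: prod_power_distrib)
qed

lemma prod_atLeast1_lessThan_Suc: "(\<Prod>r=1..<Suc s. F r) = (\<Prod>r<s. F (Suc r))"
  by (induction s) auto

text \<open>Andreief's identity for pairs \<open>(m, y)\<close> with weight
  \<open>m ^ k * q ^ (m * y)\<close> and node \<open>m\<^sup>2\<close>. Equal values of
  \<open>m\<close> give a vanishing Vandermonde factor, so restriction to decreasing
  \<open>m\<close> removes exactly the factor \<open>fact n\<close>.\<close>

lemma (in nome) has_sum_triangular_term: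
  assumes M: "M \<subseteq> {1..}"
  shows "(triangular_term k q n has_sum hankel_det n (\<lambda>j. \<Sum>\<^sub>\<infinity>m\<in>M. of_nat m ^ (k + 2 * j) * csch q (int m))) (tuples M n)"
proof -
  define Z where "Z = M \<times> {y::nat. odd y}"
  define g where "g = (\<lambda>(m::nat, y::nat). of_nat m ^ k * q ^ (m * y))"
  define x where "x = (\<lambda>(m::nat, y::nat). (of_nat m)\<^sup>2 :: complex)"
  define \<mu> where "\<mu> = (\<lambda>j. \<Sum>\<^sub>\<infinity>m\<in>M. of_nat m ^ (k + 2 * j) * csch q (int m))"
  define h where "h = (\<lambda>z. (\<Prod>i<n. g (z i)) * (\<Prod>s<n. \<Prod>r<s. (x (z s) - x (z r))\<^sup>2))"
  have "((\<lambda>z. g z * x z ^ j) has_sum \<mu> j) Z" for j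
    using has_sum_lambert_pairs[OF M, of "k + 2 * j"]
    by (simp add: g_def x_def Z_def \<mu>_def case_prod_unfold power_add mult_ac flip: power_mult)
  then have all: "(h has_sum fact n * hankel_det n \<mu>) ({..<n} \<rightarrow>\<^sub>E Z)"
    unfolding h_def by (rule has_sum_andreief)
  have dec: "(h has_sum hankel_det n \<mu>) {z \<in> {..<n} \<rightarrow>\<^sub>E Z. strict_antimono_on {..<n} (fst \<circ> z)}"
  proof (rule has_sum_decreasing_tuples[OF all])
    show "h (z \<circ> p) = h z" if "p permutes {..<n}" for z p
    proof -
      have "(\<Prod>i<n. g (z (p i))) = (\<Prod>i<n. g (z i))"
        using prod.permute[OF that, of "\<lambda>i. g (z i)"] by (simp add: o_def)
      moreover have "(\<Prod>s<n. \<Prod>r<s. (x (z (p s)) - x (z (p r)))\<^sup>2) = (\<Prod>s<n. \<Prod>r<s. (x (z s) - x (z r))\<^sup>2)"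
        by (rule vandermonde_square_permute[OF that, of "\<lambda>i. x (z i)"])
      ultimately show ?thesis by (simp add: h_def)
    qed
    show "h z = 0" if ninj: "\<not> inj_on (fst \<circ> z) {..<n}" for z
    proof -
      obtain r s where rs: "r < s" "s < n" "fst (z r) = fst (z s)"
        using ninj linorder_inj_onI'[of "{..<n}" "fst \<circ> z"] by auto
      then have "x (z s) - x (z r) = 0" by (simp add: x_def case_prod_unfold)
      then have "(\<Prod>r<s. (x (z s) - x (z r))\<^sup>2) = 0"
        using rs by (intro prod_zero) auto
      then have "(\<Prod>s<n. \<Prod>r<s. (x (z s) - x (z r))\<^sup>2) = 0"
        using rs by (intro prod_zero) auto
      then show ?thesis by (simp add: h_def)
    qed
  qed
  \<comment> \<open>Translation between tuples of pairs indexed from 0 and the pairs of tuples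
    indexed from 1 in \<open>tuples\<close>; \<open>restrict\<close> keeps both sides
    extensional.\<close>
  define to where "to = (\<lambda>z. (\<lambda>r\<in>{1..n}. fst (z (r - 1) :: nat \<times> nat), \<lambda>r\<in>{1..n}. snd (z (r - 1) :: nat \<times> nat)))"
  define from' where "from' = (\<lambda>(m, y). \<lambda>s\<in>{..<n}. (m (Suc s) :: nat, y (Suc s) :: nat))"
  have "(h has_sum hankel_det n \<mu>) {z \<in> {..<n} \<rightarrow>\<^sub>E Z. strict_antimono_on {..<n} (fst \<circ> z)} \<longleftrightarrow>
    (triangular_term k q n has_sum hankel_det n \<mu>) (tuples M n)"
  proof (rule has_sum_reindex_bij_witness[of _ from' to])
    fix z assume z: "z \<in> {z \<in> {..<n} \<rightarrow>\<^sub>E Z. strict_antimono_on {..<n} (fst \<circ> z)}"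
    show "from' (to z) = z"
    proof
      fix i
      show "from' (to z) i = z i"
        using z PiE_arb[of z "{..<n}" "\<lambda>_. Z" i] by (cases "i < n") (auto simp: from'_def to_def)
    qed
    have mem: "fst (z i) \<in> M" "odd (snd (z i))" if "i < n" for i
      using PiE_mem[of z "{..<n}" "\<lambda>_. Z" i] z that by (auto simp: Z_def mem_Times_iff)
    have dec: "fst (z s) < fst (z r)" if "r < s" "s < n" for r s
      using z that by (auto simp: monotone_on_def)
    show "to z \<in> tuples M n"
      unfolding tuples_def to_def
      using mem dec by (auto simp: monotone_on_def)
    have 1: "(\<Prod>r=1..n. F r) = (\<Prod>i<n. F (Suc i))" for F :: "nat \<Rightarrow> complex"
      by (simp add: prod.atLeast1_atMost_eq)
    have 2: "(\<Sum>r=1..n. F r) = (\<Sum>i<n. F (Suc i))" for F :: "nat \<Rightarrow> nat"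
      by (simp add: sum.atLeast1_atMost_eq)
    have "triangular_term k q n (to z) = (\<Prod>i<n. of_nat (fst (z i))) ^ k * q ^ (\<Sum>i<n. fst (z i) * snd (z i)) *
        (\<Prod>s<n. \<Prod>r<s. ((of_nat (fst (z r)))\<^sup>2 - (of_nat (fst (z s)))\<^sup>2)\<^sup>2)"
      unfolding triangular_term_def to_def prod.case 1 2 prod_atLeast1_lessThan_Suc
      by (intro arg_cong2[of _ _ _ _ times] arg_cong[of _ _ "\<lambda>x. x ^ k"] arg_cong[of _ _ "(^) q"] prod.cong sum.cong) auto
    also have "(\<Prod>i<n. of_nat (fst (z i))) ^ k * q ^ (\<Sum>i<n. fst (z i) * snd (z i)) = (\<Prod>i<n. g (z i))"
      by (simp add: g_def case_prod_unfold prod.distrib prod_power_distrib power_sum)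
    also have "(\<Prod>s<n. \<Prod>r<s. ((of_nat (fst (z r)))\<^sup>2 - (of_nat (fst (z s)))\<^sup>2)\<^sup>2) =
        (\<Prod>s<n. \<Prod>r<s. (x (z s) - x (z r))\<^sup>2)"
      unfolding x_def case_prod_unfold by (intro prod.cong refl power2_commute)
    also have "(\<Prod>i<n. g (z i)) * \<dots> = h z" by (simp only: h_def)
    finally show "triangular_term k q n (to z) = h z" .
  next
    fix b assume b: "b \<in> tuples M n"
    obtain m y where my: "b = (m, y)" by (cases b)
    have m: "m \<in> {1..n} \<rightarrow>\<^sub>E M" and y: "y \<in> {1..n} \<rightarrow>\<^sub>E {k. odd k}" and anti: "strict_antimono_on {1..n} m"
      using b by (auto simp: tuples_def my)
    have "(\<lambda>r\<in>{1..n}. m (Suc (r - 1))) = m"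
    proof
      fix r show "(\<lambda>r\<in>{1..n}. m (Suc (r - 1))) r = m r"
        using PiE_arb[OF m, of r] by (cases "r \<in> {1..n}") auto
    qed
    moreover have "(\<lambda>r\<in>{1..n}. y (Suc (r - 1))) = y"
    proof
      fix r show "(\<lambda>r\<in>{1..n}. y (Suc (r - 1))) r = y r"
        using PiE_arb[OF y, of r] by (cases "r \<in> {1..n}") auto
    qed
    moreover have "to (from' b) = (\<lambda>r\<in>{1..n}. m (Suc (r - 1)), \<lambda>r\<in>{1..n}. y (Suc (r - 1)))"
      unfolding to_def from'_def my by (auto intro!: restrict_ext)
    ultimately show "to (from' b) = b" by (simp add: my)
    have mem: "m (Suc s) \<in> M" "odd (y (Suc s))" if "s < n" for s
      using PiE_mem[OF m, of "Suc s"] PiE_mem[OF y, of "Suc s"] that by auto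
    have "m (Suc s) < m (Suc r)" if "r < s" "s < n" for r s
      using anti that by (auto simp: monotone_on_def)
    then show "from' b \<in> {z \<in> {..<n} \<rightarrow>\<^sub>E Z. strict_antimono_on {..<n} (fst \<circ> z)}"
      using mem by (auto simp: from'_def my Z_def monotone_on_def)
  qed simp
  then show ?thesis using dec by (simp add: \<mu>_def)
qed

section \<open>Closed forms of the determinants and the two identities\<close>

lemma prod_odd_lambert_closed_form:
  fixes A :: complex
  shows "(\<Prod>m<n. A * (16 * A ^ 2) ^ m * fact (2 * m) * fact (2 * m + 1)) =
    4 ^ (n * (n - 1)) * A ^ n\<^sup>2 * (\<Prod>r<2 * n. fact r)"
proof (induction n)
  case (Suc n)
  have e: "Suc n * (Suc n - 1) = n * (n - 1) + 2 * n" "(Suc n)\<^sup>2 = n\<^sup>2 + (2 * n + 1)"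
    by (cases n; simp add: power2_eq_square algebra_simps)+
  have 16: "(16 * A ^ 2) ^ n = 4 ^ (2 * n) * A ^ (2 * n)"
    by (simp add: power_mult_distrib power_mult)
  have f: "(\<Prod>r<2 * Suc n. fact r) = (\<Prod>r<2 * n. fact r) * fact (2 * n) * (fact (2 * n + 1) :: complex)"
    by simp
  show ?case
    unfolding prod.lessThan_Suc Suc e f 16 power_add power_one_right by (simp only: mult_ac)
qed simp

lemma prod_even_lambert_closed_form:
  fixes A :: complex
  shows "(\<Prod>m<n. A ^ (2 * m + 2) * fact (2 * m + 1) * fact (2 * m + 2) / 2) =
    A ^ (n * (n + 1)) * (\<Prod>r=1..2 * n. fact r) / 2 ^ n"
proof (induction n)
  case (Suc n)
  have e: "Suc n * (Suc n + 1) = n * (n + 1) + (2 * n + 2)" by simp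
  have f: "(\<Prod>r=1..2 * Suc n. fact r) = (\<Prod>r=1..2 * n. fact r) * fact (2 * n + 1) * (fact (2 * n + 2) :: complex)"
    by (simp add: prod.nat_ivl_Suc')
  have "a / b * (c * d1 * d2 / 2) = a * c * d1 * d2 / (2 * b)" for a b c d1 d2 :: complex
    by (simp add: mult_ac)
  then show ?case
    unfolding prod.lessThan_Suc Suc e f power_add[of A "n * (n + 1)"] power_Suc by (simp add: mult_ac)
qed simp

theorem corollary7p6:
  fixes q :: complex and n :: nat
  assumes "0 < norm q" and "norm q < 1" and "n \<ge> 1"
  shows "(triangular_term 1 q n summable_on tuples {k. odd k} n \<and>
          Delta (q\<^sup>2) ^ (4 * n\<^sup>2) =
            4 powi (- (int n * (int n - 1))) * q powi (- ((int n)\<^sup>2)) *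
            (\<Prod>r=1..2*n-1. inverse (fact r)) *
            (\<Sum>\<^sub>\<infinity>p\<in>tuples {k. odd k} n. triangular_term 1 q n p)) \<and>
         (triangular_term 3 q n summable_on tuples {k. k \<ge> 1} n \<and>
          Delta q ^ (4 * n * (n + 1)) =
            2 ^ n * q powi (- (int n * (int n + 1) div 2)) *
            (\<Prod>r=1..2*n. inverse (fact r)) *
            (\<Sum>\<^sub>\<infinity>p\<in>tuples {k. k \<ge> 1} n. triangular_term 3 q n p))"
proof (intro conjI)
  interpret nome q by unfold_locales (use assms in auto)
  have 1: "(triangular_term 1 q n has_sum hankel_det n (\<lambda>k. odd_lambert (2 * k + 1))) (tuples {k. odd k} n)"
    using has_sum_triangular_term[of "{k. odd k}" 1 n]
    by (simp add: odd_lambert_def add.commute Suc_le_eq odd_pos subset_iff)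
  then show "triangular_term 1 q n summable_on tuples {k. odd k} n"
    by (rule has_sum_imp_summable)
  define D where "D = Delta (q\<^sup>2) ^ (4 * n\<^sup>2)"
  have "(q * Delta (q\<^sup>2) ^ 4) ^ n\<^sup>2 = q ^ n\<^sup>2 * D"
    by (simp add: D_def power_mult_distrib flip: power_mult)
  then have s1: "(\<Sum>\<^sub>\<infinity>p\<in>tuples {k. odd k} n. triangular_term 1 q n p) =
      4 ^ (n * (n - 1)) * (q ^ n\<^sup>2 * D) * (\<Prod>r<2 * n. fact r)"
    using infsumI[OF 1] by (simp only: hankel_det_odd_lambert prod_odd_lambert_closed_form odd_lambert_1)
  \<comment> \<open>The closed form starts at index 0, the statement at 1; they agree because
    \<open>fact 0 = 1\<close>.\<close>
  have "{..<2 * n} = insert 0 {1..2 * n - 1}" using assms(3) by auto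
  then have f1: "(\<Prod>r=1..2*n-1. inverse (fact r)) * (\<Prod>r<2 * n. fact r) = (1 :: complex)"
    by (simp add: prod_inversef[symmetric] flip: prod.distrib)
  have "int (n * (n - 1)) = int n * (int n - 1)" using assms(3) by (simp add: of_nat_diff)
  then have p1: "4 powi (- (int n * (int n - 1))) = inverse (4 ^ (n * (n - 1)) :: complex)"
    by (metis power_int_minus power_int_of_nat)
  have "int (n\<^sup>2) = (int n)\<^sup>2" by simp
  then have p2: "q powi (- ((int n)\<^sup>2)) = inverse (q ^ n\<^sup>2)"
    by (metis power_int_minus power_int_of_nat)
  have gen: "inverse a * inverse b * F * (a * (b * D) * F') = (F * F') * D" if "a \<noteq> 0" "b \<noteq> 0" for a b F F' :: complex
    using that by (simp add: field_simps)
  show "Delta (q\<^sup>2) ^ (4 * n\<^sup>2) =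
            4 powi (- (int n * (int n - 1))) * q powi (- ((int n)\<^sup>2)) *
            (\<Prod>r=1..2*n-1. inverse (fact r)) *
            (\<Sum>\<^sub>\<infinity>p\<in>tuples {k. odd k} n. triangular_term 1 q n p)"
    unfolding s1 p1 p2 D_def[symmetric] by (subst gen) (use f1 q_nz in simp_all)
next
  \<comment> \<open>The series of the second identity in \<open>q\<close> is
    \<open>even_lambert\<close> for the nome \<open>p\<close>, since
    \<open>csch p (2 * m) = csch q m\<close>.\<close>
  define p where "p = csqrt q"
  have p: "p\<^sup>2 = q" by (simp add: p_def)
  interpret q: nome q by unfold_locales (use assms in auto)
  have "norm p < 1"
    using assms(2) unfolding p[symmetric] by (simp add: norm_power power_less_one_iff)
  then interpret nome p by unfold_locales (use assms p in auto)
  have ev: "(\<Sum>\<^sub>\<infinity>m\<in>{m. m \<ge> 1}. of_nat m ^ (3 + 2 * k) * csch q (int m)) = even_lambert (2 * k + 3)" for k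
    unfolding even_lambert_def csch_square[unfolded p] by (simp only: add.commute)
  have 1: "(triangular_term 3 q n has_sum hankel_det n (\<lambda>k. even_lambert (2 * k + 3))) (tuples {k. k \<ge> 1} n)"
    using q.has_sum_triangular_term[of "{k. k \<ge> 1}" 3 n] unfolding ev by (simp add: atLeast_def)
  then show "triangular_term 3 q n summable_on tuples {k. k \<ge> 1} n"
    by (rule has_sum_imp_summable)
  define D where "D = Delta q ^ (4 * n * (n + 1))"
  \<comment> \<open>Halving the exponent is exact and turns \<open>p ^ (n * (n + 1))\<close> into a
    power of \<open>q\<close>, so the chosen square root leaves no trace.\<close>
  define t where "t = n * (n + 1) div 2"
  have t: "n * (n + 1) = 2 * t" by (simp add: t_def)
  have "(p * Delta (p\<^sup>2) ^ 4) ^ (n * (n + 1)) = p ^ (n * (n + 1)) * D"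
    unfolding D_def p mult.assoc[of 4] by (simp only: power_mult_distrib power_mult[symmetric])
  also have "p ^ (n * (n + 1)) = q ^ t" unfolding t power_mult p ..
  finally have s1: "(\<Sum>\<^sub>\<infinity>p\<in>tuples {k. k \<ge> 1} n. triangular_term 3 q n p) =
      (q ^ t * D) * (\<Prod>r=1..2 * n. fact r) / 2 ^ n"
    using infsumI[OF 1] by (simp only: hankel_det_even_lambert prod_even_lambert_closed_form odd_lambert_1)
  have f1: "(\<Prod>r=1..2*n. inverse (fact r)) * (\<Prod>r=1..2 * n. fact r) = (1 :: complex)"
    by (simp flip: prod.distrib)
  have "int t = int n * (int n + 1) div 2" unfolding t_def by (simp add: zdiv_int algebra_simps)
  then have p2: "q powi (- (int n * (int n + 1) div 2)) = inverse (q ^ t)"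
    by (metis power_int_minus power_int_of_nat)
  have gen: "a * inverse b * F * (b * D * F' / a) = (F * F') * D" if "a \<noteq> 0" "b \<noteq> 0" for a b F F' :: complex
    using that by (simp add: field_simps)
  show "Delta q ^ (4 * n * (n + 1)) =
            2 ^ n * q powi (- (int n * (int n + 1) div 2)) *
            (\<Prod>r=1..2*n. inverse (fact r)) *
            (\<Sum>\<^sub>\<infinity>p\<in>tuples {k. k \<ge> 1} n. triangular_term 3 q n p)"
    unfolding s1 p2 D_def[symmetric] by (subst gen) (use f1 q.q_nz in simp_all)
qed

end
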